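(* Let $(X_1,X_2,X_3)$, $I=\{1,2,3\}$, be a basic partition of $(X,\mu)$ into three cells and let the two composite partitions be $\mathcal{J}_A=\{\{1,2\},\{3\}\}$ and $\mathcal{J}_B=\{\{1\},\{2,3\}\}$. Let $\pi^{(0)}\in\Pi(\mu,\nu)$ be arbitrary and let $(\pi^{(\ell)})_{\ell\ge 0}$ be the iterates of the entropic domain decomposition algorithm. Then for all $\ell>1$ $$\Delta(\pi^{(\ell)})\le\left(1+\exp\left(-\tfrac{2\|c\|}{\varepsilon}\right)\frac{\|\mu_2\|}{\|\mu_{\{1,3\}}\|}\right)^{-1}\cdot\Delta(\pi^{(\ell-1)}),$$ where $\mu_{\{1,3\}}=\mu_1+\mu_3$. In particular, $\pi^{(\ell)}$ converges (weakly-$\ast$) to the optimal solution $\pi^\ast$ as $\ell\to\infty$.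
   Context: $X,Y$ are compact metric spaces, $\mu$ and $\nu$ are (Radon) probability measures on $X$ and $Y$, $c\in L^\infty(X\times Y,\mu\otimes\nu)$ is non-negative, $\|c\|$ is its $L^\infty$ norm, $\varepsilon>0$, $k=\exp(-c/\varepsilon)$, and $K=k\cdot(\mu\otimes\nu)$. The norm $\|\rho\|$ of a non-negative measure is its total mass; $\rho\llcorner S$ denotes restriction. $P_X,P_Y$ map a measure on $X\times Y$ to its marginals. For non-negative measures $\hat\mu,\hat\nu$ of equal mass, $\Pi(\hat\mu,\hat\nu)$ is the set of non-negative measures on $X\times Y$ with marginals $\hat\mu,\hat\nu$. $\mathrm{KL}(\rho|\sigma)=\int\varphi(\frac{d\rho}{d\sigma})\,d\sigma$ if $\rho\ll\sigma$, $\rho\ge0$, and $+\infty$ otherwise, where $\varphi(s)=s\log s-s+1$ for $s>0$, $\varphi(0)=1$. The problem is $\min\{\varepsilon\,\mathrm{KL}(\pi|K):\pi\in\Pi(\mu,\nu)\}$; it has a unique minimizer $\pi^\ast$. Suboptimality: $\Delta(\pi)=\mathrm{KL}(\pi|K)-\mathrm{KL}(\pi^\ast|K)$ for $\pi\in\Pi(\mu,\nu)$. Basic partition: a finite partition $\{X_i\}_{i\in I}$ of $X$ into measurable sets such that $\mu_i:=\mu\llcorner X_i$ satisfies $\|\mu_i\|>0$. Composite partition: a partition $\mathcal J$ of $I$; for $J\in\mathcal J$, $X_J=\bigcup_{i\in J}X_i$ and $\mu_J=\mu\llcorner X_J$. Entropic domain decomposition algorithm: given $\pi^{(0)}\in\Pi(\mu,\nu)$,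 for $\ell=1,2,\ldots$ let $\mathcal J^{(\ell)}=\mathcal J_A$ if $\ell$ is odd and $\mathcal J_B$ if $\ell$ is even. For each $J\in\mathcal J^{(\ell)}$ set $\nu_J^{(\ell)}=P_Y(\pi^{(\ell-1)}\llcorner(X_J\times Y))$ and let $\pi_J^{(\ell)}$ be the unique minimizer of $\varepsilon\,\mathrm{KL}(\cdot|K)$ over $\Pi(\mu_J,\nu_J^{(\ell)})$. Then $\pi^{(\ell)}=\sum_{J\in\mathcal J^{(\ell)}}\pi_J^{(\ell)}$. *)

theory Defs
  imports "HOL-Probability.Probability"
begin

text \<open>
  Compact metric spaces are rendered as types of class \<open>metric_space\<close> whose universe is compact.
  All measures on \<open>X \<times> Y\<close> live on the product sigma-algebra \<open>borel \<Otimes>\<^sub>M borel\<close>, which for compact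
  metric (hence second countable) spaces is the Borel sigma-algebra of the product.
  On a compact metric space every finite Borel measure is Radon, so no regularity is required.
\<close>

definition Linfty :: "'z measure \<Rightarrow> ('z \<Rightarrow> real) set" where
  "Linfty M = {f \<in> borel_measurable M. esssup M (\<lambda>z. ereal \<bar>f z\<bar>) < \<infinity>}"

definition Linfty_norm :: "'z measure \<Rightarrow> ('z \<Rightarrow> real) \<Rightarrow> real" where
  "Linfty_norm M f = real_of_ereal (esssup M (\<lambda>z. ereal \<bar>f z\<bar>))"

definition mass :: "'z measure \<Rightarrow> real" where
  "mass M = measure M (space M)"

text \<open>The restriction of a measure to \<open>S\<close>, as a measure on the original space (not on \<open>S\<close>).\<close>

definition restr :: "'z measure \<Rightarrow> 'z set \<Rightarrow> 'z measure" where
  "restr M S = density M (indicator S)"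

text \<open>The sum of the measures \<open>N i\<close>, \<open>i \<in> I\<close> (\<open>I\<close> finite), all of them on the measurable space \<open>M\<close>.\<close>

definition sum_measure :: "'z measure \<Rightarrow> 'i set \<Rightarrow> ('i \<Rightarrow> 'z measure) \<Rightarrow> 'z measure" where
  "sum_measure M I N = measure_of (space M) (sets M) (\<lambda>A. \<Sum>i\<in>I. emeasure (N i) A)"

definition marginal_X :: "('a::topological_space \<times> 'b::topological_space) measure \<Rightarrow> 'a measure" where
  "marginal_X \<pi> = distr \<pi> borel fst"

definition marginal_Y :: "('a::topological_space \<times> 'b::topological_space) measure \<Rightarrow> 'b measure" where
  "marginal_Y \<pi> = distr \<pi> borel snd"

definition couplings ::
  "'a::topological_space measure \<Rightarrow> 'b::topological_space measure \<Rightarrow> ('a \<times> 'b) measure set" where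
  "couplings \<mu> \<nu> =
     {\<pi>. sets \<pi> = sets (borel \<Otimes>\<^sub>M borel) \<and> marginal_X \<pi> = \<mu> \<and> marginal_Y \<pi> = \<nu>}"

definition phi :: "real \<Rightarrow> real" where
  "phi s = (if s > 0 then s * ln s - s + 1 else 1)"

text \<open>As \<open>phi\<close> is non-negative, the defining integral is a non-negative Lebesgue integral, which
  may be infinite. The density is finite almost everywhere as the measures at hand are finite.\<close>

definition KL :: "'z measure \<Rightarrow> 'z measure \<Rightarrow> ereal" where
  "KL \<rho> \<sigma> =
     (if absolutely_continuous \<sigma> \<rho>
      then enn2ereal (\<integral>\<^sup>+ z. ennreal (phi (enn2real (RN_deriv \<sigma> \<rho> z))) \<partial>\<sigma>)
      else \<infinity>)"

definition gibbs ::
  "real \<Rightarrow> ('a \<times> 'b \<Rightarrow> real) \<Rightarrow> 'a measure \<Rightarrow> 'b measure \<Rightarrow> ('a \<times> 'b) measure" where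
  "gibbs \<epsilon> c \<mu> \<nu> = density (\<mu> \<Otimes>\<^sub>M \<nu>) (\<lambda>z. ennreal (exp (- c z / \<epsilon>)))"

definition entropic_minimizer ::
  "real \<Rightarrow> ('a::topological_space \<times> 'b::topological_space) measure
    \<Rightarrow> 'a measure \<Rightarrow> 'b measure \<Rightarrow> ('a \<times> 'b) measure \<Rightarrow> bool" where
  "entropic_minimizer \<epsilon> K \<mu> \<nu> = is_arg_min (\<lambda>\<pi>. ereal \<epsilon> * KL \<pi> K) (\<lambda>\<pi>. \<pi> \<in> couplings \<mu> \<nu>)"

text \<open>Suboptimality of \<open>\<pi>\<close> relative to the minimizer \<open>\<pi>s\<close>; it is \<open>\<infinity>\<close> if \<open>KL \<pi> K\<close> is, since the
  minimal value is finite.\<close>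

definition subopt :: "'z measure \<Rightarrow> 'z measure \<Rightarrow> 'z measure \<Rightarrow> ereal" where
  "subopt K \<pi>s \<pi> = KL \<pi> K - KL \<pi>s K"

definition basic_partition :: "'a::topological_space measure \<Rightarrow> 'i set \<Rightarrow> ('i \<Rightarrow> 'a set) \<Rightarrow> bool" where
  "basic_partition \<mu> I X \<longleftrightarrow>
     finite I \<and> disjoint_family_on X I \<and> (\<Union>i\<in>I. X i) = UNIV \<and>
     (\<forall>i\<in>I. X i \<in> sets borel \<and> mass (restr \<mu> (X i)) > 0)"

definition composite_cell :: "('i \<Rightarrow> 'a set) \<Rightarrow> 'i set \<Rightarrow> 'a set" where
  "composite_cell X J = (\<Union>i\<in>J. X i)"

text \<open>The sequence \<open>\<pi>\<close> is generated by the entropic domain decomposition algorithm with composite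
  partitions \<open>\<J>A\<close> (odd steps) and \<open>\<J>B\<close> (even steps), started at \<open>\<pi> 0\<close>.\<close>

definition domdec_iterates ::
  "real \<Rightarrow> ('a::topological_space \<times> 'b::topological_space \<Rightarrow> real) \<Rightarrow> 'a measure \<Rightarrow> 'b measure
    \<Rightarrow> ('i \<Rightarrow> 'a set) \<Rightarrow> 'i set set \<Rightarrow> 'i set set \<Rightarrow> (nat \<Rightarrow> ('a \<times> 'b) measure) \<Rightarrow> bool" where
  "domdec_iterates \<epsilon> c \<mu> \<nu> X \<J>A \<J>B \<pi> \<longleftrightarrow>
     \<pi> 0 \<in> couplings \<mu> \<nu> \<and>
     (\<forall>l\<ge>1. let \<J> = (if odd l then \<J>A else \<J>B) in
        \<exists>\<pi>J. (\<forall>J\<in>\<J>. entropic_minimizer \<epsilon> (gibbs \<epsilon> c \<mu> \<nu>)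
                  (restr \<mu> (composite_cell X J))
                  (marginal_Y (restr (\<pi> (l - 1)) (composite_cell X J \<times> UNIV)))
                  (\<pi>J J)) \<and>
             \<pi> l = sum_measure (borel \<Otimes>\<^sub>M borel) \<J> \<pi>J)"

definition weak_star_tendsto ::
  "(nat \<Rightarrow> ('a::topological_space \<times> 'b::topological_space) measure) \<Rightarrow> ('a \<times> 'b) measure \<Rightarrow> bool" where
  "weak_star_tendsto \<pi> \<rho> \<longleftrightarrow>
     (\<forall>f::'a \<times> 'b \<Rightarrow> real. continuous_on UNIV f \<longrightarrow>
        (\<lambda>l. integral\<^sup>L (\<pi> l) f) \<longlonglongrightarrow> integral\<^sup>L \<rho> f)"

end

theory Submission
  imports Defs
begin

text \<open>
  The density with respect to \<open>K\<close> of the entropy minimizer on a composite cell factorizes as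
  \<open>u(x) v(y)\<close>. Let \<open>p'\<close> and \<open>p\<close> be the densities of two consecutive iterates, where \<open>p\<close> arises from \<open>p'\<close>
  by solving on the cells \<open>A \<union> B\<close> and \<open>P\<close>, so that \<open>p = u v\<close> on \<open>A \<union> B\<close> and \<open>p' = u' w\<close> on \<open>B \<union> P\<close>. Extend \<open>u v\<close>
  to a density \<open>t\<close> on the whole space by renormalizing it over each \<open>x\<close>. Since \<open>ln t\<close> is the sum of a function
  of \<open>x\<close> and a function of \<open>y\<close>, differences of entropies of couplings equal differences of Bregman
  divergences from \<open>t\<close>. Hence the suboptimality of \<open>p\<close> is at most the divergence of \<open>p'\<close> from \<open>t\<close> over \<open>P\<close>,
  whereas the decrement from \<open>p'\<close> to \<open>p\<close> is at least this divergence over \<open>B\<close>. On \<open>B \<union> P\<close> both densities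
  depend on \<open>x\<close> only through \<open>k(x, -)\<close>, which varies by a factor of at most \<open>exp (norm c / \<epsilon>)\<close>; therefore the
  divergences over single points \<open>x\<close> differ by a factor of at most \<open>exp (2 norm c / \<epsilon>)\<close>.
\<close>

text \<open>Two obstacles shape the proof. The first is that potentials of a cell minimizer are not
  given. Minimality alone yields \<open>p(x,y) p(x',y') = p(x,y') p(x',y)\<close> almost everywhere,
  and integrating this identity produces the factors. The second is that \<open>ln v\<close> might
  be unbounded, so that the comparison of entropies would involve divergent integrals. The cell
  \<open>B\<close>, solved for in both steps, prevents this: over \<open>A \<union> B\<close> the
  new iterate has the same second marginal as the old one, which controls \<open>w\<close> by
  \<open>v\<close>, and the total second marginal \<open>\<nu>\<close> then keeps \<open>v\<close>
  away from 0. The 2 in the exponent arises as follows. Renormalizing over \<open>x\<close> scales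
  \<open>v\<close> by the factor that minimizes the divergence of \<open>w\<close> from a multiple
  of \<open>v\<close> at \<open>x\<close>, so the factor of another point \<open>x'\<close> may be
  inserted for free in an upper bound. Passing from \<open>k(x, -)\<close> to
  \<open>k(x', -)\<close> costs one factor, the normalization of \<open>p'\<close> the other. The
  estimate gives the ratio of the masses of \<open>B\<close> and \<open>P\<close>. As
  \<open>P\<close> alternates between the two outer cells, the smaller ratio with their total mass
  serves every step.\<close>

section \<open>The entropy function and its Bregman divergence on the reals\<close>

definition breg :: "real \<Rightarrow> real \<Rightarrow> real" where
  "breg s t = s * (ln s - ln t) - s + t"

text \<open>At \<open>s = 0\<close> the product \<open>s * ln s\<close> vanishes whatever value
  \<open>ln 0\<close> has, so one formula covers both cases of the definition.\<close>

lemma phi_eq: "0 \<le> s \<Longrightarrow> phi s = s * ln s - s + 1"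
  by (auto simp: phi_def)

text \<open>Since \<open>phi\<close> has derivative \<open>ln\<close>, \<open>breg s t\<close> is
  the gap at \<open>s\<close> between \<open>phi\<close> and its tangent at
  \<open>t\<close>.\<close>

lemma breg_eq: "0 \<le> s \<Longrightarrow> 0 \<le> t \<Longrightarrow> breg s t = phi s - phi t - ln t * (s - t)"
  by (simp add: breg_def phi_eq algebra_simps)

lemma breg_nonneg:
  assumes "0 \<le> s" "0 < t"
  shows "0 \<le> breg s t"
proof (cases "s = 0")
  case False
  then have s: "s > 0" using assms by simp
  have "ln (t / s) \<le> t / s - 1" using s assms by (intro ln_le_minus_one) auto
  then have "s * ln (t / s) \<le> s * (t / s - 1)" using s by (intro mult_left_mono) auto
  then show ?thesis using s assms by (simp add: breg_def ln_div algebra_simps)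
qed (use assms in \<open>simp add: breg_def\<close>)

lemma breg_scale: "0 < r \<Longrightarrow> 0 \<le> s \<Longrightarrow> 0 < t \<Longrightarrow> breg (r * s) (r * t) = r * breg s t"
  by (cases "s = 0") (auto simp: breg_def ln_mult algebra_simps)

lemma phi_nonneg: "0 \<le> phi s"
  using breg_nonneg[of s 1] by (cases "s > 0") (auto simp: phi_def breg_def)

lemma phi_tangent: "0 \<le> s \<Longrightarrow> 0 < t \<Longrightarrow> phi t - phi s \<le> ln t * (t - s)"
  using breg_nonneg[of s t] by (simp add: breg_eq algebra_simps)

text \<open>The tangent of \<open>phi\<close> at \<open>exp 1\<close> has slope 1 and lies below
  \<open>phi\<close>; \<open>exp 1 \<le> 3\<close> rounds the constant. On a finite measure this
  makes every density of finite entropy integrable.\<close>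

lemma le_phi: "0 \<le> s \<Longrightarrow> s \<le> phi s + 2"
  using breg_nonneg[of s "exp 1"] exp_le by (simp add: breg_def phi_eq algebra_simps)

lemma phi_measurable [measurable]: "phi \<in> borel_measurable borel"
  unfolding phi_def by measurable

lemma breg_measurable [measurable]:
  assumes [measurable]: "f \<in> borel_measurable M" "g \<in> borel_measurable M"
  shows "(\<lambda>z. breg (f z) (g z)) \<in> borel_measurable M"
  unfolding breg_def by measurable

lemma phi_bounded_on: "0 \<le> s \<Longrightarrow> s \<le> b \<Longrightarrow> phi s \<le> 1 + b * b"
proof -
  assume s: "0 \<le> s" "s \<le> b"
  show ?thesis
  proof (cases "s = 0")
    case False
    then have "ln s \<le> s" using s ln_less_self[of s] by (auto simp: less_imp_le)
    then have "s * ln s \<le> s * s" using s by (intro mult_left_mono) auto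
    also have "\<dots> \<le> b * b" using s by (intro mult_mono) auto
    finally show ?thesis using s by (simp add: phi_eq)
  qed (simp add: phi_def)
qed

text \<open>The Hellinger bound \<open>(sqrt s - sqrt t)\<^sup>2 \<le> breg s t\<close> and the weighted arithmetic-geometric mean
  inequality replace Pinsker's inequality.\<close>

lemma abs_diff_le_breg:
  assumes "0 \<le> s" "0 < t" "0 < d"
  shows "\<bar>s - t\<bar> \<le> breg s t / (2 * d) + d * (s + t)"
proof -
  have hell: "(sqrt s - sqrt t)\<^sup>2 \<le> breg s t"
  proof (cases "s = 0")
    case False
    then have s: "s > 0" using assms by simp
    \<comment> \<open>Using \<open>ln x \<le> x - 1\<close> at the square root of
      \<open>t / s\<close> instead of \<open>t / s\<close> itself produces the cross term of the
      Hellinger square.\<close>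
    have "ln (sqrt (t / s)) \<le> sqrt (t / s) - 1" using s assms by (intro ln_le_minus_one) auto
    then have "s * ln (sqrt (t / s)) \<le> s * (sqrt (t / s) - 1)" using s by (intro mult_left_mono) auto
    moreover have "s * sqrt (t / s) = sqrt s * sqrt t"
      using s by (simp add: real_sqrt_divide field_simps)
    moreover have "ln (sqrt (t / s)) = (ln t - ln s) / 2"
      using s assms by (simp add: ln_sqrt ln_div)
    ultimately have "s * (ln t - ln s) / 2 \<le> sqrt s * sqrt t - s" by (simp add: algebra_simps)
    then have "s * (ln t - ln s) \<le> 2 * (sqrt s * sqrt t) - 2 * s" by linarith
    moreover have "(sqrt s - sqrt t)\<^sup>2 = s + t - 2 * (sqrt s * sqrt t)"
      using s assms by (simp add: power2_eq_square algebra_simps)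
    ultimately show ?thesis by (simp add: breg_def right_diff_distrib)
  qed (use assms in \<open>simp add: breg_def\<close>)
  define a where "a = \<bar>sqrt s - sqrt t\<bar>"
  define b where "b = sqrt s + sqrt t"
  have b0: "0 \<le> b" using assms by (simp add: b_def)
  have "s - t = (sqrt s - sqrt t) * (sqrt s + sqrt t)"
    using assms by (simp add: algebra_simps)
  then have ab: "\<bar>s - t\<bar> = a * b" using b0 by (simp add: a_def b_def abs_mult)
  have "0 \<le> (a - d * b)\<^sup>2" by simp
  then have 1: "a * b \<le> a\<^sup>2 / (2 * d) + d * b\<^sup>2 / 2"
    using assms by (simp add: power2_eq_square field_simps)
  have "0 \<le> (sqrt s - sqrt t)\<^sup>2" by simp
  then have b2: "b\<^sup>2 \<le> 2 * (s + t)"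
    using assms by (simp add: b_def power2_eq_square algebra_simps)
  have "a\<^sup>2 / (2 * d) \<le> breg s t / (2 * d)"
    using hell assms by (intro divide_right_mono) (auto simp: a_def)
  moreover have "d * b\<^sup>2 / 2 \<le> d * (s + t)"
    using mult_left_mono[OF b2, of d] assms by simp
  ultimately show ?thesis using 1 ab by linarith
qed

section \<open>Measures given by densities with respect to a bounded kernel\<close>

text \<open>\<open>k\<close> stands for the Gibbs factor and \<open>\<kappa>\<close> for
  \<open>exp (- norm c / \<epsilon>)\<close>. The bounds are demanded at every point, although the
  cost is bounded only almost everywhere: truncating the cost does not change
  \<open>K\<close>.\<close>

locale bounded_kernel = pair_prob_space \<mu> \<nu>
  for \<mu> :: "'a::topological_space measure" and \<nu> :: "'b::topological_space measure" +
  fixes k :: "'a \<times> 'b \<Rightarrow> real" and \<kappa> :: real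
  assumes sets_mu [measurable_cong]: "sets \<mu> = sets borel"
    and sets_nu [measurable_cong]: "sets \<nu> = sets borel"
    and k_measurable [measurable]: "k \<in> borel_measurable (borel \<Otimes>\<^sub>M borel)"
    and kappa_pos: "0 < \<kappa>"
    and kappa_le: "\<And>z. \<kappa> \<le> k z"
    and k_le_1: "\<And>z. k z \<le> 1"
begin

abbreviation M where "M \<equiv> \<mu> \<Otimes>\<^sub>M \<nu>"

definition K where "K = density M (\<lambda>z. ennreal (k z))"

definition dens where "dens p = density K (\<lambda>z. ennreal (p z))"

text \<open>Real-valued stand-in for \<open>KL (dens p) K\<close>. A Bochner integral that diverges
  has value 0, so \<open>Phi\<close> is compared only between densities of finite entropy.\<close>

definition Phi where "Phi p = (\<integral>z. phi (p z) \<partial>K)"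

lemma k_pos: "0 < k z" and k_nonneg: "0 \<le> k z" and k_neq_0: "k z \<noteq> 0" and kappa_le_1: "\<kappa> \<le> 1"
  using kappa_pos kappa_le[of z] k_le_1[of z] kappa_le[of undefined] k_le_1[of undefined] by linarith+

lemma space_mu: "space \<mu> = UNIV" and space_nu: "space \<nu> = UNIV" and space_M: "space M = UNIV"
  using sets_eq_imp_space_eq[OF sets_mu] sets_eq_imp_space_eq[OF sets_nu]
  by (auto simp: space_pair_measure)

lemma sets_M: "sets M = sets (borel \<Otimes>\<^sub>M borel)"
  by (intro sets_pair_measure_cong sets_mu sets_nu)

lemma sets_K [measurable_cong]: "sets K = sets (borel \<Otimes>\<^sub>M borel)"
  by (simp add: K_def sets_M)

lemma space_K: "space K = UNIV" by (simp add: K_def space_M)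

lemma sets_dens [measurable_cong]: "sets (dens p) = sets (borel \<Otimes>\<^sub>M borel)"
  by (simp add: dens_def sets_K)

lemma space_dens: "space (dens p) = UNIV" by (simp add: dens_def space_K)

lemma integral_K:
  assumes [measurable]: "f \<in> borel_measurable (borel \<Otimes>\<^sub>M borel)"
  shows "(\<integral>z. f z \<partial>K) = (\<integral>z. k z * f z \<partial>M)"
  unfolding K_def by (subst integral_density) (auto simp: k_nonneg)

lemma integrable_K_iff:
  assumes [measurable]: "f \<in> borel_measurable (borel \<Otimes>\<^sub>M borel)"
  shows "integrable K f \<longleftrightarrow> integrable M (\<lambda>z. k z * f z)"
  unfolding K_def by (subst integrable_density) (auto simp: k_nonneg)

lemma AE_K_iff: "(AE z in K. P z) \<longleftrightarrow> (AE z in M. P z)"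
  unfolding K_def by (subst AE_density) (auto simp: k_pos)

lemma integral_dens:
  assumes [measurable]: "p \<in> borel_measurable (borel \<Otimes>\<^sub>M borel)" "f \<in> borel_measurable (borel \<Otimes>\<^sub>M borel)"
    and "\<And>z. 0 \<le> p z"
  shows "(\<integral>z. f z \<partial>dens p) = (\<integral>z. p z * f z \<partial>K)"
  unfolding dens_def by (subst integral_density) (use assms in auto)

lemma finite_measure_K: "finite_measure K"
proof
  have "emeasure K (space K) = (\<integral>\<^sup>+z. ennreal (k z) \<partial>M)"
    by (simp add: K_def emeasure_density)
  also have "\<dots> \<le> (\<integral>\<^sup>+z. 1 \<partial>M)" by (intro nn_integral_mono) (auto simp: k_le_1)
  also have "\<dots> < \<infinity>" using P.emeasure_space_1 by simp
  finally show "emeasure K (space K) \<noteq> \<infinity>" by simp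
qed

sublocale K: finite_measure K by (rule finite_measure_K)

lemma integrable_bounded:
  fixes f :: "'a \<times> 'b \<Rightarrow> real"
  assumes "f \<in> borel_measurable (borel \<Otimes>\<^sub>M borel)" "\<And>z. \<bar>f z\<bar> \<le> b"
  shows "integrable K f" "integrable M f"
proof -
  have [measurable]: "f \<in> borel_measurable (borel \<Otimes>\<^sub>M borel)" by fact
  show "integrable K f" by (rule K.integrable_const_bound[of _ b]) (use assms(2) in auto)
  show "integrable M f" by (rule P.integrable_const_bound[of _ b]) (use assms(2) in auto)
qed

lemma KL_dens:
  assumes [measurable]: "p \<in> borel_measurable (borel \<Otimes>\<^sub>M borel)" and "\<And>z. 0 \<le> p z"
  shows "KL (dens p) K = enn2ereal (\<integral>\<^sup>+z. ennreal (phi (p z)) \<partial>K)"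
proof -
  have ac: "absolutely_continuous K (dens p)"
    unfolding dens_def by (rule absolutely_continuousI_density) measurable
  have "AE z in K. ennreal (p z) = RN_deriv K (dens p) z"
    by (rule K.RN_deriv_unique) (auto simp: dens_def)
  then have "(\<integral>\<^sup>+z. ennreal (phi (enn2real (RN_deriv K (dens p) z))) \<partial>K) = (\<integral>\<^sup>+z. ennreal (phi (p z)) \<partial>K)"
    by (intro nn_integral_cong_AE) (auto elim!: eventually_mono simp: assms(2) dest!: sym[of "ennreal _"])
  then show ?thesis using ac by (simp add: KL_def)
qed

lemma KL_dens_Phi:
  assumes [measurable]: "p \<in> borel_measurable (borel \<Otimes>\<^sub>M borel)" and "\<And>z. 0 \<le> p z"
    and "integrable K (\<lambda>z. phi (p z))"
  shows "KL (dens p) K = ereal (Phi p)"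
  using nn_integral_eq_integral[OF assms(3)]
  by (simp add: KL_dens assms phi_nonneg Phi_def integral_nonneg_AE)

text \<open>The Radon-Nikodym derivative of a finite measure is finite almost everywhere, so its
  real-valued version represents the same measure.\<close>

lemma dens_of_finite_KL:
  assumes "sets \<rho> = sets (borel \<Otimes>\<^sub>M borel)" "finite_measure \<rho>" "KL \<rho> K \<noteq> \<infinity>"
  obtains p where "p \<in> borel_measurable (borel \<Otimes>\<^sub>M borel)" "\<And>z. 0 \<le> p z" "\<rho> = dens p"
    "integrable K (\<lambda>z. phi (p z))"
proof -
  interpret R: finite_measure \<rho> by fact
  have ac: "absolutely_continuous K \<rho>" using assms(3) by (auto simp: KL_def split: if_splits)
  define p where "p = (\<lambda>z. enn2real (RN_deriv K \<rho> z))"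
  have s: "sets \<rho> = sets K" by (simp add: assms sets_K)
  have [measurable]: "p \<in> borel_measurable (borel \<Otimes>\<^sub>M borel)"
    unfolding p_def using borel_measurable_RN_deriv[of K \<rho>]
    by (simp add: measurable_cong_sets[OF sets_K refl])
  have fin: "AE z in K. RN_deriv K \<rho> z \<noteq> \<infinity>"
    by (rule K.RN_deriv_finite[OF _ ac s]) unfold_locales
  have "\<rho> = density K (RN_deriv K \<rho>)" using K.density_RN_deriv[OF ac s] by simp
  also have "\<dots> = dens p" unfolding dens_def p_def
    by (rule density_cong) (use fin in \<open>auto elim!: eventually_mono simp: top.not_eq_extremum\<close>)
  finally have eq: "\<rho> = dens p" .
  have p0: "\<And>z. 0 \<le> p z" by (simp add: p_def)
  have "integrable K (\<lambda>z. phi (p z))"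
  proof (rule integrableI_nonneg)
    show "(\<integral>\<^sup>+z. ennreal (phi (p z)) \<partial>K) < \<infinity>"
      using assms(3) KL_dens[of p] p0 eq by (auto simp: less_top)
  qed (auto simp: phi_nonneg)
  with eq p0 show ?thesis by (intro that[of p]) auto
qed


text \<open>Non-negativity is required everywhere, which lets the pointwise inequalities for
  \<open>phi\<close> and \<open>breg\<close> be used without exceptional sets. Integrability of
  \<open>p\<close> itself follows from \<open>le_phi\<close>.\<close>

definition admissible where
  "admissible p \<longleftrightarrow> p \<in> borel_measurable (borel \<Otimes>\<^sub>M borel) \<and> (\<forall>z. 0 \<le> p z)
     \<and> integrable K (\<lambda>z. phi (p z))"

lemma admissibleD:
  assumes "admissible p"
  shows "p \<in> borel_measurable (borel \<Otimes>\<^sub>M borel)" "0 \<le> p z" "integrable K (\<lambda>z. phi (p z))"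
    "integrable K p"
proof -
  show 1: "p \<in> borel_measurable (borel \<Otimes>\<^sub>M borel)" "0 \<le> p z" "integrable K (\<lambda>z. phi (p z))"
    using assms unfolding admissible_def by blast+
  note [measurable] = 1(1)
  show "integrable K p"
    by (rule Bochner_Integration.integrable_bound[of K "\<lambda>z. phi (p z) + 2"])
       (use assms 1(3) in \<open>auto simp: admissible_def le_phi phi_nonneg abs_of_nonneg add_nonneg_nonneg\<close>)
qed

lemma KL_admissible: "admissible p \<Longrightarrow> KL (dens p) K = ereal (Phi p)"
  by (intro KL_dens_Phi admissibleD)

lemma emeasure_dens:
  assumes "admissible p" "A \<in> sets (borel \<Otimes>\<^sub>M borel)"
  shows "emeasure (dens p) A = ennreal (\<integral>z. indicator A z * p z \<partial>K)"
proof -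
  note [measurable] = admissibleD(1)[OF assms(1)] assms(2)
  have i: "integrable K (\<lambda>z. indicator A z * p z)"
    using integrable_real_mult_indicator[of A K p] admissibleD(4)[OF assms(1)] assms(2)
    by (simp add: sets_K mult.commute)
  have "emeasure (dens p) A = (\<integral>\<^sup>+z. ennreal (indicator A z * p z) \<partial>K)"
    unfolding dens_def using assms(2)
    by (subst emeasure_density) (auto simp: sets_K admissibleD(2)[OF assms(1)] indicator_def intro!: nn_integral_cong)
  also have "\<dots> = ennreal (\<integral>z. indicator A z * p z \<partial>K)"
    using nn_integral_eq_integral[OF i] admissibleD(2)[OF assms(1)] by auto
  finally show ?thesis .
qed

lemma marginal_X_eqI:
  assumes "admissible p" "admissible q"
    and "\<And>A. A \<in> sets borel \<Longrightarrow> (\<integral>z. indicator A (fst z) * p z \<partial>K) = (\<integral>z. indicator A (fst z) * q z \<partial>K)"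
  shows "marginal_X (dens p) = marginal_X (dens q)"
proof (rule measure_eqI)
  fix A assume "A \<in> sets (marginal_X (dens p))"
  then have [measurable]: "A \<in> sets borel" by (simp add: marginal_X_def)
  have *: "fst -` A \<in> sets (borel \<Otimes>\<^sub>M borel :: ('a \<times> 'b) measure)"
    using measurable_sets[OF measurable_fst, of A borel borel] by (simp add: space_pair_measure)
  have "indicator (fst -` A) z = (indicator A (fst z) :: real)" for z :: "'a \<times> 'b"
    by (simp add: indicator_def)
  then show "emeasure (marginal_X (dens p)) A = emeasure (marginal_X (dens q)) A"
    using assms * by (simp add: marginal_X_def emeasure_distr space_dens emeasure_dens)
qed (simp add: marginal_X_def)

lemma marginal_Y_eqI:
  assumes "admissible p" "admissible q"
    and "\<And>A. A \<in> sets borel \<Longrightarrow> (\<integral>z. indicator A (snd z) * p z \<partial>K) = (\<integral>z. indicator A (snd z) * q z \<partial>K)"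
  shows "marginal_Y (dens p) = marginal_Y (dens q)"
proof (rule measure_eqI)
  fix A assume "A \<in> sets (marginal_Y (dens p))"
  then have [measurable]: "A \<in> sets borel" by (simp add: marginal_Y_def)
  have *: "snd -` A \<in> sets (borel \<Otimes>\<^sub>M borel :: ('a \<times> 'b) measure)"
    using measurable_sets[OF measurable_snd, of A borel borel] by (simp add: space_pair_measure)
  have "indicator (snd -` A) z = (indicator A (snd z) :: real)" for z :: "'a \<times> 'b"
    by (simp add: indicator_def)
  then show "emeasure (marginal_Y (dens p)) A = emeasure (marginal_Y (dens q)) A"
    using assms * by (simp add: marginal_Y_def emeasure_distr space_dens emeasure_dens)
qed (simp add: marginal_Y_def)

text \<open>The marginals are those of \<open>p\<close> itself rather than parameters, so the same
  notion serves the global problem and every cell problem.\<close>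

definition optimal where
  "optimal p \<longleftrightarrow> admissible p \<and> (\<forall>q. admissible q \<longrightarrow> marginal_X (dens q) = marginal_X (dens p)
     \<longrightarrow> marginal_Y (dens q) = marginal_Y (dens p) \<longrightarrow> Phi p \<le> Phi q)"

subsection \<open>Factorization of entropy minimizers\<close>

definition exch :: "('a \<times> 'b) \<times> ('a \<times> 'b) \<Rightarrow> ('a \<times> 'b) \<times> ('a \<times> 'b)" where
  "exch w = ((fst (fst w), snd (snd w)), (fst (snd w), snd (fst w)))"

lemma exch_exch [simp]: "exch (exch w) = w" by (simp add: exch_def)

lemma exch_measurable [measurable]: "exch \<in> (M \<Otimes>\<^sub>M M) \<rightarrow>\<^sub>M (M \<Otimes>\<^sub>M M)"
  unfolding exch_def by measurable

text \<open>After Fubini the two \<open>y\<close>-integrals stand next to each other, and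
  \<open>exch\<close> merely swaps their order.\<close>

lemma nn_integral_exch:
  assumes [measurable]: "F \<in> borel_measurable (M \<Otimes>\<^sub>M M)"
  shows "(\<integral>\<^sup>+w. F (exch w) \<partial>(M \<Otimes>\<^sub>M M)) = (\<integral>\<^sup>+w. F w \<partial>(M \<Otimes>\<^sub>M M))"
proof -
  interpret MM: pair_prob_space M M ..
  interpret NN: pair_prob_space \<nu> \<nu> ..
  have four: "(\<integral>\<^sup>+w. G w \<partial>(M \<Otimes>\<^sub>M M)) =
      (\<integral>\<^sup>+x. \<integral>\<^sup>+x'. \<integral>\<^sup>+y. \<integral>\<^sup>+y'. G ((x, y), (x', y')) \<partial>\<nu> \<partial>\<nu> \<partial>\<mu> \<partial>\<mu>)"
    if [measurable]: "G \<in> borel_measurable (M \<Otimes>\<^sub>M M)" for G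
  proof -
    have "(\<integral>\<^sup>+w. G w \<partial>(M \<Otimes>\<^sub>M M)) = (\<integral>\<^sup>+z. \<integral>\<^sup>+z'. G (z, z') \<partial>M \<partial>M)"
      by (rule P.nn_integral_fst[symmetric]) measurable
    also have "\<dots> = (\<integral>\<^sup>+x. \<integral>\<^sup>+y. \<integral>\<^sup>+z'. G ((x, y), z') \<partial>M \<partial>\<nu> \<partial>\<mu>)"
      by (rule M2.nn_integral_fst[symmetric]) measurable
    also have "\<dots> = (\<integral>\<^sup>+x. \<integral>\<^sup>+y. \<integral>\<^sup>+x'. \<integral>\<^sup>+y'. G ((x, y), (x', y')) \<partial>\<nu> \<partial>\<mu> \<partial>\<nu> \<partial>\<mu>)"
      by (intro nn_integral_cong M2.nn_integral_fst[symmetric]) measurable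
    also have "\<dots> = (\<integral>\<^sup>+x. \<integral>\<^sup>+x'. \<integral>\<^sup>+y. \<integral>\<^sup>+y'. G ((x, y), (x', y')) \<partial>\<nu> \<partial>\<nu> \<partial>\<mu> \<partial>\<mu>)"
      by (intro nn_integral_cong Fubini') measurable
    finally show ?thesis .
  qed
  have "(\<integral>\<^sup>+w. F (exch w) \<partial>(M \<Otimes>\<^sub>M M)) =
      (\<integral>\<^sup>+x. \<integral>\<^sup>+x'. \<integral>\<^sup>+y. \<integral>\<^sup>+y'. F ((x, y'), (x', y)) \<partial>\<nu> \<partial>\<nu> \<partial>\<mu> \<partial>\<mu>)"
    by (subst four) (simp_all add: exch_def)
  also have "\<dots> = (\<integral>\<^sup>+x. \<integral>\<^sup>+x'. \<integral>\<^sup>+y'. \<integral>\<^sup>+y. F ((x, y'), (x', y)) \<partial>\<nu> \<partial>\<nu> \<partial>\<mu> \<partial>\<mu>)"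
    by (intro nn_integral_cong NN.Fubini') measurable
  also have "\<dots> = (\<integral>\<^sup>+w. F w \<partial>(M \<Otimes>\<^sub>M M))" by (subst four) simp_all
  finally show ?thesis .
qed

lemma distr_exch: "distr (M \<Otimes>\<^sub>M M) (M \<Otimes>\<^sub>M M) exch = M \<Otimes>\<^sub>M M"
proof (rule measure_eqI)
  fix A assume "A \<in> sets (distr (M \<Otimes>\<^sub>M M) (M \<Otimes>\<^sub>M M) exch)"
  then have [measurable]: "A \<in> sets (M \<Otimes>\<^sub>M M)" by simp
  have "emeasure (distr (M \<Otimes>\<^sub>M M) (M \<Otimes>\<^sub>M M) exch) A
      = (\<integral>\<^sup>+w. indicator A w \<partial>distr (M \<Otimes>\<^sub>M M) (M \<Otimes>\<^sub>M M) exch)" by simp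
  also have "\<dots> = (\<integral>\<^sup>+w. indicator A (exch w) \<partial>(M \<Otimes>\<^sub>M M))"
    by (rule nn_integral_distr) measurable
  also have "\<dots> = emeasure (M \<Otimes>\<^sub>M M) A" by (subst nn_integral_exch) auto
  finally show "emeasure (distr (M \<Otimes>\<^sub>M M) (M \<Otimes>\<^sub>M M) exch) A = emeasure (M \<Otimes>\<^sub>M M) A" .
qed simp

lemma integral_exch:
  fixes F :: "_ \<Rightarrow> real"
  assumes "F \<in> borel_measurable (M \<Otimes>\<^sub>M M)"
  shows "(\<integral>w. F (exch w) \<partial>(M \<Otimes>\<^sub>M M)) = (\<integral>w. F w \<partial>(M \<Otimes>\<^sub>M M))"
  by (metis assms exch_measurable integral_distr distr_exch)

text \<open>If the claim failed on a set \<open>E\<close> of quadruples of positive measure, moving a little mass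
  from the pairs \<open>(x, y'), (x', y)\<close> to the pairs \<open>(x, y), (x', y')\<close> over \<open>E\<close> would keep the marginals
  and decrease the entropy.\<close>

lemma optimal_exch_null:
  assumes opt: "optimal p" and d: "0 < d" and N: "0 < N"
  defines "E \<equiv> {w. p (fst w) * p (snd w) + d \<le> p (fst (exch w)) * p (snd (exch w))
     \<and> p (fst w) \<le> N \<and> p (snd w) \<le> N \<and> p (fst (exch w)) \<le> N \<and> p (snd (exch w)) \<le> N}"
  shows "AE w in M \<Otimes>\<^sub>M M. w \<notin> E"
proof -
  interpret MM: pair_prob_space M M ..
  have adm: "admissible p" using opt by (simp add: optimal_def)
  note p0 = admissibleD(2)[OF adm]
  have [measurable]: "p \<in> borel_measurable (borel \<Otimes>\<^sub>M borel)" by (rule admissibleD(1)[OF adm])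
  have [measurable]: "p \<in> borel_measurable M" by measurable
  have [measurable]: "Measurable.pred (M \<Otimes>\<^sub>M M) (\<lambda>w. w \<in> E)"
    unfolding E_def mem_Collect_eq by measurable
  have E[measurable]: "E \<in> sets (M \<Otimes>\<^sub>M M)"
    using predE[OF \<open>Measurable.pred (M \<Otimes>\<^sub>M M) (\<lambda>w. w \<in> E)\<close>] by (simp add: space_pair_measure space_mu space_nu)
  \<comment> \<open>\<open>\<eta>\<close> bounds the pointwise change of the density. The bound
    \<open>d / (2 * N)\<close> leaves at least \<open>\<eta>\<close> wherever mass is removed,
    \<open>N\<close> keeps the new density below \<open>2 * N\<close> wherever
    \<open>p z \<le> N\<close>, and 1 and \<open>d / (8 * N + 4)\<close> preserve the strict gap
    between the two products on \<open>E\<close>.\<close>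
  define \<eta> where "\<eta> = Min {1, d / (2 * N), N, d / (8 * N + 4)}"
  have eta: "0 < \<eta>" "\<eta> \<le> 1" "\<eta> \<le> d / (2 * N)" "\<eta> \<le> N" "\<eta> \<le> d / (8 * N + 4)"
    using d N by (auto simp: \<eta>_def)
  \<comment> \<open>The density changes by \<open>t * h z / k z\<close>; as
    \<open>\<bar>h z\<bar> \<le> 1\<close> and \<open>\<kappa> \<le> k z\<close>, this is at most
    \<open>\<eta>\<close>.\<close>
  define t where "t = \<eta> * \<kappa>"
  have t: "0 < t" using eta kappa_pos by (simp add: t_def)
  \<comment> \<open>\<open>H\<close> is the mass gained by points in the first slot of a quadruple
    in \<open>E\<close>, and \<open>H'\<close> the mass lost by points that enter the first slot
    after the exchange. The first slot suffices, because \<open>E\<close> is invariant under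
    interchanging its two points.\<close>
  define H where "H z = (\<integral>z'. (indicator E (z, z') :: real) \<partial>M)" for z :: "'a \<times> 'b"
  define H' where "H' z = (\<integral>z'. (indicator E (exch (z, z')) :: real) \<partial>M)" for z :: "'a \<times> 'b"
  define h where "h z = H z - H' z" for z :: "'a \<times> 'b"
  have [measurable]: "H \<in> borel_measurable M" "H' \<in> borel_measurable M"
    unfolding H_def H'_def by measurable
  have [measurable]: "h \<in> borel_measurable M"
    unfolding h_def by measurable
  have [measurable]: "h \<in> borel_measurable (borel \<Otimes>\<^sub>M borel)"
    using \<open>h \<in> borel_measurable M\<close> by (simp add: measurable_cong_sets[OF sets_M refl])
  have b: "(0::real) \<le> (\<integral>z'. indicator E (g z') \<partial>M)" "(\<integral>z'. indicator E (g z') \<partial>M) \<le> (1::real)"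
    if [measurable]: "g \<in> M \<rightarrow>\<^sub>M (M \<Otimes>\<^sub>M M)" for g :: "'a \<times> 'b \<Rightarrow> ('a \<times> 'b) \<times> ('a \<times> 'b)"
  proof -
    have "(\<integral>z'. indicator E (g z') \<partial>M) \<le> (\<integral>z'. (1::real) \<partial>M)"
      by (intro integral_mono P.integrable_const_bound[of _ 1]) (auto simp: indicator_def)
    then show "(\<integral>z'. indicator E (g z') \<partial>M) \<le> (1::real)" by (simp add: P.prob_space)
  qed (auto intro!: integral_nonneg_AE)
  have Hb: "0 \<le> H z" "H z \<le> 1" "0 \<le> H' z" "H' z \<le> 1" for z
  proof -
    have 1: "(\<lambda>z'. (z, z')) \<in> M \<rightarrow>\<^sub>M (M \<Otimes>\<^sub>M M)"
      by (rule measurable_Pair1') (simp add: space_M)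
    show "0 \<le> H z" "H z \<le> 1" using b[OF 1] by (auto simp: H_def)
    show "0 \<le> H' z" "H' z \<le> 1"
      using b[OF measurable_compose[OF 1 exch_measurable]] by (auto simp: H'_def)
  qed
  have habs: "\<bar>h z\<bar> \<le> 1" for z using Hb[of z] by (auto simp: h_def)
  \<comment> \<open>Mass is taken from \<open>z\<close> only if \<open>p z * p z' \<ge> d\<close>
    for some \<open>z'\<close> with \<open>p z' \<le> N\<close>, hence only where \<open>p z\<close>
    is at least \<open>d / N\<close>. This keeps \<open>q\<close> non-negative.\<close>
  have H'0: "H' z = 0" if "p z < d / N \<or> N < p z" for z
  proof -
    have "indicator E (exch (z, z')) = (0::real)" for z'
    proof -
      have "exch (z, z') \<notin> E"
      proof
        assume a: "exch (z, z') \<in> E"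
        then have "d \<le> p z * p z'" "p z' \<le> N" "p z \<le> N"
          using mult_nonneg_nonneg[OF p0[of "fst (exch (z, z'))"] p0[of "snd (exch (z, z'))"]]
          by (simp_all add: E_def)
        moreover have "p z * p z' \<le> p z * N" using p0 \<open>p z' \<le> N\<close> by (intro mult_left_mono)
        ultimately have "d \<le> p z * N" by linarith
        then have "d / N \<le> p z" using N by (simp add: field_simps)
        then show False using that \<open>p z \<le> N\<close> by linarith
      qed
      then show ?thesis by simp
    qed
    then show ?thesis by (simp add: H'_def)
  qed
  have H0: "H z = 0" if "N < p z" for z
  proof -
    have "(z, z') \<notin> E" for z' using that by (auto simp: E_def)
    then show ?thesis by (simp add: H_def)
  qed
  define q where "q z = p z + t * h z / k z" for z
  have qdiff: "\<bar>q z - p z\<bar> \<le> \<eta>" for z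
  proof -
    have "\<bar>q z - p z\<bar> = t * \<bar>h z\<bar> / k z" using t k_pos[of z] by (simp add: q_def abs_mult)
    also have "\<dots> \<le> t * 1 / \<kappa>"
      using t k_pos[of z] kappa_pos kappa_le habs by (intro frac_le mult_left_mono) auto
    finally show ?thesis using kappa_pos by (simp add: t_def)
  qed
  have dN: "d / N \<ge> 2 * \<eta>" using eta by (simp add: field_simps)
  have qge: "p z \<le> q z" if "H' z = 0" for z
    using that Hb[of z] t k_nonneg[of z] by (simp add: q_def h_def)
  have q0: "0 \<le> q z" for z
  proof (cases "p z < d / N")
    case True then show ?thesis using H'0[of z] qge[of z] p0[of z] by simp
  next
    case False then show ?thesis using dN qdiff[of z] eta by linarith
  qed
  have [measurable]: "q \<in> borel_measurable (borel \<Otimes>\<^sub>M borel)"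
    unfolding q_def by measurable
  \<comment> \<open>\<open>ln (q z)\<close>, the derivative of the entropy, is unbounded. Clamping
    its argument gives a bounded \<open>L\<close>, so that all integrals below exist.\<close>
  define a where "a z = max \<eta> (min (2 * N) (q z))" for z
  define L where "L z = ln (a z)" for z
  have ab: "\<eta> \<le> a z" "a z \<le> 2 * N" for z using eta N by (auto simp: a_def)
  have [measurable]: "L \<in> borel_measurable (borel \<Otimes>\<^sub>M borel)"
    unfolding L_def a_def by measurable
  have [measurable]: "L \<in> borel_measurable M" by measurable
  have aN: "\<bar>a z - p z\<bar> \<le> \<eta>" if "p z \<le> N" for z
    using that qdiff[of z] eta p0[of z] unfolding a_def by (auto simp: max_def min_def)
  define BL where "BL = \<bar>ln \<eta>\<bar> + \<bar>ln (2 * N)\<bar>"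
  have Lb: "\<bar>L z\<bar> \<le> BL" for z
  proof -
    have "ln \<eta> \<le> L z" "L z \<le> ln (2 * N)"
      using ab[of z] eta(1) N unfolding L_def by (subst ln_le_cancel_iff; linarith)+
    then show ?thesis by (auto simp: BL_def)
  qed
  \<comment> \<open>The tangent inequality survives the clamping: where mass may be lost the clamp
    is inactive, and where mass is only gained just the lower clamp can act, which raises the
    logarithm while \<open>q z - p z\<close> is positive.\<close>
  have key: "phi (q z) - phi (p z) \<le> (t * h z / k z) * L z" for z
  proof -
    consider "h z = 0" | "H' z \<noteq> 0" | "H' z = 0" "h z > 0"
      using Hb[of z] by (fastforce simp: h_def)
    then show ?thesis
    proof cases
      case 1 then show ?thesis by (simp add: q_def)
    next
      case 2
      then have "\<not> (p z < d / N \<or> N < p z)" using H'0[of z] by metis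
      then have "d / N \<le> p z" "p z \<le> N" by auto
      then have "\<eta> \<le> q z" "q z \<le> 2 * N" using dN qdiff[of z] eta by linarith+
      then have "a z = q z" "0 < q z" using eta by (auto simp: a_def)
      then show ?thesis using phi_tangent[of "p z" "q z"] p0[of z]
        by (simp add: L_def q_def mult.commute)
    next
      case 3
      then have "p z \<le> N" using H0[of z] by (force simp: h_def)
      then have "q z \<le> 2 * N" using qdiff[of z] eta by linarith
      then have aq: "q z \<le> a z" by (simp add: a_def)
      have gt: "p z < q z" using 3 t k_pos[of z] by (simp add: q_def)
      then have "0 < q z" using p0[of z] by linarith
      have "phi (q z) - phi (p z) \<le> ln (q z) * (q z - p z)"
        using phi_tangent[of "p z" "q z"] p0[of z] \<open>0 < q z\<close> by simp
      also have "\<dots> \<le> L z * (q z - p z)"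
        using aq \<open>0 < q z\<close> gt unfolding L_def by (intro mult_right_mono) auto
      finally show ?thesis by (simp add: q_def mult.commute)
    qed
  qed
  have hLM: "integrable M (\<lambda>z. h z * f z)" if "f \<in> borel_measurable (borel \<Otimes>\<^sub>M borel)" "\<And>z. \<bar>f z\<bar> \<le> B" for f B
  proof -
    note [measurable] = that(1)
    have "\<bar>h z * f z\<bar> \<le> 1 * B" for z unfolding abs_mult using habs that(2) by (intro mult_mono) auto
    then show ?thesis by (intro integrable_bounded(2)[of _ "1 * B"]) auto
  qed
  have hK: "integrable K (\<lambda>z. (t * h z / k z) * f z)"
      "(\<integral>z. (t * h z / k z) * f z \<partial>K) = t * (\<integral>z. h z * f z \<partial>M)"
    if "f \<in> borel_measurable (borel \<Otimes>\<^sub>M borel)" "\<And>z. \<bar>f z\<bar> \<le> B" for f B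
  proof -
    note [measurable] = that(1)
    have eq: "k z * ((t * h z / k z) * f z) = t * (h z * f z)" for z using k_neq_0[of z] by simp
    show "integrable K (\<lambda>z. (t * h z / k z) * f z)"
      using hLM[OF that] by (subst integrable_K_iff) (measurable, simp only: eq, simp)
    show "(\<integral>z. (t * h z / k z) * f z \<partial>K) = t * (\<integral>z. h z * f z \<partial>M)"
      by (subst integral_K) (measurable, simp only: eq, simp)
  qed
  have pint: "integrable K (\<lambda>z. phi (p z))" by (rule admissibleD(3)[OF adm])
  have phq: "integrable K (\<lambda>z. phi (q z))"
  proof (rule Bochner_Integration.integrable_bound)
    show "integrable K (\<lambda>z. phi (p z) + (t * h z / k z) * L z)"
      using pint hK(1)[of L BL] Lb by auto
    show "AE z in K. norm (phi (q z)) \<le> norm (phi (p z) + (t * h z / k z) * L z)"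
    proof (rule AE_I2)
      fix z show "norm (phi (q z)) \<le> norm (phi (p z) + (t * h z / k z) * L z)"
        using key[of z] phi_nonneg[of "q z"] unfolding real_norm_def by linarith
    qed
  qed measurable
  have admq: "admissible q" using q0 phq by (simp add: admissible_def)
  have hf: "(\<integral>z. h z * f z \<partial>M) = (\<integral>w. indicator E w * (f (fst w) - f (fst (exch w))) \<partial>(M \<Otimes>\<^sub>M M))"
       "(\<integral>z. h z * f z \<partial>M) = (\<integral>w. indicator E w * (f (snd w) - f (snd (exch w))) \<partial>(M \<Otimes>\<^sub>M M))"
      and iE: "integrable (M \<Otimes>\<^sub>M M) (\<lambda>w. indicator E w * (f (fst w) - f (fst (exch w))))"
       "integrable (M \<Otimes>\<^sub>M M) (\<lambda>w. indicator E w * (f (snd w) - f (snd (exch w))))"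
    if fm: "f \<in> borel_measurable (borel \<Otimes>\<^sub>M borel)" and fb: "\<And>z. \<bar>f z\<bar> \<le> B" for f B
  proof -
    note [measurable] = fm
    have [measurable]: "f \<in> borel_measurable M" by measurable
    have B: "0 \<le> B" using fb[of undefined] by linarith
    have int: "integrable (M \<Otimes>\<^sub>M M) (\<lambda>w. indicator E (g w) * f (g' w))"
      if [measurable]: "g \<in> (M \<Otimes>\<^sub>M M) \<rightarrow>\<^sub>M (M \<Otimes>\<^sub>M M)" "g' \<in> (M \<Otimes>\<^sub>M M) \<rightarrow>\<^sub>M M" for g g'
      by (rule MM.P.integrable_const_bound[of _ B]) (use fb B in \<open>auto simp: indicator_def\<close>)
    note int' = int[of "\<lambda>w. w" fst] int[of exch fst] int[of "\<lambda>w. w" "\<lambda>w. fst (exch w)"]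
        int[of "\<lambda>w. w" snd] int[of "\<lambda>w. w" "\<lambda>w. snd (exch w)"]
    have "(\<integral>z. H z * f z \<partial>M) = (\<integral>z. (\<integral>z'. indicator E (z, z') * f z \<partial>M) \<partial>M)"
      by (simp add: H_def)
    also have "\<dots> = (\<integral>w. indicator E w * f (fst w) \<partial>(M \<Otimes>\<^sub>M M))"
      using MM.integral_fst'[of "\<lambda>w. indicator E w * f (fst w)"] int' by simp
    finally have 1: "(\<integral>z. H z * f z \<partial>M) = (\<integral>w. indicator E w * f (fst w) \<partial>(M \<Otimes>\<^sub>M M))" .
    have "(\<integral>z. H' z * f z \<partial>M) = (\<integral>z. (\<integral>z'. indicator E (exch (z, z')) * f z \<partial>M) \<partial>M)"
      by (simp add: H'_def)
    also have "\<dots> = (\<integral>w. indicator E (exch w) * f (fst w) \<partial>(M \<Otimes>\<^sub>M M))"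
      using MM.integral_fst'[of "\<lambda>w. indicator E (exch w) * f (fst w)"] int' by simp
    also have "\<dots> = (\<integral>w. indicator E w * f (fst (exch w)) \<partial>(M \<Otimes>\<^sub>M M))"
      using integral_exch[of "\<lambda>w. indicator E w * f (fst (exch w))"] by simp
    finally have 2: "(\<integral>z. H' z * f z \<partial>M) = (\<integral>w. indicator E w * f (fst (exch w)) \<partial>(M \<Otimes>\<^sub>M M))" .
    have iH: "integrable M (\<lambda>z. H z * f z)" "integrable M (\<lambda>z. H' z * f z)"
    proof -
      have "\<bar>H z * f z\<bar> \<le> 1 * B" "\<bar>H' z * f z\<bar> \<le> 1 * B" for z
        unfolding abs_mult using Hb[of z] fb[of z] by (intro mult_mono; simp)+
      then show "integrable M (\<lambda>z. H z * f z)" "integrable M (\<lambda>z. H' z * f z)"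
        by (auto intro!: P.integrable_const_bound[of _ "1 * B"])
    qed
    have hH: "(\<integral>z. h z * f z \<partial>M) = (\<integral>z. H z * f z \<partial>M) - (\<integral>z. H' z * f z \<partial>M)"
      using iH by (simp add: h_def left_diff_distrib)
    show 3: "(\<integral>z. h z * f z \<partial>M) = (\<integral>w. indicator E w * (f (fst w) - f (fst (exch w))) \<partial>(M \<Otimes>\<^sub>M M))"
      using int' by (simp add: hH 1 2 right_diff_distrib)
    show "integrable (M \<Otimes>\<^sub>M M) (\<lambda>w. indicator E w * (f (fst w) - f (fst (exch w))))"
       "integrable (M \<Otimes>\<^sub>M M) (\<lambda>w. indicator E w * (f (snd w) - f (snd (exch w))))"
      using int' by (auto simp: right_diff_distrib)
    \<comment> \<open>This symmetry of \<open>E\<close> turns the first-slot formula for the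
      integral of \<open>h * f\<close> into the second-slot formula.\<close>
    have flip: "indicator E (snd w, fst w) = (indicator E w :: real)" for w
      by (auto simp: E_def exch_def indicator_def mult.commute)
    have "(\<integral>w. indicator E w * (f (snd w) - f (snd (exch w))) \<partial>(M \<Otimes>\<^sub>M M))
       = (\<integral>(z, z'). indicator E (z', z) * (f z - f (snd (exch (z', z)))) \<partial>(M \<Otimes>\<^sub>M M))"
      by (subst MM.integral_product_swap[symmetric]) (auto simp: split_beta)
    also have "\<dots> = (\<integral>w. indicator E w * (f (fst w) - f (fst (exch w))) \<partial>(M \<Otimes>\<^sub>M M))"
      by (intro Bochner_Integration.integral_cong) (auto simp: flip[of "(_, _)", simplified] exch_def)
    finally show "(\<integral>z. h z * f z \<partial>M) = (\<integral>w. indicator E w * (f (snd w) - f (snd (exch w))) \<partial>(M \<Otimes>\<^sub>M M))"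
      using 3 by simp
  qed
  have mass0: "(\<integral>z. f z * q z \<partial>K) = (\<integral>z. f z * p z \<partial>K)"
    if "f \<in> borel_measurable (borel \<Otimes>\<^sub>M borel)" "\<And>z. \<bar>f z\<bar> \<le> 1" "(\<integral>z. h z * f z \<partial>M) = 0" for f
  proof -
    note [measurable] = that(1)
    have "integrable K (\<lambda>z. f z * p z)"
      by (rule Bochner_Integration.integrable_bound[OF admissibleD(4)[OF adm]])
         (use that(2) p0 in \<open>auto simp: abs_mult intro!: mult_left_le_one_le\<close>)
    then have "(\<integral>z. f z * p z + (t * h z / k z) * f z \<partial>K) = (\<integral>z. f z * p z \<partial>K)"
      using hK[OF that(1,2)] that(3) by simp
    then show ?thesis by (simp add: q_def algebra_simps)
  qed
  have "marginal_X (dens q) = marginal_X (dens p)"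
  proof (rule marginal_X_eqI[OF admq adm])
    fix A :: "'a set" assume [measurable]: "A \<in> sets borel"
    define f where "f = (\<lambda>z :: 'a \<times> 'b. indicator A (fst z) :: real)"
    show "(\<integral>z. indicator A (fst z) * q z \<partial>K) = (\<integral>z. indicator A (fst z) * p z \<partial>K)"
      using hf(1)[of f 1] mass0[of f] by (auto simp: f_def exch_def)
  qed
  moreover have "marginal_Y (dens q) = marginal_Y (dens p)"
  proof (rule marginal_Y_eqI[OF admq adm])
    fix A :: "'b set" assume [measurable]: "A \<in> sets borel"
    define f where "f = (\<lambda>z :: 'a \<times> 'b. indicator A (snd z) :: real)"
    have fm: "f \<in> borel_measurable (borel \<Otimes>\<^sub>M borel)" "\<And>z. \<bar>f z\<bar> \<le> 1" by (auto simp: f_def)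
    \<comment> \<open>The exchange swaps the two \<open>y\<close>-values, so for a function of
      \<open>y\<close> the two formulas in \<open>hf\<close> are negatives of each other and their
      common value is 0. For a function of \<open>x\<close> the integrand itself vanishes.\<close>
    have "indicator E w * (f (snd w) - f (snd (exch w))) = - (indicator E w * (f (fst w) - f (fst (exch w))))" for w
      by (auto simp: f_def exch_def algebra_simps)
    then have "(\<integral>z. h z * f z \<partial>M) = - (\<integral>z. h z * f z \<partial>M)"
      using hf[of f 1, OF fm] by simp
    then show "(\<integral>z. indicator A (snd z) * q z \<partial>K) = (\<integral>z. indicator A (snd z) * p z \<partial>K)"
      using mass0[of f] fm by (simp add: f_def)
  qed
  ultimately have "Phi p \<le> Phi q" using opt admq by (auto simp: optimal_def)
  also have "Phi q \<le> (\<integral>z. phi (p z) + (t * h z / k z) * L z \<partial>K)"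
    unfolding Phi_def using pint phq key hK(1)[of L BL] Lb
    by (intro integral_mono) (auto simp: algebra_simps)
  also have "\<dots> = Phi p + t * (\<integral>z. h z * L z \<partial>M)"
    using pint hK[of L BL] Lb by (simp add: Phi_def)
  finally have pos: "0 \<le> (\<integral>z. h z * L z \<partial>M)" using t by (simp add: zero_le_mult_iff)
  \<comment> \<open>Adding both slot formulas shows that the integral of \<open>Q\<close> is
    \<open>-2\<close> times that of \<open>h * L\<close>, hence at most 0 by optimality. As
    \<open>Q\<close> is positive on \<open>E\<close> and zero elsewhere, \<open>E\<close> must be a
    null set.\<close>
  define Q where "Q w = indicator E w * (L (fst (exch w)) + L (snd (exch w)) - L (fst w) - L (snd w))" for w
  have QE: "0 < L (fst (exch w)) + L (snd (exch w)) - L (fst w) - L (snd w)" if "w \<in> E" for w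
  proof -
    have w: "p (fst w) * p (snd w) + d \<le> p (fst (exch w)) * p (snd (exch w))"
     "p (fst w) \<le> N" "p (snd w) \<le> N" "p (fst (exch w)) \<le> N" "p (snd (exch w)) \<le> N"
      using that by (auto simp: E_def)
    define e where "e = 2 * N * \<eta> + \<eta>"
    have prod: "\<bar>a z * a z' - p z * p z'\<bar> \<le> e" if "p z \<le> N" "p z' \<le> N" for z z'
    proof -
      have "\<bar>a z - p z\<bar> * a z' \<le> \<eta> * (N + \<eta>)"
        using aN[OF that(1)] aN[OF that(2)] that ab[of z'] eta by (intro mult_mono) auto
      moreover have "p z * \<bar>a z' - p z'\<bar> \<le> N * \<eta>"
        using aN[OF that(2)] that p0 N by (intro mult_mono) auto
      moreover have "a z * a z' - p z * p z' = (a z - p z) * a z' + p z * (a z' - p z')"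
        by (simp add: algebra_simps)
      moreover have "\<bar>(a z - p z) * a z' + p z * (a z' - p z')\<bar> \<le> \<bar>a z - p z\<bar> * a z' + p z * \<bar>a z' - p z'\<bar>"
        using ab[of z'] eta p0[of z] by (intro order_trans[OF abs_triangle_ineq]) (auto simp: abs_mult)
      moreover have "\<eta> * \<eta> \<le> \<eta> * 1" using eta by (intro mult_left_mono) auto
      ultimately show ?thesis by (simp add: e_def algebra_simps)
    qed
    have "\<eta> * (8 * N + 4) \<le> d" using eta(5) N by (simp add: field_simps)
    then have "2 * e < d" using d by (simp add: e_def algebra_simps)
    then have "a (fst w) * a (snd w) < a (fst (exch w)) * a (snd (exch w))"
      using prod[OF w(2,3)] prod[OF w(4,5)] w(1) by linarith
    moreover have pos: "0 < a z" for z using ab[of z] eta by linarith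
    ultimately have "ln (a (fst w) * a (snd w)) < ln (a (fst (exch w)) * a (snd (exch w)))"
      by (intro ln_less_cancel_iff[THEN iffD2] mult_pos_pos) auto
    then have "ln (a (fst w)) + ln (a (snd w)) < ln (a (fst (exch w))) + ln (a (snd (exch w)))"
      using pos by (simp only: ln_mult_pos)
    then show ?thesis by (simp add: L_def)
  qed
  have Q0: "0 \<le> Q w" for w using QE[of w] by (auto simp: Q_def indicator_def)
  have "(\<integral>w. Q w \<partial>(M \<Otimes>\<^sub>M M)) = - ((\<integral>z. h z * L z \<partial>M) + (\<integral>z. h z * L z \<partial>M))"
    and Qi: "integrable (M \<Otimes>\<^sub>M M) Q"
  proof -
    have Qeq: "Q = (\<lambda>w. - (indicator E w * (L (fst w) - L (fst (exch w))) + indicator E w * (L (snd w) - L (snd (exch w)))))"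
      by (auto simp: Q_def algebra_simps)
    note i = iE[of L BL] and hL = hf[of L BL]
    show "integrable (M \<Otimes>\<^sub>M M) Q" unfolding Qeq using i Lb by auto
    have "(\<integral>w. Q w \<partial>(M \<Otimes>\<^sub>M M)) = - ((\<integral>w. indicator E w * (L (fst w) - L (fst (exch w))) \<partial>(M \<Otimes>\<^sub>M M))
       + (\<integral>w. indicator E w * (L (snd w) - L (snd (exch w))) \<partial>(M \<Otimes>\<^sub>M M)))"
      unfolding Qeq using i Lb by (subst integral_minus, subst Bochner_Integration.integral_add) auto
    then show "(\<integral>w. Q w \<partial>(M \<Otimes>\<^sub>M M)) = - ((\<integral>z. h z * L z \<partial>M) + (\<integral>z. h z * L z \<partial>M))"
      using hL Lb by simp
  qed
  moreover have "0 \<le> (\<integral>w. Q w \<partial>(M \<Otimes>\<^sub>M M))"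
    by (rule Bochner_Integration.integral_nonneg) (rule Q0)
  ultimately have "(\<integral>w. Q w \<partial>(M \<Otimes>\<^sub>M M)) = 0" using pos by linarith
  then have "AE w in M \<Otimes>\<^sub>M M. Q w = 0"
    using integral_nonneg_eq_0_iff_AE[OF Qi] Q0 by auto
  then show ?thesis
  proof eventually_elim
    case (elim w) then show ?case using QE[of w] by (auto simp: Q_def)
  qed
qed

text \<open>A strict inequality between the two products has a gap of at least
  \<open>1 / (n + 1)\<close> and involves values of at most \<open>n + 1\<close> for some
  \<open>n\<close>, so countably many null sets of the preceding lemma cover it. The reverse
  inequality follows since \<open>exch\<close> is a measure-preserving involution.\<close>

lemma optimal_exch:
  assumes opt: "optimal p"
  shows "AE w in M \<Otimes>\<^sub>M M. p (fst w) * p (snd w) = p (fst (exch w)) * p (snd (exch w))"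
proof -
  have adm: "admissible p" using opt by (simp add: optimal_def)
  have [measurable]: "p \<in> borel_measurable (borel \<Otimes>\<^sub>M borel)" by (rule admissibleD(1)[OF adm])
  have [measurable]: "p \<in> borel_measurable M" by measurable
  have "AE w in M \<Otimes>\<^sub>M M. \<forall>n::nat. \<not> (p (fst w) * p (snd w) + inverse (Suc n) \<le> p (fst (exch w)) * p (snd (exch w))
     \<and> p (fst w) \<le> real (Suc n) \<and> p (snd w) \<le> real (Suc n) \<and> p (fst (exch w)) \<le> real (Suc n) \<and> p (snd (exch w)) \<le> real (Suc n))"
    unfolding AE_all_countable
    using optimal_exch_null[OF opt, of "inverse (Suc n)" "Suc n" for n] by auto
  then have le: "AE w in M \<Otimes>\<^sub>M M. p (fst (exch w)) * p (snd (exch w)) \<le> p (fst w) * p (snd w)"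
  proof eventually_elim
    case (elim w)
    show ?case
    proof (rule ccontr)
      assume "\<not> ?case"
      then have "0 < p (fst (exch w)) * p (snd (exch w)) - p (fst w) * p (snd w)" by simp
      then obtain n where n: "inverse (real (Suc n)) < p (fst (exch w)) * p (snd (exch w)) - p (fst w) * p (snd w)"
        using reals_Archimedean by blast
      define B where "B = p (fst w) + p (snd w) + p (fst (exch w)) + p (snd (exch w))"
      obtain m where m: "B \<le> real m" using real_arch_simple by blast
      have B: "p (fst w) \<le> B" "p (snd w) \<le> B" "p (fst (exch w)) \<le> B" "p (snd (exch w)) \<le> B"
        using admissibleD(2)[OF adm] by (auto simp: B_def add_nonneg_nonneg)
      have mono: "inverse (real (Suc (n + m))) \<le> inverse (real (Suc n))"
        by (intro le_imp_inverse_le) auto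
      have "B \<le> real (Suc (n + m))" using m by simp
      then show False using elim[rule_format, of "n + m"] n mono B by linarith
    qed
  qed
  then have "AE w in distr (M \<Otimes>\<^sub>M M) (M \<Otimes>\<^sub>M M) exch.
      p (fst (exch w)) * p (snd (exch w)) \<le> p (fst w) * p (snd w)" by (simp only: distr_exch)
  then have "AE w in M \<Otimes>\<^sub>M M. p (fst (exch (exch w))) * p (snd (exch (exch w))) \<le> p (fst (exch w)) * p (snd (exch w))"
    by (rule AE_distrD[rotated]) measurable
  with le show ?thesis by eventually_elim simp
qed

end

section \<open>Marginal densities, profiles and minimizers on a cell\<close>

text \<open>If the density exceeded 1 on a set of positive measure, \<open>N\<close> would exceed
  \<open>L\<close> there. Applied to the second marginals of cells, which are dominated by
  \<open>\<nu>\<close>.\<close>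

lemma nn_density_le_1:
  fixes N L :: "'z measure"
  assumes L: "prob_space L" and s: "sets N = sets L" and le: "\<And>A. A \<in> sets L \<Longrightarrow> emeasure N A \<le> emeasure L A"
  obtains f where "f \<in> borel_measurable L" "\<And>z. 0 \<le> f z" "\<And>z. f z \<le> (1::real)"
    "N = density L (\<lambda>z. ennreal (f z))"
proof -
  interpret L: prob_space L by fact
  have ac: "absolutely_continuous L N"
    unfolding absolutely_continuous_def
  proof
    fix A assume "A \<in> null_sets L"
    then show "A \<in> null_sets N" using le[of A] s by (auto simp: null_sets_def)
  qed
  define r where "r = RN_deriv L N"
  have [measurable]: "r \<in> borel_measurable L" by (simp add: r_def)
  have N: "density L r = N" unfolding r_def by (rule L.density_RN_deriv[OF ac s])
  define A where "A = {z \<in> space L. 1 < r z}"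
  have A[measurable]: "A \<in> sets L" unfolding A_def by measurable
  have "AE z in L. r z * indicator A z \<le> indicator A z"
  proof (rule ccontr)
    assume n: "\<not> ?thesis"
    have "(\<integral>\<^sup>+z. indicator A z \<partial>L) < (\<integral>\<^sup>+z. r z * indicator A z \<partial>L)"
    proof (rule nn_integral_less)
      show "(\<integral>\<^sup>+z. indicator A z \<partial>L) \<noteq> \<infinity>" by (simp add: top.not_eq_extremum)
      show "AE z in L. indicator A z \<le> r z * indicator A z"
        by (rule AE_I2) (auto simp: A_def indicator_def)
    qed (use n in auto)
    also have "(\<integral>\<^sup>+z. r z * indicator A z \<partial>L) = emeasure N A"
      by (simp add: N[symmetric] emeasure_density)
    finally show False using le[OF A] by (simp add: not_less[symmetric])
  qed
  then have r1: "AE z in L. r z \<le> 1"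
    by (elim AE_mp, intro AE_I2) (auto simp: A_def indicator_def split: if_splits)
  define f where "f z = min 1 (enn2real (r z))" for z
  have "N = density L (\<lambda>z. ennreal (f z))"
    unfolding N[symmetric]
  proof (rule density_cong)
    show "AE z in L. r z = ennreal (f z)" using r1
    proof eventually_elim
      case (elim z)
      then have "r z < \<top>" by (rule le_less_trans) simp
      then have "ennreal (enn2real (r z)) = r z" by simp
      moreover from this elim have "enn2real (r z) \<le> 1" by (metis enn2real_nonneg ennreal_le_1)
      ultimately show ?case by (simp add: f_def)
    qed
  qed (auto simp: f_def)
  moreover have "f \<in> borel_measurable L" unfolding f_def by measurable
  ultimately show ?thesis by (intro that[of f]) (auto simp: f_def)
qed

context bounded_kernel
begin

lemma AE_fst:
  assumes "AE x in \<mu>. Q x" shows "AE z in M. Q (fst z)"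
proof -
  have "AE x in distr M \<mu> fst. Q x" using assms by (simp only: M2.distr_pair_fst)
  then show ?thesis by (rule AE_distrD[rotated]) simp
qed

lemma AE_snd: 
  assumes "AE y in \<nu>. Q y" shows "AE z in M. Q (snd z)"
proof -
  have "distr M \<nu> snd = \<nu>"
  proof (rule measure_eqI)
    fix A assume A: "A \<in> sets (distr M \<nu> snd)"
    have "snd -` A \<inter> space M = UNIV \<times> A" by (auto simp: space_M)
    then have "emeasure (distr M \<nu> snd) A = emeasure M (space \<mu> \<times> A)"
      using A by (simp add: emeasure_distr space_mu)
    also have "\<dots> = emeasure \<nu> A"
      using A by (subst M2.emeasure_pair_measure_Times) (auto simp: M1.emeasure_space_1)
    finally show "emeasure (distr M \<nu> snd) A = emeasure \<nu> A" .
  qed simp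
  then have "AE y in distr M \<nu> snd. Q y" using assms by (simp only:)
  then show ?thesis by (rule AE_distrD[rotated]) simp
qed

definition X_density where "X_density q x = (\<integral>\<^sup>+y. ennreal (k (x, y) * q (x, y)) \<partial>\<nu>)"
definition Y_density where "Y_density q y = (\<integral>\<^sup>+x. ennreal (k (x, y) * q (x, y)) \<partial>\<mu>)"

lemma X_density_measurable [measurable]:
  assumes [measurable]: "q \<in> borel_measurable (borel \<Otimes>\<^sub>M borel)"
  shows "X_density q \<in> borel_measurable borel"
proof -
  have "X_density q \<in> borel_measurable \<mu>" unfolding X_density_def by measurable
  then show ?thesis by (simp add: measurable_cong_sets[OF sets_mu refl])
qed

lemma Y_density_measurable [measurable]:
  assumes [measurable]: "q \<in> borel_measurable (borel \<Otimes>\<^sub>M borel)"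
  shows "Y_density q \<in> borel_measurable borel"
proof -
  have "Y_density q \<in> borel_measurable \<nu>" unfolding Y_density_def by measurable
  then show ?thesis by (simp add: measurable_cong_sets[OF sets_nu refl])
qed

lemma nn_integral_dens:
  assumes [measurable]: "q \<in> borel_measurable (borel \<Otimes>\<^sub>M borel)" "f \<in> borel_measurable (borel \<Otimes>\<^sub>M borel)"
  assumes "\<And>z. 0 \<le> q z"
  shows "(\<integral>\<^sup>+z. f z \<partial>dens q) = (\<integral>\<^sup>+z. ennreal (k z * q z) * f z \<partial>M)"
  unfolding dens_def K_def
  by (subst nn_integral_density, measurable)+ (auto simp: ennreal_mult assms(3) k_nonneg mult.assoc)

lemma marginal_X_dens:
  assumes [measurable]: "q \<in> borel_measurable (borel \<Otimes>\<^sub>M borel)" and "\<And>z. 0 \<le> q z"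
  shows "marginal_X (dens q) = density \<mu> (X_density q)"
proof (rule measure_eqI)
  fix A assume "A \<in> sets (marginal_X (dens q))"
  then have [measurable]: "A \<in> sets borel" by (simp add: marginal_X_def)
  have "emeasure (marginal_X (dens q)) A = (\<integral>\<^sup>+x. indicator A x \<partial>marginal_X (dens q))"
    by (simp add: marginal_X_def)
  also have "\<dots> = (\<integral>\<^sup>+z. indicator A (fst z) \<partial>dens q)"
    unfolding marginal_X_def by (rule nn_integral_distr) measurable
  also have "\<dots> = (\<integral>\<^sup>+z. ennreal (k z * q z) * indicator A (fst z) \<partial>M)"
    by (rule nn_integral_dens) (use assms in auto)
  also have "\<dots> = (\<integral>\<^sup>+x. X_density q x * indicator A x \<partial>\<mu>)"
    unfolding X_density_def by (subst M2.nn_integral_fst[symmetric]) (auto simp: nn_integral_multc)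
  finally show "emeasure (marginal_X (dens q)) A = emeasure (density \<mu> (X_density q)) A"
    by (simp add: emeasure_density)
qed (simp add: marginal_X_def sets_mu)

lemma marginal_Y_dens:
  assumes [measurable]: "q \<in> borel_measurable (borel \<Otimes>\<^sub>M borel)" and "\<And>z. 0 \<le> q z"
  shows "marginal_Y (dens q) = density \<nu> (Y_density q)"
proof (rule measure_eqI)
  fix A assume "A \<in> sets (marginal_Y (dens q))"
  then have [measurable]: "A \<in> sets borel" by (simp add: marginal_Y_def)
  have "emeasure (marginal_Y (dens q)) A = (\<integral>\<^sup>+x. indicator A x \<partial>marginal_Y (dens q))"
    by (simp add: marginal_Y_def)
  also have "\<dots> = (\<integral>\<^sup>+z. indicator A (snd z) \<partial>dens q)"
    unfolding marginal_Y_def by (rule nn_integral_distr) measurable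
  also have "\<dots> = (\<integral>\<^sup>+z. ennreal (k z * q z) * indicator A (snd z) \<partial>M)"
    by (rule nn_integral_dens) (use assms in auto)
  also have "\<dots> = (\<integral>\<^sup>+y. Y_density q y * indicator A y \<partial>\<nu>)"
    unfolding Y_density_def by (subst nn_integral_snd[symmetric]) (auto simp: nn_integral_multc)
  finally show "emeasure (marginal_Y (dens q)) A = emeasure (density \<nu> (Y_density q)) A"
    by (simp add: emeasure_density)
qed (simp add: marginal_Y_def sets_nu)

lemma marginal_X_eq_restr_iff:
  assumes [measurable]: "q \<in> borel_measurable (borel \<Otimes>\<^sub>M borel)" and "\<And>z. 0 \<le> q z" and [measurable]: "S \<in> sets borel"
  shows "marginal_X (dens q) = restr \<mu> S \<longleftrightarrow> (AE x in \<mu>. X_density q x = indicator S x)"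
  unfolding restr_def marginal_X_dens[OF assms(1,2)] by (rule M1.density_unique_iff) measurable

definition normalizer where "normalizer v x = (\<integral>y. k (x, y) * v y \<partial>\<nu>)"

text \<open>The \<open>y\<close>-factor of a product \<open>u(x) v(y)\<close> is determined only up
  to a constant. Unit integral fixes the constant and places every \<open>normalizer v x\<close>
  between \<open>\<kappa>\<close> and 1.\<close>

definition is_profile where
  "is_profile v \<longleftrightarrow> v \<in> borel_measurable borel \<and> (\<forall>y. 0 \<le> v y) \<and> integrable \<nu> v \<and> (\<integral>y. v y \<partial>\<nu>) = 1"

lemma profileD:
  assumes "is_profile v"
  shows "v \<in> borel_measurable borel" "0 \<le> v y" "integrable \<nu> v" "(\<integral>y. v y \<partial>\<nu>) = 1"
  using assms unfolding is_profile_def by blast+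

lemma integrable_section:
  assumes "integrable \<nu> f" shows "integrable \<nu> (\<lambda>y. k (x, y) * f y)"
proof (rule Bochner_Integration.integrable_bound[OF assms])
  have [measurable]: "f \<in> borel_measurable \<nu>" using assms by auto
  show "(\<lambda>y. k (x, y) * f y) \<in> borel_measurable \<nu>" by measurable
  show "AE y in \<nu>. norm (k (x, y) * f y) \<le> norm (f y)"
    by (auto simp: abs_mult abs_of_nonneg k_nonneg k_le_1 intro!: mult_left_le_one_le)
qed

lemma normalizer_bounds:
  assumes v: "is_profile v"
  shows "\<kappa> \<le> normalizer v x" "normalizer v x \<le> 1" "0 < normalizer v x"
proof -
  note p = profileD[OF v]
  have i: "integrable \<nu> (\<lambda>y. k (x, y) * v y)" by (rule integrable_section[OF p(3)])
  have "(\<integral>y. \<kappa> * v y \<partial>\<nu>) \<le> normalizer v x" unfolding normalizer_def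
    using i p by (intro integral_mono) (auto intro!: mult_right_mono kappa_le)
  then show "\<kappa> \<le> normalizer v x" using p by simp
  then show "0 < normalizer v x" using kappa_pos by simp
  have "normalizer v x \<le> (\<integral>y. 1 * v y \<partial>\<nu>)" unfolding normalizer_def
    using i p by (intro integral_mono mult_right_mono k_le_1) auto
  then show "normalizer v x \<le> 1" using p by simp
qed

lemma normalizer_measurable [measurable]:
  assumes v: "v \<in> borel_measurable borel" shows "normalizer v \<in> borel_measurable borel"
proof -
  note [measurable] = v
  have "normalizer v \<in> borel_measurable \<mu>" unfolding normalizer_def by measurable
  then show ?thesis by (simp add: measurable_cong_sets[OF sets_mu refl])
qed

lemma nn_integral_normalizer:
  assumes v: "is_profile v" shows "(\<integral>\<^sup>+y. ennreal (k (x, y) * v y) \<partial>\<nu>) = ennreal (normalizer v x)"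
  unfolding normalizer_def using profileD[OF v]
  by (intro nn_integral_eq_integral integrable_section) (auto simp: k_nonneg)

text \<open>The \<open>x\<close>-factor is forced: marginal \<open>\<mu>\<close> means that the
  integral of \<open>k(x, -)\<close> times the section at \<open>x\<close> is 1. So \<open>v\<close>
  alone describes the density, and the formula makes sense at every \<open>x\<close>, also outside
  the cell on which \<open>v\<close> was found. This is the extension \<open>t\<close> of the
  overview.\<close>

definition kern where "kern v z = v (snd z) / normalizer v (fst z)"

lemma kern_measurable [measurable]:
  assumes v: "v \<in> borel_measurable borel" shows "kern v \<in> borel_measurable (borel \<Otimes>\<^sub>M borel)"
proof -
  note [measurable] = v
  show ?thesis unfolding kern_def by measurable
qed

text \<open>Integrating \<open>p(x,y) p(x',y') = p(x,y') p(x',y)\<close> over \<open>(x',y')\<close> factorises \<open>p\<close>.\<close>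

lemma optimal_factor:
  assumes opt: "optimal p" and mX: "marginal_X (dens p) = restr \<mu> S"
    and S [measurable]: "S \<in> sets borel" and Spos: "measure \<mu> S > 0"
  obtains v where "is_profile v" "AE z in M. p z = indicator S (fst z) * kern v z"
proof -
  interpret MM: pair_prob_space M M ..
  have adm: "admissible p" using opt by (simp add: optimal_def)
  note p0 = admissibleD(2)[OF adm]
  have [measurable]: "p \<in> borel_measurable (borel \<Otimes>\<^sub>M borel)" by (rule admissibleD(1)[OF adm])
  have yS: "AE x in \<mu>. X_density p x = indicator S x"
    using mX marginal_X_eq_restr_iff[of p S] p0 by simp
  define A where "A x = (\<integral>\<^sup>+y. ennreal (p (x, y)) \<partial>\<nu>)" for x
  define B where "B y = (\<integral>\<^sup>+x. ennreal (p (x, y)) \<partial>\<mu>)" for y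
  have [measurable]: "A \<in> borel_measurable \<mu>" "B \<in> borel_measurable \<nu>"
    unfolding A_def B_def by measurable
  have ikp: "integrable M (\<lambda>z. k z * p z)"
    using admissibleD(4)[OF adm] by (simp add: integrable_K_iff)
  have ip: "integrable M p"
  proof (rule Bochner_Integration.integrable_bound)
    show "integrable M (\<lambda>z. k z * p z / \<kappa>)" using ikp by simp
    have "p z \<le> k z * p z / \<kappa>" for z
      using mult_right_mono[OF kappa_le[of z] p0[of z]] kappa_pos by (simp add: field_simps)
    then show "AE z in M. norm (p z) \<le> norm (k z * p z / \<kappa>)"
      using p0 k_nonneg kappa_pos by (auto simp: abs_mult)
  qed measurable
  \<comment> \<open>The integral is taken against \<open>M\<close>, not \<open>K\<close>, because
    the exchange identity holds for \<open>M \<Otimes>\<^sub>M M\<close> without weights. From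
    \<open>k z \<le> 1\<close> follows \<open>b \<ge> measure \<mu> S > 0\<close>, so division by
    \<open>b\<close> is possible.\<close>
  define b where "b = (\<integral>z. p z \<partial>M)"
  have nb: "(\<integral>\<^sup>+z. ennreal (p z) \<partial>M) = ennreal b"
    unfolding b_def by (rule nn_integral_eq_integral[OF ip]) (use p0 in auto)
  have "ennreal (measure \<mu> S) = (\<integral>\<^sup>+x. indicator S x \<partial>\<mu>)"
    by (simp add: M1.emeasure_eq_measure)
  also have "\<dots> = (\<integral>\<^sup>+x. X_density p x \<partial>\<mu>)" using yS by (intro nn_integral_cong_AE) (auto elim: eventually_mono)
  also have "\<dots> = (\<integral>\<^sup>+z. ennreal (k z * p z) \<partial>M)"
    unfolding X_density_def by (subst M2.nn_integral_fst[symmetric]) auto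
  also have "\<dots> \<le> (\<integral>\<^sup>+z. ennreal (p z) \<partial>M)"
    using p0 k_nonneg k_le_1 by (intro nn_integral_mono ennreal_leI mult_left_le_one_le) auto
  finally have "0 < ennreal b" using Spos nb by (metis ennreal_less_zero_iff order_less_le_trans)
  then have b: "0 < b" by simp
  have intA: "(\<integral>\<^sup>+x. A x \<partial>\<mu>) = ennreal b" and intB: "(\<integral>\<^sup>+y. B y \<partial>\<nu>) = ennreal b"
    using nb M2.nn_integral_fst[of "\<lambda>z. ennreal (p z)" \<mu>] nn_integral_snd[of "\<lambda>(x,y). ennreal (p (x, y))"]
    unfolding A_def B_def by (simp_all add: split_beta')
  have finA: "AE x in \<mu>. A x \<noteq> \<infinity>" by (rule nn_integral_PInf_AE) (auto simp: intA)
  have finB: "AE y in \<nu>. B y \<noteq> \<infinity>" by (rule nn_integral_PInf_AE) (auto simp: intB)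
  define A' where "A' x = enn2real (A x)" for x
  define B' where "B' y = enn2real (B y)" for y
  have "AE z in M. AE z' in M. p z * p z' = p (fst z, snd z') * p (fst z', snd z)"
    using MM.AE_pair[OF optimal_exch[OF opt]] by (simp add: exch_def)
  then have "AE z in M. p z * b = A' (fst z) * B' (snd z)"
    using AE_fst[OF finA] AE_snd[OF finB]
  proof eventually_elim
    case (elim z)
    obtain x y where z: "z = (x, y)" by (cases z)
    have "ennreal (p z) * ennreal b = (\<integral>\<^sup>+z'. ennreal (p z) * ennreal (p z') \<partial>M)"
      by (simp add: nn_integral_cmult nb)
    also have "\<dots> = (\<integral>\<^sup>+z'. ennreal (p (fst z, snd z')) * ennreal (p (fst z', snd z)) \<partial>M)"
      using elim(1) by (intro nn_integral_cong_AE) (auto elim!: eventually_mono simp: ennreal_mult[symmetric] p0)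
    also have "\<dots> = (\<integral>\<^sup>+x'. \<integral>\<^sup>+y'. ennreal (p (x, y')) * ennreal (p (x', y)) \<partial>\<nu> \<partial>\<mu>)"
      unfolding z by (subst M2.nn_integral_fst[symmetric]) auto
    also have "\<dots> = A x * B y"
      unfolding A_def B_def by (simp add: nn_integral_multc nn_integral_cmult)
    also have "\<dots> = ennreal (A' x) * ennreal (B' y)"
      using elim(2,3) by (simp add: A'_def B'_def z less_top)
    finally have "ennreal (p z * b) = ennreal (A' x * B' y)"
      using p0 b by (simp add: ennreal_mult A'_def B'_def)
    then show ?case using p0 b by (simp add: z A'_def B'_def)
  qed
  then have prod: "AE z in M. p z = A' (fst z) * (B' (snd z) / b)"
    by eventually_elim (use b in \<open>simp add: field_simps\<close>)
  have [measurable]: "B' \<in> borel_measurable borel"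
    using \<open>B \<in> borel_measurable \<nu>\<close> unfolding B'_def by (simp add: measurable_cong_sets[OF sets_nu refl])
  define v where "v y = B' y / b" for y
  have nv: "(\<integral>\<^sup>+y. ennreal (v y) \<partial>\<nu>) = 1"
  proof -
    have "(\<integral>\<^sup>+y. ennreal (v y) \<partial>\<nu>) = (\<integral>\<^sup>+y. B y / ennreal b \<partial>\<nu>)"
      using finB by (intro nn_integral_cong_AE)
        (auto elim!: eventually_mono simp: v_def B'_def divide_ennreal[symmetric] b less_top)
    also have "\<dots> = 1" using b by (simp add: nn_integral_divide intB ennreal_divide_self)
    finally show ?thesis .
  qed
  have v: "is_profile v"
  proof -
    have m: "v \<in> borel_measurable borel" unfolding v_def by measurable
    have n: "0 \<le> v y" for y using b by (simp add: v_def B'_def)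
    have i: "integrable \<nu> v"
      using m n nv by (intro integrableI_nonneg) auto
    have "(\<integral>y. v y \<partial>\<nu>) = 1"
      using nn_integral_eq_integral[OF i] n nv by simp
    with m n i show ?thesis by (simp add: is_profile_def)
  qed
  have "AE x in \<mu>. AE y in \<nu>. p (x, y) = A' x * v y"
    using AE_pair[OF prod] by (simp add: v_def)
  \<comment> \<open>The prescribed first marginal determines the \<open>x\<close>-factor: it is the
    reciprocal of the normalizer on \<open>S\<close> and 0 elsewhere.\<close>
  then have AZ: "AE x in \<mu>. A' x * normalizer v x = indicator S x"
    using yS
  proof eventually_elim
    case (elim x)
    have "X_density p x = (\<integral>\<^sup>+y. ennreal (A' x) * ennreal (k (x, y) * v y) \<partial>\<nu>)"
      unfolding X_density_def using elim(1) profileD(2)[OF v]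
      by (intro nn_integral_cong_AE) (auto elim!: eventually_mono simp: ennreal_mult[symmetric] A'_def k_nonneg mult_ac)
    also have "\<dots> = ennreal (A' x) * ennreal (normalizer v x)"
      using profileD(1)[OF v] by (simp add: nn_integral_cmult nn_integral_normalizer[OF v])
    finally have "ennreal (A' x * normalizer v x) = ennreal (indicator S x)"
      using elim(2) normalizer_bounds(3)[OF v, of x] by (simp add: ennreal_mult A'_def ennreal_indicator)
    then show ?case using normalizer_bounds(3)[OF v, of x] by (simp add: A'_def)
  qed
  have "AE z in M. p z = indicator S (fst z) * kern v z"
    using prod AE_fst[OF AZ]
  proof eventually_elim
    case (elim z)
    have "A' (fst z) = indicator S (fst z) / normalizer v (fst z)"
      using elim(2) normalizer_bounds(3)[OF v, of "fst z"] by (simp add: field_simps)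
    then show ?case using elim(1) by (simp add: kern_def v_def)
  qed
  then show ?thesis using v that by blast
qed

text \<open>Both \<open>k\<close> and the normalizer lie between \<open>\<kappa>\<close> and 1, so
  \<open>k * kern v\<close> lies between \<open>\<kappa> * v y\<close> and
  \<open>v y / \<kappa>\<close> at every \<open>x\<close>; integration over \<open>T\<close> gives
  the bounds. They translate knowledge of second marginals into bounds on profiles.\<close>

lemma Y_density_bounds:
  assumes [measurable]: "q \<in> borel_measurable (borel \<Otimes>\<^sub>M borel)" "T \<in> sets borel" and v: "is_profile v"
    and eq: "AE z in M. fst z \<in> T \<longrightarrow> q z = kern v z"
  shows "AE y in \<nu>. ennreal (\<kappa> * v y * measure \<mu> T) \<le> Y_density (\<lambda>z. indicator T (fst z) * q z) y
     \<and> Y_density (\<lambda>z. indicator T (fst z) * q z) y \<le> ennreal (v y * measure \<mu> T / \<kappa>)"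
proof -
  have [measurable]: "v \<in> borel_measurable borel" by (rule profileD(1)[OF v])
  have "AE x in \<mu>. AE y in \<nu>. x \<in> T \<longrightarrow> q (x, y) = kern v (x, y)"
    using AE_pair[OF eq] by simp
  then have "AE y in \<nu>. AE x in \<mu>. x \<in> T \<longrightarrow> q (x, y) = kern v (x, y)"
    by (subst (asm) AE_commute) measurable
  then show ?thesis
  proof eventually_elim
    case (elim y)
    have e: "Y_density (\<lambda>z. indicator T (fst z) * q z) y = (\<integral>\<^sup>+x. ennreal (k (x, y) * kern v (x, y)) * indicator T x \<partial>\<mu>)"
      unfolding Y_density_def using elim
      by (intro nn_integral_cong_AE) (auto elim!: eventually_mono simp: indicator_def)
    have m: "(\<integral>\<^sup>+x. ennreal c * indicator T x \<partial>\<mu>) = ennreal (c * measure \<mu> T)" if "0 \<le> c" for c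
      using that by (simp add: nn_integral_cmult_indicator M1.emeasure_eq_measure ennreal_mult)
    note v0 = profileD(2)[OF v, of y]
    have l: "\<kappa> * v y \<le> k (x, y) * kern v (x, y)" for x
    proof -
      have "v y / 1 \<le> v y / normalizer v x" using v0 normalizer_bounds[OF v, of x] by (intro divide_left_mono) auto
      then show ?thesis using v0 kappa_pos unfolding kern_def
        by (intro mult_mono kappa_le k_nonneg) auto
    qed
    have u: "k (x, y) * kern v (x, y) \<le> v y / \<kappa>" for x
    proof -
      have "v y / normalizer v x \<le> v y / \<kappa>" using v0 normalizer_bounds[OF v, of x] kappa_pos by (intro divide_left_mono) auto
      then have "k (x, y) * kern v (x, y) \<le> 1 * (v y / \<kappa>)" using v0 normalizer_bounds[OF v, of x] unfolding kern_def
        by (intro mult_mono k_le_1) auto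
      then show ?thesis by simp
    qed
    have "(\<integral>\<^sup>+x. ennreal (\<kappa> * v y) * indicator T x \<partial>\<mu>) \<le> Y_density (\<lambda>z. indicator T (fst z) * q z) y"
      unfolding e by (intro nn_integral_mono mult_right_mono ennreal_leI l) auto
    moreover have "Y_density (\<lambda>z. indicator T (fst z) * q z) y \<le> (\<integral>\<^sup>+x. ennreal (v y / \<kappa>) * indicator T x \<partial>\<mu>)"
      unfolding e by (intro nn_integral_mono mult_right_mono ennreal_leI u) auto
    ultimately show ?case using v0 kappa_pos by (simp add: m)
  qed
qed

lemma admissible_bounded:
  assumes [measurable]: "q \<in> borel_measurable (borel \<Otimes>\<^sub>M borel)" and "\<And>z. 0 \<le> q z" "\<And>z. q z \<le> b"
  shows "admissible q"
  unfolding admissible_def using assms phi_bounded_on[OF assms(2,3)]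
  by (auto intro!: integrable_bounded(1)[of _ "1 + b * b"] simp: phi_nonneg abs_of_nonneg)

text \<open>The product of the two marginals, divided by their common mass, has a bounded density
  with respect to \<open>K\<close> because \<open>\<kappa> \<le> k z\<close>. It shows that the
  minimal value of a cell problem is finite.\<close>

lemma ex_admissible_coupling:
  assumes S [measurable]: "S \<in> sets borel" and Spos: "measure \<mu> S > 0"
    and s: "sets \<nu>' = sets borel" and le: "\<And>A. A \<in> sets borel \<Longrightarrow> emeasure \<nu>' A \<le> emeasure \<nu> A"
    and mass: "emeasure \<nu>' UNIV = emeasure \<mu> S"
  shows "\<exists>q. admissible q \<and> dens q \<in> couplings (restr \<mu> S) \<nu>'"
proof -
  obtain n where n: "n \<in> borel_measurable \<nu>" "\<And>y. 0 \<le> n y" "\<And>y. n y \<le> (1::real)"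
     and \<nu>': "\<nu>' = density \<nu> (\<lambda>y. ennreal (n y))"
    using nn_density_le_1[of \<nu> \<nu>'] s le sets_nu M2.prob_space_axioms by metis
  have [measurable]: "n \<in> borel_measurable borel" using n(1) by (simp add: measurable_cong_sets[OF sets_nu refl])
  define m where "m = measure \<mu> S"
  have m: "0 < m" using Spos by (simp add: m_def)
  have nm: "(\<integral>\<^sup>+y. ennreal (n y) \<partial>\<nu>) = ennreal m"
  proof -
    have "emeasure \<nu>' UNIV = (\<integral>\<^sup>+y. ennreal (n y) \<partial>\<nu>)"
      unfolding \<nu>' by (subst emeasure_density) (auto simp: sets_nu)
    then show ?thesis using mass by (simp add: m_def M1.emeasure_eq_measure)
  qed
  define q where "q z = indicator S (fst z) * n (snd z) / (m * k z)" for z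
  have [measurable]: "q \<in> borel_measurable (borel \<Otimes>\<^sub>M borel)" unfolding q_def by measurable
  have q0: "0 \<le> q z" for z using n m k_nonneg by (simp add: q_def)
  have kq: "k z * q z = indicator S (fst z) * n (snd z) / m" for z using k_neq_0[of z] by (simp add: q_def)
  have "q z \<le> 1 / (m * \<kappa>)" for z
    unfolding q_def using n(2,3)[of "snd z"] m kappa_pos kappa_le
    by (intro frac_le mult_left_mono) (auto simp: indicator_def)
  then have adm: "admissible q" using q0 by (intro admissible_bounded) auto
  have "marginal_X (dens q) = restr \<mu> S"
  proof (subst marginal_X_eq_restr_iff)
    have "X_density q x = indicator S x" for x
    proof -
      have "X_density q x = (\<integral>\<^sup>+y. ennreal (indicator S x / m) * ennreal (n y) \<partial>\<nu>)"
        unfolding X_density_def kq using n m by (intro nn_integral_cong) (simp add: ennreal_mult[symmetric])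
      also have "\<dots> = ennreal (indicator S x / m) * ennreal m"
        by (subst nn_integral_cmult) (auto simp: nm n(1))
      also have "\<dots> = indicator S x" using m by (simp add: ennreal_mult[symmetric] ennreal_indicator)
      finally show ?thesis .
    qed
    then show "AE x in \<mu>. X_density q x = indicator S x" by simp
  qed (auto simp: q0)
  moreover have "marginal_Y (dens q) = \<nu>'"
  proof -
    have "Y_density q y = ennreal (n y)" for y
    proof -
      have "Y_density q y = (\<integral>\<^sup>+x. ennreal (n y / m) * indicator S x \<partial>\<mu>)"
        unfolding Y_density_def kq using n m by (intro nn_integral_cong) (auto simp: indicator_def)
      also have "\<dots> = ennreal (n y / m) * ennreal m"
        by (simp add: nn_integral_cmult_indicator M1.emeasure_eq_measure m_def sets_mu)
      also have "\<dots> = ennreal (n y)" using m n by (simp add: ennreal_mult[symmetric])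
      finally show ?thesis .
    qed
    then have "Y_density q = (\<lambda>y. ennreal (n y))" by auto
    then show ?thesis using q0 by (simp add: marginal_Y_dens \<nu>')
  qed
  ultimately show ?thesis using adm by (auto simp: couplings_def sets_dens)
qed

text \<open>A competitor of finite entropy forces the minimizer to have finite entropy, hence a
  density, and the problem for measures becomes one for densities.\<close>

lemma entropic_minimizer_optimal:
  assumes min: "entropic_minimizer \<epsilon> K (restr \<mu> S) \<nu>' \<rho>" and eps: "\<epsilon> > 0"
    and S [measurable]: "S \<in> sets borel" and Spos: "measure \<mu> S > 0"
    and s: "sets \<nu>' = sets borel" and le: "\<And>A. A \<in> sets borel \<Longrightarrow> emeasure \<nu>' A \<le> emeasure \<nu> A"
    and mass: "emeasure \<nu>' UNIV = emeasure \<mu> S"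
  obtains p where "optimal p" "\<rho> = dens p" "marginal_X (dens p) = restr \<mu> S" "marginal_Y (dens p) = \<nu>'"
proof -
  have cp: "\<rho> \<in> couplings (restr \<mu> S) \<nu>'"
    and le: "\<And>\<rho>'. \<rho>' \<in> couplings (restr \<mu> S) \<nu>' \<Longrightarrow> \<not> ereal \<epsilon> * KL \<rho>' K < ereal \<epsilon> * KL \<rho> K"
    using min by (auto simp: entropic_minimizer_def is_arg_min_def)
  have le: "KL \<rho> K \<le> KL \<rho>' K" if "\<rho>' \<in> couplings (restr \<mu> S) \<nu>'" for \<rho>'
  proof -
    have "ereal \<epsilon> * KL \<rho> K \<le> ereal \<epsilon> * KL \<rho>' K" using le[OF that] by simp
    then show ?thesis using eps by (simp add: ereal_mult_le_mult_iff)
  qed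
  obtain q where q: "admissible q" "dens q \<in> couplings (restr \<mu> S) \<nu>'"
    using ex_admissible_coupling[OF S Spos s assms(6) mass] by blast
  have "KL \<rho> K \<le> ereal (Phi q)"
    using le[OF q(2)] KL_admissible[OF q(1)] by simp
  then have "KL \<rho> K \<noteq> \<infinity>" by auto
  moreover have sr: "sets \<rho> = sets (borel \<Otimes>\<^sub>M borel)" and mX: "marginal_X \<rho> = restr \<mu> S" and mY: "marginal_Y \<rho> = \<nu>'"
    using cp by (auto simp: couplings_def)
  moreover have "finite_measure \<rho>"
  proof
    have "space \<rho> = UNIV" using sets_eq_imp_space_eq[OF sr] by (simp add: space_pair_measure)
    have [measurable_cong]: "sets \<rho> = sets (borel \<Otimes>\<^sub>M borel)" by (rule sr)
    have "emeasure \<rho> (space \<rho>) = emeasure (marginal_X \<rho>) UNIV"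
      unfolding marginal_X_def by (subst emeasure_distr) (auto simp: \<open>space \<rho> = UNIV\<close>)
    also have "\<dots> = emeasure \<mu> S" unfolding mX restr_def by (subst emeasure_density) (auto simp: sets_mu)
    finally show "emeasure \<rho> (space \<rho>) \<noteq> \<infinity>" by simp
  qed
  ultimately obtain p where p: "p \<in> borel_measurable (borel \<Otimes>\<^sub>M borel)" "\<And>z. 0 \<le> p z" "\<rho> = dens p"
    "integrable K (\<lambda>z. phi (p z))"
    using dens_of_finite_KL by metis
  have "optimal p" unfolding optimal_def
  proof (intro conjI allI impI)
    show "admissible p" using p by (simp add: admissible_def)
    fix q assume q: "admissible q" "marginal_X (dens q) = marginal_X (dens p)" "marginal_Y (dens q) = marginal_Y (dens p)"
    then have "dens q \<in> couplings (restr \<mu> S) \<nu>'" using p(3) mX mY by (simp add: couplings_def sets_dens)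
    from le[OF this] show "Phi p \<le> Phi q"
      using KL_dens_Phi[of q] admissibleD[OF q(1)] KL_dens_Phi[of p] p by simp
  qed
  then show ?thesis using that p(3) mX mY by blast
qed


subsection \<open>Bregman divergences\<close>

text \<open>With \<open>v\<close> bounded and bounded away from 0, \<open>ln (kern v z)\<close> is
  bounded and thus integrable against every admissible density.\<close>

definition bounded_profile where
  "bounded_profile v \<longleftrightarrow> is_profile v \<and> (\<exists>a b. 0 < a \<and> (\<forall>y. a \<le> v y \<and> v y \<le> b))"

text \<open>Bounds derived from marginals hold only almost everywhere. Truncation makes them hold at
  every \<open>y\<close> and alters \<open>v\<close> on a null set, so the normalizers do not change
  at all.\<close>

lemma clamp_profile:
  assumes v: "is_profile v" and ae: "AE y in \<nu>. a \<le> v y \<and> v y \<le> b" and "0 \<le> a"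
  obtains v' where "is_profile v'" "\<And>y. a \<le> v' y" "\<And>y. v' y \<le> b" "AE z in M. kern v' z = kern v z"
proof -
  have [measurable]: "v \<in> borel_measurable borel" by (rule profileD[OF v])
  have "\<exists>y. a \<le> v y \<and> v y \<le> b"
  proof (rule ccontr)
    assume no: "\<not> ?thesis"
    have "AE y in \<nu>. False" using ae by eventually_elim (use no in blast)
    then show False by simp
  qed
  then have ab: "a \<le> b" by auto
  define v' where "v' y = max a (min b (v y))" for y
  have [measurable]: "v' \<in> borel_measurable borel" unfolding v'_def by measurable
  have eq: "AE y in \<nu>. v' y = v y" using ae by eventually_elim (auto simp: v'_def)
  have "integrable \<nu> v'" using eq profileD(3)[OF v] by (subst integrable_cong_AE[of _ _ v]) auto
  moreover have "(\<integral>y. v' y \<partial>\<nu>) = 1" using eq profileD(4)[OF v] by (subst integral_cong_AE[of _ _ v]) auto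
  ultimately have p: "is_profile v'"
    using \<open>0 \<le> a\<close> by (auto simp: is_profile_def v'_def intro: le_max_iff_disj[THEN iffD2])
  have "normalizer v' x = normalizer v x" for x
    unfolding normalizer_def using eq by (intro integral_cong_AE) (auto elim: eventually_mono)
  then have "AE z in M. kern v' z = kern v z"
    using AE_snd[OF eq] by (auto simp: kern_def elim: eventually_mono)
  with p show ?thesis using ab by (intro that[of v']) (auto simp: v'_def)
qed

lemma kern_bounds:
  assumes v: "is_profile v" and "0 \<le> a" "\<And>y. a \<le> v y" "\<And>y. v y \<le> b"
  shows "a \<le> kern v z" "kern v z \<le> b / \<kappa>"
proof -
  note Z = normalizer_bounds[OF v, of "fst z"]
  have 0: "0 \<le> v (snd z)" by (rule profileD(2)[OF v])
  have "a \<le> v (snd z) / 1" using assms by simp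
  also have "\<dots> \<le> kern v z" unfolding kern_def using 0 Z by (intro divide_left_mono) auto
  finally show "a \<le> kern v z" .
  show "kern v z \<le> b / \<kappa>" unfolding kern_def using 0 Z kappa_pos assms by (intro frac_le) (auto intro: order_trans[OF 0])
qed

abbreviation cut where "cut T q \<equiv> (\<lambda>z. indicator T (fst z) * q z)"

lemma admissible_cut:
  assumes q: "admissible q" and [measurable]: "T \<in> sets borel"
  shows "admissible (cut T q)"
proof -
  note [measurable] = admissibleD(1)[OF q]
  have "integrable K (\<lambda>z. phi (cut T q z))"
  proof (rule Bochner_Integration.integrable_bound)
    show "integrable K (\<lambda>z. phi (q z) + 1)" using admissibleD(3)[OF q] by simp
    show "AE z in K. norm (phi (cut T q z)) \<le> norm (phi (q z) + 1)"
    proof (rule AE_I2)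
      fix z show "norm (phi (cut T q z)) \<le> norm (phi (q z) + 1)"
        using phi_nonneg[of "q z"] by (cases "fst z \<in> T") (auto simp: phi_def[of 0])
    qed
  qed measurable
  then show ?thesis using admissibleD(2)[OF q] by (auto simp: admissible_def)
qed

lemma restr_dens:
  assumes q: "admissible q" and T[measurable]: "T \<in> sets borel"
  shows "restr (dens q) (T \<times> UNIV) = dens (cut T q)"
proof -
  note [measurable] = admissibleD(1)[OF q]
  have [measurable]: "T \<times> UNIV \<in> sets (borel \<Otimes>\<^sub>M borel :: ('a \<times> 'b) measure)" by simp
  show ?thesis unfolding restr_def dens_def
    by (subst density_density_eq)
       (auto intro!: density_cong AE_I2 simp: admissibleD(2)[OF q] indicator_def)
qed

lemma integral_marginals:
  assumes q: "admissible q" and [measurable]: "a \<in> borel_measurable borel" "b \<in> borel_measurable borel"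
  shows "(\<integral>z. q z * a (fst z) \<partial>K) = (\<integral>x. a x \<partial>marginal_X (dens q))"
    "(\<integral>z. q z * b (snd z) \<partial>K) = (\<integral>y. b y \<partial>marginal_Y (dens q))"
proof -
  note [measurable] = admissibleD(1)[OF q]
  show "(\<integral>z. q z * a (fst z) \<partial>K) = (\<integral>x. a x \<partial>marginal_X (dens q))"
    unfolding marginal_X_def
    by (subst integral_distr, measurable) (auto simp: integral_dens admissibleD(2)[OF q])
  show "(\<integral>z. q z * b (snd z) \<partial>K) = (\<integral>y. b y \<partial>marginal_Y (dens q))"
    unfolding marginal_Y_def
    by (subst integral_distr, measurable) (auto simp: integral_dens admissibleD(2)[OF q])
qed

text \<open>For positive \<open>kern v\<close> this is the relative entropy of \<open>dens q\<close>
  with respect to \<open>dens (kern v)\<close>.\<close>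

definition bregman where "bregman q v = (\<integral>z. breg (q z) (kern v z) \<partial>K)"

lemma integrable_admissible_mult:
  assumes q: "admissible q" and f: "f \<in> borel_measurable (borel \<Otimes>\<^sub>M borel)" "\<And>z. \<bar>f z\<bar> \<le> B"
  shows "integrable K (\<lambda>z. q z * f z)"
proof (rule Bochner_Integration.integrable_bound)
  note [measurable] = f(1) admissibleD(1)[OF q]
  show "integrable K (\<lambda>z. q z * B)" using admissibleD(4)[OF q] by simp
  have "0 \<le> B" using f(2)[of undefined] by linarith
  then show "AE z in K. norm (q z * f z) \<le> norm (q z * B)"
    using f(2) admissibleD(2)[OF q] by (auto simp: abs_mult intro!: mult_left_mono)
  show "(\<lambda>z. q z * f z) \<in> borel_measurable K" by measurable
qed

lemma bounded_profile_logs: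
  assumes v: "bounded_profile v"
  obtains B where "\<And>y. \<bar>ln (v y)\<bar> \<le> B" "\<And>x. \<bar>ln (normalizer v x)\<bar> \<le> B"
    "\<And>z. ln (kern v z) = ln (v (snd z)) - ln (normalizer v (fst z))" "\<And>z. 0 < kern v z" "\<And>z. kern v z \<le> B"
proof -
  obtain a b where ab: "0 < a" "\<And>y. a \<le> v y" "\<And>y. v y \<le> b" and p: "is_profile v"
    using v by (auto simp: bounded_profile_def)
  have v0: "0 < v y" for y using ab(1) ab(2)[of y] by simp
  define B where "B = \<bar>ln a\<bar> + \<bar>ln b\<bar> + \<bar>ln \<kappa>\<bar> + b / \<kappa>"
  have b: "0 < b" using ab(1) ab(2,3)[of undefined] by simp
  then have bk: "0 \<le> b / \<kappa>" using kappa_pos by simp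
  show ?thesis
  proof (rule that[of B])
    fix y
    have "ln a \<le> ln (v y)" "ln (v y) \<le> ln b" using ab v0 b by auto
    then show "\<bar>ln (v y)\<bar> \<le> B" using bk by (simp add: B_def)
  next
    fix x
    have "ln \<kappa> \<le> ln (normalizer v x)" "ln (normalizer v x) \<le> 0" using normalizer_bounds[OF p, of x] kappa_pos by auto
    then show "\<bar>ln (normalizer v x)\<bar> \<le> B" using bk by (simp add: B_def)
  next
    fix z show "ln (kern v z) = ln (v (snd z)) - ln (normalizer v (fst z))" "0 < kern v z"
      using v0[of "snd z"] normalizer_bounds(3)[OF p, of "fst z"] by (simp_all add: kern_def ln_div)
  next
    fix z show "kern v z \<le> B" using kern_bounds(2)[OF p, of a b z] ab bk by (simp add: B_def)
  qed
qed

text \<open>In the expansion \<open>q\<close> occurs in \<open>Phi q\<close> and in two linear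
  terms, one weighted by a function of \<open>y\<close> and one by a function of \<open>x\<close>;
  the rest depends on \<open>v\<close> only.\<close>

lemma integrable_breg:
  assumes q: "admissible q" and v: "bounded_profile v"
  shows "integrable K (\<lambda>z. breg (q z) (kern v z))"
    and "bregman q v = Phi q - Phi (kern v) - (\<integral>z. q z * ln (v (snd z)) \<partial>K) + (\<integral>z. q z * ln (normalizer v (fst z)) \<partial>K)
      + (\<integral>z. ln (kern v z) * kern v z \<partial>K)"
proof -
  obtain B where B: "\<And>y. \<bar>ln (v y)\<bar> \<le> B" "\<And>x. \<bar>ln (normalizer v x)\<bar> \<le> B"
    "\<And>z. ln (kern v z) = ln (v (snd z)) - ln (normalizer v (fst z))" "\<And>z. 0 < kern v z" "\<And>z. kern v z \<le> B"
    using bounded_profile_logs[OF v] by metis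
  have [measurable]: "v \<in> borel_measurable borel" using v by (auto simp: bounded_profile_def profileD(1))
  have ka: "admissible (kern v)" by (rule admissible_bounded[of _ B]) (auto intro: B less_imp_le)
  have i: "integrable K (\<lambda>z. q z * ln (v (snd z)))" "integrable K (\<lambda>z. q z * ln (normalizer v (fst z)))"
    by (intro integrable_admissible_mult[OF q, of _ B]; simp add: B)+
  have "\<bar>ln (kern v z)\<bar> \<le> 2 * B" for z using B(1)[of "snd z"] B(2)[of "fst z"] B(3)[of z] by linarith
  then have i2: "integrable K (\<lambda>z. ln (kern v z) * kern v z)"
    using integrable_admissible_mult[OF ka, of "\<lambda>z. ln (kern v z)" "2 * B"] by (simp add: mult.commute)
  have eq: "breg (q z) (kern v z) = phi (q z) - phi (kern v z) - q z * ln (v (snd z)) + q z * ln (normalizer v (fst z))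
      + ln (kern v z) * kern v z" for z
  proof -
    have "breg (q z) (kern v z) = phi (q z) - phi (kern v z) - q z * ln (kern v z) + ln (kern v z) * kern v z"
      using B(4)[of z] admissibleD(2)[OF q, of z] by (simp add: breg_eq algebra_simps)
    then show ?thesis by (simp add: B(3) right_diff_distrib)
  qed
  note ints = i i2 admissibleD(3)[OF q] admissibleD(3)[OF ka]
  show "integrable K (\<lambda>z. breg (q z) (kern v z))" unfolding eq using ints by auto
  show "bregman q v = Phi q - Phi (kern v) - (\<integral>z. q z * ln (v (snd z)) \<partial>K) + (\<integral>z. q z * ln (normalizer v (fst z)) \<partial>K)
      + (\<integral>z. ln (kern v z) * kern v z \<partial>K)"
    unfolding bregman_def Phi_def eq using ints by simp
qed

text \<open>\<open>ln (kern v)\<close> is a sum of a function of \<open>x\<close> and a function of \<open>y\<close>, so its integral only depends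
  on the marginals.\<close>

lemma bregman_diff:
  assumes q: "admissible q" "admissible q'" and v: "bounded_profile v"
    and m: "marginal_X (dens q) = marginal_X (dens q')" "marginal_Y (dens q) = marginal_Y (dens q')"
  shows "bregman q v - bregman q' v = Phi q - Phi q'"
proof -
  have [measurable]: "v \<in> borel_measurable borel" using v by (auto simp: bounded_profile_def profileD(1))
  show ?thesis
    unfolding integrable_breg(2)[OF q(1) v] integrable_breg(2)[OF q(2) v]
    using integral_marginals[OF q(1), of "\<lambda>x. ln (normalizer v x)" "\<lambda>y. ln (v y)"]
      integral_marginals[OF q(2), of "\<lambda>x. ln (normalizer v x)" "\<lambda>y. ln (v y)"]
    by (simp add: m)
qed

text \<open>\<open>F x\<close> is, by homogeneity of \<open>breg\<close>, the divergence at
  \<open>x\<close> of \<open>w\<close> from the multiple \<open>la x * v\<close>, divided by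
  \<open>normalizer w x\<close>. The scale \<open>la x\<close> is optimal at \<open>x\<close>, so
  replacing it by \<open>la x'\<close> can only increase the divergence. Then \<open>k(x, -)\<close>
  is exchanged for \<open>k(x', -)\<close> at the cost of one \<open>\<kappa>\<close>; the
  normalizers of \<open>w\<close>, between \<open>\<kappa>\<close> and 1, cost the second.\<close>

lemma section_comparison:
  assumes w: "is_profile w" "\<And>y. w y \<le> c" and v: "bounded_profile v"
  defines "F \<equiv> (\<lambda>x. \<integral>y. k (x, y) * breg (kern w (x, y)) (kern v (x, y)) \<partial>\<nu>)"
  shows "\<kappa>\<^sup>2 * F x \<le> F x'" and "0 \<le> F x"
proof -
  obtain a b where ab: "0 < a" "\<And>y. a \<le> v y" "\<And>y. v y \<le> b" and p: "is_profile v"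
    using v by (auto simp: bounded_profile_def)
  obtain B where B: "\<And>y. \<bar>ln (v y)\<bar> \<le> B" using bounded_profile_logs[OF v] by metis
  have v0: "0 < v y" for y using ab(1) ab(2)[of y] by simp
  have w0: "0 \<le> w y" for y by (rule profileD(2)[OF w(1)])
  have [measurable]: "v \<in> borel_measurable borel" "w \<in> borel_measurable borel"
    using profileD(1) p w by auto
  note Zv = normalizer_bounds[OF p] and Zw = normalizer_bounds[OF w(1)]
  define J where "J l x = (\<integral>y. k (x, y) * breg (w y) (l * v y) \<partial>\<nu>)" for l x
  define R where "R x = (\<integral>y. k (x, y) * (w y * (ln (w y) - ln (v y))) \<partial>\<nu>)" for x
  have "0 \<le> phi (w y)" "phi (w y) \<le> 1 + c * c" for y
    using phi_nonneg phi_bounded_on[OF w0 w(2)] by auto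
  have iR: "integrable \<nu> (\<lambda>y. w y * (ln (w y) - ln (v y)))"
  proof (rule M2.integrable_const_bound[of _ "1 + c * c + c + 1 + c * B"])
    have "\<bar>w y * (ln (w y) - ln (v y))\<bar> \<le> 1 + c * c + c + 1 + c * B" for y
    proof -
      have "w y * (ln (w y) - ln (v y)) = phi (w y) + w y - 1 - w y * ln (v y)"
        by (simp add: phi_eq[OF w0] algebra_simps)
      moreover have "\<bar>w y * ln (v y)\<bar> \<le> c * B"
        unfolding abs_mult using w0[of y] w(2)[of y] B[of y] by (intro mult_mono) auto
      ultimately show ?thesis using \<open>0 \<le> phi (w y)\<close> \<open>phi (w y) \<le> 1 + c * c\<close> w0[of y] w(2)[of y] by linarith
    qed
    then show "AE y in \<nu>. norm (w y * (ln (w y) - ln (v y))) \<le> 1 + c * c + c + 1 + c * B" by simp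
  qed measurable
  note iv = profileD(3)[OF p] and iw = profileD(3)[OF w(1)]
  have Jint: "integrable \<nu> (\<lambda>y. k (x, y) * breg (w y) (l * v y))"
    and Jeq: "J l x = R x - ln l * normalizer w x - normalizer w x + l * normalizer v x" if l: "0 < l" for l x
  proof -
    have eq: "k (x, y) * breg (w y) (l * v y) = k (x, y) * (w y * (ln (w y) - ln (v y))) - ln l * (k (x, y) * w y)
        - k (x, y) * w y + l * (k (x, y) * v y)" for y
      using l v0[of y] by (simp add: breg_def ln_mult algebra_simps)
    note ints = integrable_section[OF iR, of x] integrable_section[OF iw, of x] integrable_section[OF iv, of x]
    show "integrable \<nu> (\<lambda>y. k (x, y) * breg (w y) (l * v y))" unfolding eq using ints by auto
    show "J l x = R x - ln l * normalizer w x - normalizer w x + l * normalizer v x"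
      unfolding J_def eq R_def normalizer_def using ints by simp
  qed
  \<comment> \<open>The derivative of \<open>J l x\<close> in \<open>l\<close> is
    \<open>normalizer v x - normalizer w x / l\<close>, which vanishes exactly here.\<close>
  define la where "la x = normalizer w x / normalizer v x" for x
  have la: "0 < la x" for x using Zv(3) Zw(3) by (simp add: la_def)
  have FJ: "F x = J (la x) x / normalizer w x" for x
  proof -
    have "breg (kern w (x, y)) (kern v (x, y)) = breg (w y) (la x * v y) / normalizer w x" for y
    proof -
      have "kern w (x, y) = (1 / normalizer w x) * w y" "kern v (x, y) = (1 / normalizer w x) * (la x * v y)"
        using Zw(3)[of x] Zv(3)[of x] by (auto simp: kern_def la_def)
      then show ?thesis
        using breg_scale[of "1 / normalizer w x" "w y" "la x * v y"] Zw(3)[of x] w0 la v0 by simp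
    qed
    then show ?thesis by (simp add: F_def J_def)
  qed
  have Jmin: "J (la x) x \<le> J l x" if "0 < l" for l x
  proof -
    \<comment> \<open>In this scaling the excess of \<open>J l x\<close> over
      \<open>J (la x) x\<close> is \<open>normalizer w x * (\<tau> - 1 - ln \<tau>)\<close>.\<close>
    define \<tau> where "\<tau> = l / la x"
    have t: "0 < \<tau>" "l = \<tau> * la x" using that la[of x] by (auto simp: \<tau>_def)
    have "ln l = ln \<tau> + ln (la x)" using t la[of x] by (simp add: ln_mult)
    moreover have "la x * normalizer v x = normalizer w x" using Zv(3)[of x] by (simp add: la_def)
    moreover have "0 \<le> normalizer w x * (\<tau> - 1 - ln \<tau>)"
      using ln_le_minus_one[OF t(1)] Zw(3)[of x] by simp
    moreover have "l * normalizer v x = \<tau> * normalizer w x"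
      using t \<open>la x * normalizer v x = normalizer w x\<close> by (simp add: mult.assoc)
    ultimately show ?thesis using Jeq[OF that, of x] Jeq[OF la, of x x] by (simp add: algebra_simps)
  qed
  have b0: "0 \<le> breg (w y) (l * v y)" if "0 < l" for l y
    using that v0 w0 by (intro breg_nonneg) auto
  have Jcmp: "\<kappa> * J l x \<le> J l x'" if "0 < l" for l x x'
  proof -
    have "(\<integral>y. \<kappa> * (k (x, y) * breg (w y) (l * v y)) \<partial>\<nu>) \<le> J l x'"
      unfolding J_def
    proof (intro integral_mono)
      fix y
      have "\<kappa> * k (x, y) \<le> k (x', y) * 1"
        by (intro mult_mono kappa_le k_le_1 k_nonneg)
      from mult_right_mono[OF this b0[OF that, of y]]
      show "\<kappa> * (k (x, y) * breg (w y) (l * v y)) \<le> k (x', y) * breg (w y) (l * v y)"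
        by (simp add: mult.assoc)
    qed (use Jint[OF that] in auto)
    then show ?thesis by (simp add: J_def)
  qed
  have J0: "0 \<le> J l x" if "0 < l" for l x
    unfolding J_def using b0[OF that] by (intro integral_nonneg_AE AE_I2 mult_nonneg_nonneg k_nonneg)
  show F0: "0 \<le> F x" using FJ[of x] J0[OF la[of x], of x] Zw(3)[of x] by simp
  have "\<kappa> * J (la x) x \<le> \<kappa> * J (la x') x" using Jmin[OF la] kappa_pos by simp
  also have "\<dots> \<le> J (la x') x'" by (rule Jcmp[OF la])
  finally have 1: "\<kappa> * (F x * normalizer w x) \<le> F x' * normalizer w x'"
    using FJ[of x] FJ[of x'] Zw(3)[of x] Zw(3)[of x'] by simp
  have "F x' * normalizer w x' \<le> F x' * 1"
    using FJ[of x'] J0[OF la[of x'], of x'] Zw[of x'] by (intro mult_left_mono) auto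
  moreover have "F x * \<kappa> \<le> F x * normalizer w x" by (intro mult_left_mono F0 Zw(1))
  then have "\<kappa> * (F x * \<kappa>) \<le> \<kappa> * (F x * normalizer w x)" by (rule mult_left_mono) (use kappa_pos in simp)
  ultimately show "\<kappa>\<^sup>2 * F x \<le> F x'" using 1 by (simp add: power2_eq_square algebra_simps)
qed

text \<open>The comparison of sections holds for every pair \<open>x\<close>, \<open>x'\<close>, so
  it can be integrated over \<open>x\<close> in \<open>S\<close> and \<open>x'\<close> in
  \<open>T\<close>; each side picks up the measure of the other cell.\<close>

lemma cell_comparison:
  assumes w: "is_profile w" "\<And>y. w y \<le> c" and v: "bounded_profile v"
    and [measurable]: "S \<in> sets borel" "T \<in> sets borel"
  shows "\<kappa>\<^sup>2 * measure \<mu> T * (\<integral>z. indicator S (fst z) * breg (kern w z) (kern v z) \<partial>K)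
     \<le> measure \<mu> S * (\<integral>z. indicator T (fst z) * breg (kern w z) (kern v z) \<partial>K)"
proof -
  define F where "F = (\<lambda>x. \<integral>y. k (x, y) * breg (kern w (x, y)) (kern v (x, y)) \<partial>\<nu>)"
  have p: "is_profile v" using v by (simp add: bounded_profile_def)
  have [measurable]: "v \<in> borel_measurable borel" "w \<in> borel_measurable borel"
    using profileD(1) p w by auto
  have ka: "admissible (kern w)"
    by (rule admissible_bounded[of _ "c / \<kappa>"]) (use kern_bounds[OF w(1), of 0 c] w profileD(2)[OF w(1)] in auto)
  have iK: "integrable K (\<lambda>z. breg (kern w z) (kern v z))" by (rule integrable_breg(1)[OF ka v])
  have I: "(\<integral>z. indicator U (fst z) * breg (kern w z) (kern v z) \<partial>K) = (\<integral>x. indicator U x * F x \<partial>\<mu>)"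
     "integrable \<mu> (\<lambda>x. indicator U x * F x)"
    if [measurable]: "U \<in> sets borel" for U
  proof -
    have "integrable K (\<lambda>z. indicator (U \<times> UNIV) z * breg (kern w z) (kern v z))"
      using integrable_real_mult_indicator[OF _ iK, of "U \<times> UNIV"] by (simp add: sets_K mult.commute)
    moreover have "indicator (U \<times> UNIV) z = (indicator U (fst z) :: real)" for z :: "'a \<times> 'b"
      by (cases z) (auto simp: indicator_def)
    ultimately have "integrable K (\<lambda>z. indicator U (fst z) * breg (kern w z) (kern v z))" by simp
    then have i: "integrable M (\<lambda>z. k z * (indicator U (fst z) * breg (kern w z) (kern v z)))"
      by (subst (asm) integrable_K_iff) measurable
    have e: "(\<integral>y. k (x, y) * (indicator U (fst (x, y)) * breg (kern w (x, y)) (kern v (x, y))) \<partial>\<nu>)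
        = indicator U x * F x" for x
      by (simp add: F_def mult.left_commute[of _ "indicator U x"])
    show "(\<integral>z. indicator U (fst z) * breg (kern w z) (kern v z) \<partial>K) = (\<integral>x. indicator U x * F x \<partial>\<mu>)"
      using integral_fst'[OF i] unfolding e by (simp add: integral_K)
    show "integrable \<mu> (\<lambda>x. indicator U x * F x)"
      using integrable_fst'[OF i] unfolding e .
  qed
  have ind: "integrable \<mu> (indicator U :: 'a \<Rightarrow> real)" if [measurable]: "U \<in> sets borel" for U
    by (rule M1.integrable_const_bound[of _ 1]) auto
  have le: "\<kappa>\<^sup>2 * (\<integral>x. indicator S x * F x \<partial>\<mu>) \<le> measure \<mu> S * F x'" for x'
  proof -
    have "(\<integral>x. \<kappa>\<^sup>2 * (indicator S x * F x) \<partial>\<mu>) \<le> (\<integral>x. indicator S x * F x' \<partial>\<mu>)"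
    proof (intro integral_mono)
      fix x show "\<kappa>\<^sup>2 * (indicator S x * F x) \<le> indicator S x * F x'"
        using section_comparison(1)[OF w v, of x x'] by (auto simp: F_def indicator_def)
    qed (use I(2) ind in auto)
    then show ?thesis by (simp add: sets_mu)
  qed
  have "(\<integral>x'. indicator T x' * (\<kappa>\<^sup>2 * (\<integral>x. indicator S x * F x \<partial>\<mu>)) \<partial>\<mu>)
     \<le> (\<integral>x'. measure \<mu> S * (indicator T x' * F x') \<partial>\<mu>)"
  proof (intro integral_mono)
    fix x' show "indicator T x' * (\<kappa>\<^sup>2 * (\<integral>x. indicator S x * F x \<partial>\<mu>)) \<le> measure \<mu> S * (indicator T x' * F x')"
      using le[of x'] by (auto simp: indicator_def)
  qed (use I(2) ind in auto)
  then have "measure \<mu> T * (\<kappa>\<^sup>2 * (\<integral>x. indicator S x * F x \<partial>\<mu>))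
     \<le> measure \<mu> S * (\<integral>x. indicator T x * F x \<partial>\<mu>)" by (simp add: sets_mu)
  then show ?thesis by (simp add: I mult_ac)
qed


subsection \<open>The contraction estimate\<close>

lemma Y_density_split:
  assumes [measurable]: "q \<in> borel_measurable (borel \<Otimes>\<^sub>M borel)" "S \<in> sets borel" "T \<in> sets borel"
    and "\<And>z. 0 \<le> q z" and "S \<inter> T = {}" "S \<union> T = UNIV"
  shows "Y_density q y = Y_density (cut S q) y + Y_density (cut T q) y"
proof -
  have "Y_density q y = (\<integral>\<^sup>+x. ennreal (k (x, y) * cut S q (x, y)) + ennreal (k (x, y) * cut T q (x, y)) \<partial>\<mu>)"
    unfolding Y_density_def using assms(5,6) by (intro nn_integral_cong) (auto simp: indicator_def)
  also have "\<dots> = Y_density (cut S q) y + Y_density (cut T q) y"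
    unfolding Y_density_def by (rule nn_integral_add) auto
  finally show ?thesis .
qed

text \<open>On the cell shared by both composite cells the profiles of two consecutive iterates can be
  compared; this bounds the profile \<open>v\<close> of the new iterate away from \<open>0\<close>.\<close>

lemma consecutive_profile_bounds:
  assumes p: "admissible p" and p': "admissible p'"
    and S[measurable]: "A \<in> sets borel" "B \<in> sets borel" "P \<in> sets borel"
    and cells: "A \<inter> B = {}" "A \<inter> P = {}" "B \<inter> P = {}" "A \<union> B \<union> P = UNIV"
    and B: "measure \<mu> B > 0"
    and mY: "marginal_Y (dens p') = \<nu>"
    and mAB: "marginal_Y (dens (cut (A \<union> B) p)) = marginal_Y (dens (cut (A \<union> B) p'))"
    and w: "is_profile w" "AE z in M. fst z \<in> B \<union> P \<longrightarrow> p' z = kern w z"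
    and v: "is_profile v" "AE z in M. fst z \<in> A \<union> B \<longrightarrow> p z = kern v z"
  obtains a b where "0 < a" "AE y in \<nu>. a \<le> v y \<and> v y \<le> b" "AE y in \<nu>. 0 \<le> w y \<and> w y \<le> b"
proof -
  note [measurable] = admissibleD(1)[OF p] admissibleD(1)[OF p']
  note p0 = admissibleD(2)[OF p] admissibleD(2)[OF p']
  define mA where "mA = measure \<mu> (A \<union> B)"
  define mB where "mB = measure \<mu> B"
  define mP where "mP = measure \<mu> P"
  have m: "0 < mB" "0 < mA" "0 \<le> mP"
  proof -
    show "0 < mB" "0 \<le> mP" using B by (auto simp: mB_def mP_def)
    have "mB \<le> mA" unfolding mA_def mB_def by (rule M1.finite_measure_mono) (auto simp: sets_mu)
    with \<open>0 < mB\<close> show "0 < mA" by simp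
  qed
  \<comment> \<open>\<open>c\<close> is what the unit second marginal leaves: it is chosen so that
    \<open>1 \<le> v y * c\<close>. The sum \<open>b\<close> is one upper bound valid for both
    \<open>v\<close> and \<open>w\<close>.\<close>
  define c where "c = mA / \<kappa> * (1 + mP / (\<kappa>\<^sup>2 * mB))"
  have c: "0 < c" using m kappa_pos unfolding c_def by (intro mult_pos_pos add_pos_nonneg divide_nonneg_pos divide_pos_pos) auto
  define b where "b = 1 / (\<kappa> * mA) + 1 / (\<kappa> * mB)"
  have one: "AE y in \<nu>. Y_density p' y = 1"
  proof -
    have "density \<nu> (Y_density p') = density \<nu> (\<lambda>_. 1)" using mY p0 by (simp add: marginal_Y_dens density_1)
    then show ?thesis by (subst (asm) M2.density_unique_iff) auto
  qed
  have ABeq: "AE y in \<nu>. Y_density (cut (A \<union> B) p) y = Y_density (cut (A \<union> B) p') y"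
  proof -
    have "density \<nu> (Y_density (cut (A \<union> B) p)) = density \<nu> (Y_density (cut (A \<union> B) p'))"
      using mAB p0 by (subst (asm) (1 2) marginal_Y_dens) auto
    then show ?thesis by (subst (asm) M2.density_unique_iff) auto
  qed
  have wB: "AE z in M. fst z \<in> B \<longrightarrow> p' z = kern w z" and wP: "AE z in M. fst z \<in> P \<longrightarrow> p' z = kern w z"
    using w(2) by (auto elim: eventually_mono)
  have split: "Y_density p' y = Y_density (cut (A \<union> B) p') y + Y_density (cut P p') y" for y
    by (rule Y_density_split) (use p0 cells in auto)
  have Ble: "Y_density (cut B p') y \<le> Y_density (cut (A \<union> B) p') y" for y
    unfolding Y_density_def using p0 k_nonneg by (intro nn_integral_mono ennreal_leI mult_left_mono) (auto simp: indicator_def)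
  have AE: "AE y in \<nu>. (1 / c \<le> v y \<and> v y \<le> b) \<and> (0 \<le> w y \<and> w y \<le> b)"
    using one ABeq Y_density_bounds[OF admissibleD(1)[OF p] sets.Un[OF S(1,2)] v] Y_density_bounds[OF admissibleD(1)[OF p'] S(2) w(1) wB]
      Y_density_bounds[OF admissibleD(1)[OF p'] S(3) w(1) wP]
  proof eventually_elim
    case (elim y)
    let ?xA = "Y_density (cut (A \<union> B) p') y" and ?xP = "Y_density (cut P p') y"
    note 1 = elim(1,2) and v' = elim(3) and wB' = elim(4) and wP' = elim(5)
    note v0 = profileD(2)[OF v(1), of y] and w0 = profileD(2)[OF w(1), of y]
    have nn: "0 \<le> v y * mA / \<kappa>" "0 \<le> w y * mP / \<kappa>" using v0 w0 m kappa_pos by auto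
    have xA1: "?xA \<le> 1" using 1(1) split[of y] by (metis le_iff_add)
    have "ennreal (\<kappa> * v y * mA) \<le> ?xA" using v' 1(2) by (simp add: mA_def)
    then have "ennreal (\<kappa> * v y * mA) \<le> ennreal 1" unfolding ennreal_1 using xA1 by (rule order_trans)
    then have r1: "\<kappa> * v y * mA \<le> 1" by (subst (asm) ennreal_le_iff) auto
    have Ble': "ennreal (\<kappa> * w y * mB) \<le> ?xA" using wB' Ble[of y] by (auto simp: mB_def intro: order_trans)
    then have "ennreal (\<kappa> * w y * mB) \<le> ennreal 1" unfolding ennreal_1 using xA1 by (rule order_trans)
    then have r2: "\<kappa> * w y * mB \<le> 1" by (subst (asm) ennreal_le_iff) auto
    \<comment> \<open>The second marginal of the old iterate over \<open>B\<close> is at most that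
      over \<open>A \<union> B\<close>, which equals that of the new iterate. This is how
      \<open>v\<close> comes to dominate \<open>w\<close>.\<close>
    have "ennreal (\<kappa> * w y * mB) \<le> ennreal (v y * mA / \<kappa>)" using Ble' v' 1 by (auto simp: mA_def intro: order_trans)
    then have r3: "\<kappa> * w y * mB \<le> v y * mA / \<kappa>" using nn by (subst (asm) ennreal_le_iff) auto
    have "ennreal 1 \<le> ennreal (v y * mA / \<kappa>) + ennreal (w y * mP / \<kappa>)"
    proof -
      have "ennreal 1 = ?xA + ?xP" using 1(1) split[of y] by simp
      also have "\<dots> \<le> ennreal (v y * mA / \<kappa>) + ennreal (w y * mP / \<kappa>)"
        using 1(2) v' wP' unfolding mA_def mP_def by (intro add_mono) auto
      finally show ?thesis .
    qed
    then have r4: "1 \<le> v y * mA / \<kappa> + w y * mP / \<kappa>"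
      using nn by (simp flip: ennreal_plus)
    \<comment> \<open>Eliminating \<open>w\<close> from \<open>r4\<close> by means of
      \<open>r3\<close> leaves an inequality for \<open>v\<close> alone.\<close>
    have "w y \<le> v y * mA / (\<kappa>\<^sup>2 * mB)"
      using r3 m kappa_pos by (simp add: field_simps power2_eq_square)
    then have "w y * mP / \<kappa> \<le> v y * mA / (\<kappa>\<^sup>2 * mB) * mP / \<kappa>"
      using m kappa_pos by (intro divide_right_mono mult_right_mono) auto
    then have "1 \<le> v y * c" using r4 unfolding c_def by (simp add: algebra_simps)
    then have "1 / c \<le> v y" using c by (simp add: field_simps)
    moreover have "v y \<le> 1 / (\<kappa> * mA)" "w y \<le> 1 / (\<kappa> * mB)"
      using r1 r2 m kappa_pos by (auto simp: field_simps)
    moreover have "0 \<le> 1 / (\<kappa> * mA)" "0 \<le> 1 / (\<kappa> * mB)" using m kappa_pos by auto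
    ultimately show ?case using w0 unfolding b_def by linarith
  qed
  show ?thesis by (rule that[of "1 / c" b]) (use c AE in \<open>auto elim: eventually_mono\<close>)
qed

lemma integrable_cut:
  fixes f :: "'a \<times> 'b \<Rightarrow> real"
  assumes "integrable K f" and [measurable]: "T \<in> sets borel"
  shows "integrable K (\<lambda>z. indicator T (fst z) * f z)"
proof -
  have "integrable K (\<lambda>z. indicator (T \<times> UNIV) z * f z)"
    using integrable_real_mult_indicator[OF _ assms(1), of "T \<times> UNIV"] by (simp add: sets_K mult.commute)
  moreover have "indicator (T \<times> UNIV) z = (indicator T (fst z) :: real)" for z :: "'a \<times> 'b"
    by (cases z) (auto simp: indicator_def)
  ultimately show ?thesis by simp
qed

text \<open>\<open>A \<union> B\<close> and \<open>P\<close> are the cells of the current step,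
  \<open>B \<union> P\<close> is the two-cell block of the step before, and \<open>q\<close> is any
  competitor for the global problem.\<close>

lemma entropy_contraction:
  assumes p: "admissible p" and p': "admissible p'" and q: "admissible q"
    and S[measurable]: "A \<in> sets borel" "B \<in> sets borel" "P \<in> sets borel"
    and cells: "A \<inter> B = {}" "A \<inter> P = {}" "B \<inter> P = {}" "A \<union> B \<union> P = UNIV"
    and B: "measure \<mu> B > 0"
    and mX: "marginal_X (dens p') = \<mu>" "marginal_X (dens p) = \<mu>" "marginal_X (dens q) = \<mu>"
    and mY: "marginal_Y (dens p') = \<nu>" "marginal_Y (dens p) = \<nu>" "marginal_Y (dens q) = \<nu>"
    and mAB: "marginal_Y (dens (cut (A \<union> B) p)) = marginal_Y (dens (cut (A \<union> B) p'))"
    and mP: "marginal_Y (dens (cut P p)) = marginal_Y (dens (cut P p'))"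
      "marginal_X (dens (cut P p)) = marginal_X (dens (cut P p'))"
    and opt: "Phi (cut P p) \<le> Phi (cut P p')"
    and w: "is_profile w" "AE z in M. fst z \<in> B \<union> P \<longrightarrow> p' z = kern w z"
    and v: "is_profile v" "AE z in M. fst z \<in> A \<union> B \<longrightarrow> p z = kern v z"
  shows "measure \<mu> P * (Phi p - Phi q) + \<kappa>\<^sup>2 * measure \<mu> B * (Phi p - Phi q) \<le> measure \<mu> P * (Phi p' - Phi q)"
proof -
  obtain a b where ab: "0 < a" "AE y in \<nu>. a \<le> v y \<and> v y \<le> b" "AE y in \<nu>. 0 \<le> w y \<and> w y \<le> b"
    using consecutive_profile_bounds[OF p p' S cells B mY(1) mAB w v] by metis
  obtain v' where v': "is_profile v'" "\<And>y. a \<le> v' y" "\<And>y. v' y \<le> b" "AE z in M. kern v' z = kern v z"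
    using clamp_profile[OF v(1) ab(2)] ab(1) by (metis less_imp_le)
  obtain w' where w': "is_profile w'" "\<And>y. w' y \<le> b" "AE z in M. kern w' z = kern w z"
    using clamp_profile[OF w(1) ab(3)] by (metis order_refl)
  have bv: "bounded_profile v'" using v' ab(1) by (auto simp: bounded_profile_def)
  have [measurable]: "v' \<in> borel_measurable borel" "w' \<in> borel_measurable borel"
    using v'(1) w'(1) profileD(1) by auto
  note [measurable] = admissibleD(1)[OF p] admissibleD(1)[OF p']
  have pAB: "AE z in K. fst z \<in> A \<union> B \<longrightarrow> p z = kern v' z"
    unfolding AE_K_iff using v(2) v'(4) by eventually_elim auto
  have pBP: "AE z in K. fst z \<in> B \<union> P \<longrightarrow> p' z = kern w' z"
    unfolding AE_K_iff using w(2) w'(3) by eventually_elim auto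
  have kpos: "0 < kern v' z" for z using bounded_profile_logs[OF bv] by metis
  note ip = integrable_breg(1)[OF p bv] and ip' = integrable_breg(1)[OF p' bv] and iq = integrable_breg(1)[OF q bv]
  have b0: "0 \<le> breg (p z) (kern v' z)" "0 \<le> breg (p' z) (kern v' z)" "0 \<le> breg (q z) (kern v' z)" for z
    by (intro breg_nonneg admissibleD(2)[OF p] admissibleD(2)[OF p'] admissibleD(2)[OF q] kpos)+
  define DP where "DP = (\<integral>z. indicator P (fst z) * breg (p' z) (kern v' z) \<partial>K)"
  define DB where "DB = (\<integral>z. indicator B (fst z) * breg (p' z) (kern v' z) \<partial>K)"
  \<comment> \<open>On \<open>A \<union> B\<close> the density \<open>p\<close> coincides with
    \<open>kern v'\<close>, so only \<open>P\<close> contributes.\<close>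
  have Dp: "bregman p v' = (\<integral>z. indicator P (fst z) * breg (p z) (kern v' z) \<partial>K)"
    unfolding bregman_def
  proof (rule integral_cong_AE)
    show "AE z in K. breg (p z) (kern v' z) = indicator P (fst z) * breg (p z) (kern v' z)"
      using pAB
    proof eventually_elim
      case (elim z)
      then show ?case using cells(4) by (cases "fst z \<in> P") (auto simp: breg_def)
    qed
  qed measurable
  \<comment> \<open>Outside \<open>P\<close> the cut density is 0 and \<open>breg 0 t = t\<close>, a
    contribution that does not depend on \<open>r\<close>. Hence optimality on \<open>P\<close>
    becomes an inequality between divergences over \<open>P\<close>.\<close>
  have rsP: "bregman (cut P r) v' = (\<integral>z. indicator P (fst z) * breg (r z) (kern v' z) \<partial>K)
      + (\<integral>z. indicator (- P) (fst z) * kern v' z \<partial>K)" if r: "admissible r" for r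
  proof -
    note [measurable] = admissibleD(1)[OF r]
    have "integrable K (kern v')"
      by (rule admissibleD(4)[OF admissible_bounded[of _ "b / \<kappa>"]])
        (use kern_bounds[OF v'(1), of a b] v' ab(1) kpos in \<open>auto intro: less_imp_le\<close>)
    then have i: "integrable K (\<lambda>z. indicator P (fst z) * breg (r z) (kern v' z))"
       "integrable K (\<lambda>z. indicator (- P) (fst z) * kern v' z)"
      by (auto intro!: integrable_cut integrable_breg(1)[OF r bv])
    have "bregman (cut P r) v' = (\<integral>z. indicator P (fst z) * breg (r z) (kern v' z) + indicator (- P) (fst z) * kern v' z \<partial>K)"
      unfolding bregman_def by (intro Bochner_Integration.integral_cong) (auto simp: indicator_def breg_def)
    then show ?thesis using i by simp
  qed
  have "bregman (cut P p) v' - bregman (cut P p') v' \<le> 0"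
    using bregman_diff[OF admissible_cut[OF p S(3)] admissible_cut[OF p' S(3)] bv mP(2,1)] opt by simp
  then have DpDP: "bregman p v' \<le> DP" unfolding rsP[OF p] rsP[OF p'] Dp DP_def by simp
  have Dq: "0 \<le> bregman q v'" unfolding bregman_def using b0 by simp
  \<comment> \<open>The contribution of \<open>A\<close> is non-negative and is dropped.\<close>
  have Dp': "DB + DP \<le> bregman p' v'"
  proof -
    have i: "integrable K (\<lambda>z. indicator U (fst z) * breg (p' z) (kern v' z))" if "U \<in> sets borel" for U
      using integrable_cut[OF ip' that] .
    have "DB + DP = (\<integral>z. indicator B (fst z) * breg (p' z) (kern v' z) + indicator P (fst z) * breg (p' z) (kern v' z) \<partial>K)"
      unfolding DB_def DP_def using i by simp
    also have "\<dots> \<le> bregman p' v'" unfolding bregman_def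
    proof (rule integral_mono)
      fix z show "indicator B (fst z) * breg (p' z) (kern v' z) + indicator P (fst z) * breg (p' z) (kern v' z)
         \<le> breg (p' z) (kern v' z)"
        using b0 cells(3) by (auto simp: indicator_def)
    qed (use i ip' in auto)
    finally show ?thesis .
  qed
  \<comment> \<open>On \<open>B \<union> P\<close> the old iterate is given by the single profile
    \<open>w'\<close>, which is what makes its divergences over \<open>B\<close> and
    \<open>P\<close> comparable.\<close>
  have cmp: "\<kappa>\<^sup>2 * measure \<mu> B * DP \<le> measure \<mu> P * DB"
  proof -
    have e: "(\<integral>z. indicator U (fst z) * breg (p' z) (kern v' z) \<partial>K)
        = (\<integral>z. indicator U (fst z) * breg (kern w' z) (kern v' z) \<partial>K)"
      if [measurable]: "U \<in> sets borel" and U: "U \<subseteq> B \<union> P" for U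
    proof (rule integral_cong_AE)
      show "AE z in K. indicator U (fst z) * breg (p' z) (kern v' z) = indicator U (fst z) * breg (kern w' z) (kern v' z)"
        using pBP
      proof eventually_elim
        case (elim z) then show ?case using U by (cases "fst z \<in> U") auto
      qed
    qed measurable
    have "DP = (\<integral>z. indicator P (fst z) * breg (kern w' z) (kern v' z) \<partial>K)"
      "DB = (\<integral>z. indicator B (fst z) * breg (kern w' z) (kern v' z) \<partial>K)"
      unfolding DP_def DB_def using e[of P] e[of B] by auto
    then show ?thesis using cell_comparison[OF w'(1,2) bv S(3,2)] by simp
  qed
  have d1: "bregman p v' - bregman q v' = Phi p - Phi q" by (rule bregman_diff[OF p q bv]) (simp_all add: mX mY)
  have d2: "bregman p' v' - bregman p v' = Phi p' - Phi p" by (rule bregman_diff[OF p' p bv]) (simp_all add: mX mY)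
  have "Phi p - Phi q \<le> DP" using d1 Dq DpDP by linarith
  then have 1: "\<kappa>\<^sup>2 * measure \<mu> B * (Phi p - Phi q) \<le> \<kappa>\<^sup>2 * measure \<mu> B * DP"
    by (intro mult_left_mono) auto
  have "DB \<le> Phi p' - Phi p" using d2 Dp' DpDP by linarith
  then have "measure \<mu> P * DB \<le> measure \<mu> P * (Phi p' - Phi p)" by (intro mult_left_mono) auto
  then show ?thesis using 1 cmp by (simp add: algebra_simps)
qed

end

section \<open>Finite sums, restrictions and marginals of measures\<close>

text \<open>A measure built by \<open>measure_of\<close> has the intended values only once the set
  function is known to be countably additive; here this is an exchange of a finite sum with a series
  of non-negative terms.\<close>

lemma emeasure_sum_measure:
  fixes M :: "'z measure"
  assumes "finite I" "\<And>i. i \<in> I \<Longrightarrow> sets (N i) = sets M" "A \<in> sets M"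
  shows "emeasure (sum_measure M I N) A = (\<Sum>i\<in>I. emeasure (N i) A)"
  unfolding sum_measure_def
proof (rule emeasure_measure_of_sigma)
  show "sigma_algebra (space M) (sets M)" by (rule sets.sigma_algebra_axioms)
  show "positive (sets M) (\<lambda>A. \<Sum>i\<in>I. emeasure (N i) A)" by (simp add: positive_def)
  show "countably_additive (sets M) (\<lambda>A. \<Sum>i\<in>I. emeasure (N i) A)"
  proof (rule countably_additiveI)
    fix A :: "nat \<Rightarrow> 'z set" assume A: "range A \<subseteq> sets M" "disjoint_family A"
    have "(\<Sum>n. \<Sum>i\<in>I. emeasure (N i) (A n)) = (\<Sum>i\<in>I. \<Sum>n. emeasure (N i) (A n))"
      by (rule suminf_sum) (rule summableI)
    also have "\<dots> = (\<Sum>i\<in>I. emeasure (N i) (\<Union>n. A n))"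
      using A assms(2) by (intro sum.cong refl suminf_emeasure) auto
    finally show "(\<Sum>n. \<Sum>i\<in>I. emeasure (N i) (A n)) = (\<Sum>i\<in>I. emeasure (N i) (\<Union>n. A n))" .
  qed
qed fact

lemma sets_sum_measure: "sets (sum_measure M I N) = sets M"
  by (simp add: sum_measure_def)

lemma emeasure_marginals:
  fixes \<rho> :: "('a::topological_space \<times> 'b::topological_space) measure"
  assumes s: "sets \<rho> = sets (borel \<Otimes>\<^sub>M borel)"
  shows "A \<in> sets borel \<Longrightarrow> emeasure (marginal_X \<rho>) A = emeasure \<rho> (A \<times> UNIV)"
    and "B \<in> sets borel \<Longrightarrow> emeasure (marginal_Y \<rho>) B = emeasure \<rho> (UNIV \<times> B)"
proof -
  note [measurable_cong] = s
  have sp: "space \<rho> = UNIV" using sets_eq_imp_space_eq[OF s] by (simp add: space_pair_measure)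
  have "fst -` A = A \<times> (UNIV :: 'b set)" "snd -` B = (UNIV :: 'a set) \<times> B" by auto
  then show "A \<in> sets borel \<Longrightarrow> emeasure (marginal_X \<rho>) A = emeasure \<rho> (A \<times> UNIV)"
    and "B \<in> sets borel \<Longrightarrow> emeasure (marginal_Y \<rho>) B = emeasure \<rho> (UNIV \<times> B)"
    by (simp_all add: marginal_X_def marginal_Y_def emeasure_distr sp)
qed

lemma emeasure_restr: "S \<in> sets N \<Longrightarrow> A \<in> sets N \<Longrightarrow> emeasure (restr N S) A = emeasure N (S \<inter> A)"
  unfolding restr_def by (rule emeasure_restricted)

lemma sets_restr [simp]: "sets (restr N S) = sets N" by (simp add: restr_def)

lemma sets_marginals [simp]: "sets (marginal_X \<rho>) = sets borel" "sets (marginal_Y \<rho>) = sets borel"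
  by (simp_all add: marginal_X_def marginal_Y_def)

lemma marginal_X_restr:
  fixes \<rho> :: "('a::topological_space \<times> 'b::topological_space) measure"
  assumes s: "sets \<rho> = sets (borel \<Otimes>\<^sub>M borel)" and [measurable]: "S \<in> sets borel"
  shows "marginal_X (restr \<rho> (S \<times> UNIV)) = restr (marginal_X \<rho>) S"
proof (rule measure_eqI)
  fix A assume "A \<in> sets (marginal_X (restr \<rho> (S \<times> UNIV)))"
  then have A[measurable]: "A \<in> sets borel" by (simp add: marginal_X_def)
  have "S \<times> UNIV \<inter> A \<times> UNIV = (S \<inter> A) \<times> (UNIV :: 'b set)" by auto
  then show "emeasure (marginal_X (restr \<rho> (S \<times> UNIV))) A = emeasure (restr (marginal_X \<rho>) S) A"
    by (simp add: emeasure_marginals s emeasure_restr)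
qed (simp add: marginal_X_def)

context bounded_kernel
begin

subsection \<open>The domain decomposition iteration\<close>

text \<open>Collects what the contraction uses of one step with composite cells \<open>S\<close> and
  \<open>T\<close>: the profile on \<open>S\<close>, the union of two basic cells, and optimality on
  the single cell \<open>T\<close>. \<open>\<rho>\<close> is the preceding iterate.\<close>

definition dd_step where
  "dd_step S T \<rho> p \<longleftrightarrow> admissible p \<and> dens p \<in> couplings \<mu> \<nu> \<and>
     (\<exists>v. is_profile v \<and> (AE z in M. fst z \<in> S \<longrightarrow> p z = kern v z)) \<and>
     marginal_X (dens (cut T p)) = restr \<mu> T \<and>
     marginal_Y (dens (cut S p)) = marginal_Y (restr \<rho> (S \<times> UNIV)) \<and>
     marginal_Y (dens (cut T p)) = marginal_Y (restr \<rho> (T \<times> UNIV)) \<and>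
     (\<forall>q. admissible q \<longrightarrow> marginal_X (dens q) = restr \<mu> T \<longrightarrow>
        marginal_Y (dens q) = marginal_Y (restr \<rho> (T \<times> UNIV)) \<longrightarrow> Phi (cut T p) \<le> Phi q)"

lemma dens_cong:
  assumes [measurable]: "p \<in> borel_measurable (borel \<Otimes>\<^sub>M borel)" "q \<in> borel_measurable (borel \<Otimes>\<^sub>M borel)"
    and "AE z in M. p z = q z"
  shows "dens p = dens q" "Phi p = Phi q"
proof -
  have ae: "AE z in K. p z = q z" using assms(3) by (simp add: AE_K_iff)
  show "dens p = dens q" unfolding dens_def by (rule density_cong) (use ae in \<open>auto elim: eventually_mono\<close>)
  show "Phi p = Phi q" unfolding Phi_def by (rule integral_cong_AE) (use ae in \<open>auto elim: eventually_mono\<close>)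
qed

text \<open>As \<open>\<rho>\<close> couples \<open>\<mu>\<close> and \<open>\<nu>\<close>, the
  second marginal of its restriction is at most \<open>\<nu>\<close> and has total mass
  \<open>emeasure \<mu> S\<close>, so the product competitor of the cell exists.\<close>

lemma cell_minimizer:
  assumes \<rho>: "\<rho> \<in> couplings \<mu> \<nu>" and eps: "\<epsilon> > 0"
    and S[measurable]: "S \<in> sets borel" and pos: "measure \<mu> S > 0"
    and min: "entropic_minimizer \<epsilon> K (restr \<mu> S) (marginal_Y (restr \<rho> (S \<times> UNIV))) \<sigma>"
  obtains p v where "optimal p" "\<sigma> = dens p" "marginal_X (dens p) = restr \<mu> S"
    "marginal_Y (dens p) = marginal_Y (restr \<rho> (S \<times> UNIV))"
    "is_profile v" "AE z in M. p z = indicator S (fst z) * kern v z"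
proof -
  have s: "sets \<rho> = sets (borel \<Otimes>\<^sub>M borel)" and mX: "marginal_X \<rho> = \<mu>" and mY: "marginal_Y \<rho> = \<nu>"
    using \<rho> by (auto simp: couplings_def)
  have e: "emeasure (marginal_Y (restr \<rho> (S \<times> UNIV))) B = emeasure \<rho> (S \<times> B)" if "B \<in> sets borel" for B
  proof -
    have "S \<times> UNIV \<inter> UNIV \<times> B = (S \<times> B :: ('a \<times> 'b) set)" by auto
    then show ?thesis using that by (simp add: emeasure_marginals s emeasure_restr)
  qed
  obtain p where p: "optimal p" "\<sigma> = dens p" "marginal_X (dens p) = restr \<mu> S"
    "marginal_Y (dens p) = marginal_Y (restr \<rho> (S \<times> UNIV))"
  proof (rule entropic_minimizer_optimal[OF min eps S pos])
    show "sets (marginal_Y (restr \<rho> (S \<times> UNIV))) = sets borel" by (simp add: marginal_Y_def)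
    show "emeasure (marginal_Y (restr \<rho> (S \<times> UNIV))) B \<le> emeasure \<nu> B" if B: "B \<in> sets borel" for B
    proof -
      have "emeasure \<rho> (S \<times> B) \<le> emeasure \<rho> (UNIV \<times> B)" by (rule emeasure_mono) (use B s in auto)
      also have "\<dots> = emeasure \<nu> B" using emeasure_marginals(2)[OF s B] mY by simp
      finally show ?thesis by (simp add: e B)
    qed
    show "emeasure (marginal_Y (restr \<rho> (S \<times> UNIV))) UNIV = emeasure \<mu> S"
      using emeasure_marginals(1)[OF s S] mX by (simp add: e)
  qed
  obtain v where "is_profile v" "AE z in M. p z = indicator S (fst z) * kern v z"
    by (rule optimal_factor[OF p(1,3) S pos])
  then show ?thesis by (rule that[OF p])
qed

lemma dd_stepI:
  assumes \<rho>: "\<rho> \<in> couplings \<mu> \<nu>" and eps: "\<epsilon> > 0"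
    and S[measurable]: "S \<in> sets borel" "T \<in> sets borel" and cells: "S \<inter> T = {}" "S \<union> T = UNIV"
    and pos: "measure \<mu> S > 0" "measure \<mu> T > 0"
    and min: "entropic_minimizer \<epsilon> K (restr \<mu> S) (marginal_Y (restr \<rho> (S \<times> UNIV))) \<sigma>1"
       "entropic_minimizer \<epsilon> K (restr \<mu> T) (marginal_Y (restr \<rho> (T \<times> UNIV))) \<sigma>2"
    and \<sigma>: "sets \<sigma> = sets (borel \<Otimes>\<^sub>M borel)"
      "\<And>A. A \<in> sets (borel \<Otimes>\<^sub>M borel) \<Longrightarrow> emeasure \<sigma> A = emeasure \<sigma>1 A + emeasure \<sigma>2 A"
  obtains p where "\<sigma> = dens p" "dd_step S T \<rho> p"
proof -
  obtain p1 v where p1: "optimal p1" "\<sigma>1 = dens p1" "marginal_X (dens p1) = restr \<mu> S"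
    "marginal_Y (dens p1) = marginal_Y (restr \<rho> (S \<times> UNIV))"
    "is_profile v" "AE z in M. p1 z = indicator S (fst z) * kern v z"
    by (rule cell_minimizer[OF \<rho> eps S(1) pos(1) min(1)])
  obtain p2 w where p2: "optimal p2" "\<sigma>2 = dens p2" "marginal_X (dens p2) = restr \<mu> T"
    "marginal_Y (dens p2) = marginal_Y (restr \<rho> (T \<times> UNIV))"
    "is_profile w" "AE z in M. p2 z = indicator T (fst z) * kern w z"
    by (rule cell_minimizer[OF \<rho> eps S(2) pos(2) min(2)])
  have adm: "admissible p1" "admissible p2" using p1 p2 by (auto simp: optimal_def)
  note [measurable] = admissibleD(1)[OF adm(1)] admissibleD(1)[OF adm(2)]
  define p where "p z = cut S p1 z + cut T p2 z" for z
  have [measurable]: "p \<in> borel_measurable (borel \<Otimes>\<^sub>M borel)" unfolding p_def by measurable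
  have ap: "admissible p"
  proof -
    \<comment> \<open>Exactly one of the two cut densities vanishes by being cut, and
      \<open>phi 0 = 1\<close> is subtracted for it.\<close>
    have "phi (p z) = phi (cut S p1 z) + phi (cut T p2 z) - 1" for z
      using cells by (auto simp: p_def indicator_def phi_def[of 0])
    then have "integrable K (\<lambda>z. phi (p z))"
      using admissibleD(3)[OF admissible_cut[OF adm(1) S(1)]] admissibleD(3)[OF admissible_cut[OF adm(2) S(2)]] by simp
    moreover have "0 \<le> p z" for z
      using admissibleD(2)[OF adm(1), of z] admissibleD(2)[OF adm(2), of z] by (simp add: p_def)
    ultimately show ?thesis by (simp add: admissible_def)
  qed
  have r: "cut S p = cut S p1" "cut T p = cut T p2" using cells by (auto simp: p_def fun_eq_iff indicator_def)
  \<comment> \<open>By their factorized form the cell minimizers already vanish almost everywhere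
    outside their cells, so cutting does not change the measures.\<close>
  have a: "AE z in M. cut S p1 z = p1 z" "AE z in M. cut T p2 z = p2 z"
    using p1(6) p2(6) by (eventually_elim, simp add: indicator_def)+
  have d: "dens (cut S p) = dens p1" "dens (cut T p) = dens p2" "Phi (cut T p) = Phi p2"
    unfolding r using dens_cong[OF _ _ a(1)] dens_cong[OF _ _ a(2)] by auto
  have "\<sigma> = dens p"
  proof (rule measure_eqI)
    fix A assume A: "A \<in> sets \<sigma>"
    then have [measurable]: "A \<in> sets (borel \<Otimes>\<^sub>M borel)" using \<sigma> by simp
    have pz: "ennreal (p z) = ennreal (p1 z) + ennreal (p2 z)" if "cut S p1 z = p1 z" "cut T p2 z = p2 z" for z
      using that admissibleD(2)[OF adm(1), of z] admissibleD(2)[OF adm(2), of z] by (simp only: p_def ennreal_plus)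
    have "emeasure (dens p) A = (\<integral>\<^sup>+z. ennreal (p z) * indicator A z \<partial>K)"
      unfolding dens_def by (rule emeasure_density) measurable
    also have "\<dots> = (\<integral>\<^sup>+z. ennreal (p1 z) * indicator A z + ennreal (p2 z) * indicator A z \<partial>K)"
    proof (rule nn_integral_cong_AE)
      show "AE z in K. ennreal (p z) * indicator A z = ennreal (p1 z) * indicator A z + ennreal (p2 z) * indicator A z"
        unfolding AE_K_iff using a by eventually_elim (simp add: pz distrib_right)
    qed
    also have "\<dots> = emeasure (dens p1) A + emeasure (dens p2) A"
      unfolding dens_def by (subst nn_integral_add) (auto simp: emeasure_density sets_K)
    finally show "emeasure \<sigma> A = emeasure (dens p) A" using A \<sigma> p1(2) p2(2) by simp
  qed (simp add: \<sigma> sets_dens)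
  moreover have "dd_step S T \<rho> p"
    unfolding dd_step_def
  proof (intro conjI allI impI)
    show "admissible p" by (rule ap)
    have s: "sets \<rho> = sets (borel \<Otimes>\<^sub>M borel)" and mX: "marginal_X \<rho> = \<mu>" and mY: "marginal_Y \<rho> = \<nu>"
      using \<rho> by (auto simp: couplings_def)
    have s12: "sets \<sigma>1 = sets (borel \<Otimes>\<^sub>M borel)" "sets \<sigma>2 = sets (borel \<Otimes>\<^sub>M borel)"
      using p1 p2 by (auto simp: sets_dens)
    have "marginal_X \<sigma> = \<mu>"
    proof (rule measure_eqI)
      fix A assume "A \<in> sets (marginal_X \<sigma>)"
      then have [measurable]: "A \<in> sets borel" by (simp add: marginal_X_def)
      have "emeasure (marginal_X \<sigma>) A = emeasure (marginal_X \<sigma>1) A + emeasure (marginal_X \<sigma>2) A"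
        by (simp add: emeasure_marginals \<sigma> s12)
      also have "\<dots> = emeasure \<mu> (S \<inter> A) + emeasure \<mu> (T \<inter> A)"
        using p1 p2 by (simp add: emeasure_restr sets_mu)
      also have "\<dots> = emeasure \<mu> ((S \<inter> A) \<union> (T \<inter> A))"
        using cells by (intro plus_emeasure) (auto simp: sets_mu)
      also have "(S \<inter> A) \<union> (T \<inter> A) = A" using cells by auto
      finally show "emeasure (marginal_X \<sigma>) A = emeasure \<mu> A" .
    qed (simp add: marginal_X_def sets_mu)
    moreover have "marginal_Y \<sigma> = \<nu>"
    proof (rule measure_eqI)
      fix B assume "B \<in> sets (marginal_Y \<sigma>)"
      then have [measurable]: "B \<in> sets borel" by (simp add: marginal_Y_def)
      have e: "emeasure (marginal_Y (restr \<rho> (U \<times> UNIV))) B = emeasure \<rho> (U \<times> B)" if [measurable]: "U \<in> sets borel" for U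
      proof -
        have "U \<times> UNIV \<inter> UNIV \<times> B = U \<times> B" by auto
        then show ?thesis by (simp add: emeasure_marginals s emeasure_restr)
      qed
      have "emeasure (marginal_Y \<sigma>) B = emeasure (marginal_Y \<sigma>1) B + emeasure (marginal_Y \<sigma>2) B"
        by (simp add: emeasure_marginals \<sigma> s12)
      also have "\<dots> = emeasure \<rho> (S \<times> B) + emeasure \<rho> (T \<times> B)"
        using p1 p2 by (simp add: e)
      also have "\<dots> = emeasure \<rho> (S \<times> B \<union> T \<times> B)"
        using cells by (intro plus_emeasure) (auto simp: s)
      also have "S \<times> B \<union> T \<times> B = UNIV \<times> B" using cells by auto
      also have "emeasure \<rho> (UNIV \<times> B) = emeasure \<nu> B"
        using emeasure_marginals(2)[OF s, of B] mY by simp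
      finally show "emeasure (marginal_Y \<sigma>) B = emeasure \<nu> B" .
    qed (simp add: marginal_Y_def sets_nu)
    ultimately show "dens p \<in> couplings \<mu> \<nu>"
      using \<open>\<sigma> = dens p\<close> by (simp add: couplings_def sets_dens)
    show "\<exists>v. is_profile v \<and> (AE z in M. fst z \<in> S \<longrightarrow> p z = kern v z)"
    proof (intro exI conjI)
      show "AE z in M. fst z \<in> S \<longrightarrow> p z = kern v z"
        using p1(6)
      proof eventually_elim
        case (elim z) then show ?case using cells by (auto simp: p_def indicator_def)
      qed
    qed (rule p1(5))
    show "marginal_X (dens (cut T p)) = restr \<mu> T" "marginal_Y (dens (cut S p)) = marginal_Y (restr \<rho> (S \<times> UNIV))"
      "marginal_Y (dens (cut T p)) = marginal_Y (restr \<rho> (T \<times> UNIV))"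
      unfolding d by (simp_all add: p1 p2)
    fix q assume "admissible q" "marginal_X (dens q) = restr \<mu> T"
      "marginal_Y (dens q) = marginal_Y (restr \<rho> (T \<times> UNIV))"
    then show "Phi (cut T p) \<le> Phi q" unfolding d using p2 by (auto simp: optimal_def)
  qed
  ultimately show ?thesis by (rule that)
qed

text \<open>The two steps share \<open>B\<close>: the earlier one has blocks
  \<open>B \<union> P\<close> and \<open>A\<close>, the later one \<open>A \<union> B\<close> and
  \<open>P\<close>. The restriction of \<open>p'\<close> to \<open>P\<close> is a competitor for the
  cell problem on \<open>P\<close>.\<close>

lemma dd_step_contraction:
  assumes S: "A \<in> sets borel" "B \<in> sets borel" "P \<in> sets borel"
    and cells: "A \<inter> B = {}" "A \<inter> P = {}" "B \<inter> P = {}" "A \<union> B \<union> P = UNIV"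
    and pos: "measure \<mu> B > 0"
    and p': "dd_step (B \<union> P) A \<rho> p'" and p: "dd_step (A \<union> B) P (dens p') p"
    and q: "admissible q" "dens q \<in> couplings \<mu> \<nu>"
  shows "measure \<mu> P * (Phi p - Phi q) + \<kappa>\<^sup>2 * measure \<mu> B * (Phi p - Phi q) \<le> measure \<mu> P * (Phi p' - Phi q)"
proof -
  have a: "admissible p" "admissible p'" using p p' by (auto simp: dd_step_def)
  obtain v where v: "is_profile v" "AE z in M. fst z \<in> A \<union> B \<longrightarrow> p z = kern v z"
    using p by (auto simp: dd_step_def)
  obtain w where w: "is_profile w" "AE z in M. fst z \<in> B \<union> P \<longrightarrow> p' z = kern w z"
    using p' by (auto simp: dd_step_def)
  have c: "dens p \<in> couplings \<mu> \<nu>" "dens p' \<in> couplings \<mu> \<nu>" using p p' by (auto simp: dd_step_def)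
  have AB: "A \<union> B \<in> sets borel" using S by simp
  have X': "marginal_X (dens (cut P p')) = restr \<mu> P"
    using marginal_X_restr[OF sets_dens S(3), of p'] c(2)
    by (simp add: restr_dens[OF a(2) S(3)] couplings_def)
  show ?thesis
  proof (rule entropy_contraction[OF a q(1) S cells pos _ _ _ _ _ _ _ _ _ _ w v])
    show "marginal_Y (dens (cut (A \<union> B) p)) = marginal_Y (dens (cut (A \<union> B) p'))"
      using p by (simp add: dd_step_def restr_dens[OF a(2) AB])
    show "marginal_Y (dens (cut P p)) = marginal_Y (dens (cut P p'))"
      using p by (simp add: dd_step_def restr_dens[OF a(2) S(3)])
    show "marginal_X (dens (cut P p)) = marginal_X (dens (cut P p'))"
      using p X' by (simp add: dd_step_def)
    show "Phi (cut P p) \<le> Phi (cut P p')"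
      using p X' admissible_cut[OF a(2) S(3)] by (simp add: dd_step_def restr_dens[OF a(2) S(3)])
  qed (use c q in \<open>auto simp: couplings_def\<close>)
qed

lemma restr_mu_UNIV: "restr \<mu> UNIV = \<mu>"
  by (rule measure_eqI) (auto simp: emeasure_restr sets_mu)

text \<open>The minimizer \<open>q\<close> itself is \<open>kern v\<close> for a bounded profile, so
  its divergence from \<open>kern v\<close> is 0 and the entropy gap of any coupling equals its
  divergence from \<open>q\<close>. The Hellinger-type bound turns a small divergence into a small
  L1 distance.\<close>

lemma dens_convergence:
  assumes p: "\<And>n. admissible (p n)" "\<And>n. dens (p n) \<in> couplings \<mu> \<nu>"
    and q: "optimal q" "dens q \<in> couplings \<mu> \<nu>"
    and lim: "(\<lambda>n. Phi (p n) - Phi q) \<longlonglongrightarrow> 0"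
    and f[measurable]: "f \<in> borel_measurable (borel \<Otimes>\<^sub>M borel)" and fb: "\<And>z. \<bar>f z\<bar> \<le> (C::real)"
  shows "(\<lambda>n. \<integral>z. f z \<partial>dens (p n)) \<longlonglongrightarrow> (\<integral>z. f z \<partial>dens q)"
proof -
  have aq: "admissible q" using q by (simp add: optimal_def)
  note [measurable] = admissibleD(1)[OF aq] admissibleD(1)[OF p(1)]
  have mq: "marginal_X (dens q) = \<mu>" "marginal_Y (dens q) = \<nu>" using q(2) by (auto simp: couplings_def)
  have mp: "marginal_X (dens (p n)) = \<mu>" "marginal_Y (dens (p n)) = \<nu>" for n using p(2) by (auto simp: couplings_def)
  have U: "measure \<mu> UNIV = 1" using M1.prob_space by (simp add: space_mu)
  obtain u where u: "is_profile u" "AE z in M. q z = indicator UNIV (fst z) * kern u z"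
    by (rule optimal_factor[OF q(1), of UNIV]) (auto simp: mq restr_mu_UNIV U)
  have qu: "AE z in M. q z = kern u z" using u(2) by simp
  \<comment> \<open>Here the profile describes \<open>q\<close> over all of \<open>X\<close>, a cell
    of mass 1, so the second marginal \<open>\<nu>\<close> alone bounds \<open>u\<close> on both
    sides.\<close>
  have "AE y in \<nu>. \<kappa> \<le> u y \<and> u y \<le> 1 / \<kappa>"
  proof -
    have "density \<nu> (Y_density q) = density \<nu> (\<lambda>_. 1)"
      using mq(2) admissibleD(2)[OF aq] by (simp add: marginal_Y_dens density_1)
    then have one: "AE y in \<nu>. Y_density q y = 1" by (subst (asm) M2.density_unique_iff) auto
    have b: "AE y in \<nu>. ennreal (\<kappa> * u y * measure \<mu> UNIV) \<le> Y_density (cut UNIV q) y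
     \<and> Y_density (cut UNIV q) y \<le> ennreal (u y * measure \<mu> UNIV / \<kappa>)"
      by (rule Y_density_bounds[OF _ _ u(1)]) (use qu in \<open>auto elim: eventually_mono\<close>)
    then show ?thesis using one
    proof eventually_elim
      case (elim y)
      have 0: "0 \<le> u y / \<kappa>" using profileD(2)[OF u(1), of y] kappa_pos by simp
      have "ennreal (\<kappa> * u y) \<le> ennreal 1" "ennreal 1 \<le> ennreal (u y / \<kappa>)"
        using elim by (auto simp: U)
      then have "\<kappa> * u y \<le> 1" "1 \<le> u y / \<kappa>"
        using 0 by (subst (asm) ennreal_le_iff; simp)+
      then show ?case using kappa_pos by (simp add: field_simps)
    qed
  qed
  then obtain v where v: "is_profile v" "\<And>y. \<kappa> \<le> v y" "\<And>y. v y \<le> 1 / \<kappa>" "AE z in M. kern v z = kern u z"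
    by (rule clamp_profile[OF u(1) _ less_imp_le[OF kappa_pos]]) blast
  have bv: "bounded_profile v" using v kappa_pos by (auto simp: bounded_profile_def)
  have qv: "AE z in K. q z = kern v z" unfolding AE_K_iff using qu v(4) by eventually_elim simp
  have [measurable]: "v \<in> borel_measurable borel" by (rule profileD[OF v(1)])
  have kpos: "0 < kern v z" for z by (rule bounded_profile_logs[OF bv])
  have Dq: "bregman q v = 0"
  proof -
    have "bregman q v = (\<integral>z. 0 \<partial>K)" unfolding bregman_def
      by (rule integral_cong_AE) (use qv in \<open>auto elim!: eventually_mono simp: breg_def\<close>)
    then show ?thesis by simp
  qed
  define e where "e n = Phi (p n) - Phi q" for n
  have De: "bregman (p n) v = e n" for n
    using bregman_diff[OF p(1) aq bv, of n] by (simp add: mp mq Dq e_def)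
  have e0: "0 \<le> e n" for n
    unfolding De[symmetric] bregman_def using breg_nonneg[OF admissibleD(2)[OF p(1)] kpos] by simp
  have tot: "(\<integral>z. r z \<partial>K) = 1" if "admissible r" "marginal_X (dens r) = \<mu>" for r
    using integral_marginals(1)[OF that(1), of "\<lambda>_. 1" "\<lambda>_. 1"] that(2) M1.prob_space by simp
  have ir: "integrable K (\<lambda>z. r z * f z)" if "admissible r" for r
    by (rule integrable_admissible_mult[OF that f fb])
  have C: "0 \<le> C" using fb[of undefined] by linarith
  have bound: "\<bar>(\<integral>z. f z \<partial>dens (p n)) - (\<integral>z. f z \<partial>dens q)\<bar> \<le> C * (e n / (2 * d) + d * 2)" if d: "0 < d" for n d
  proof -
    have iq: "integrable K q" "integrable K (p n)" "integrable K (\<lambda>z. breg (p n z) (kern v z))"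
      using admissibleD(4)[OF aq] admissibleD(4)[OF p(1)] integrable_breg(1)[OF p(1) bv] by auto
    have "(\<integral>z. f z \<partial>dens (p n)) - (\<integral>z. f z \<partial>dens q) = (\<integral>z. p n z * f z - q z * f z \<partial>K)"
      using ir[OF p(1)[of n]] ir[OF aq] admissibleD(2)[OF aq] admissibleD(2)[OF p(1)]
      by (simp add: integral_dens)
    then have "\<bar>(\<integral>z. f z \<partial>dens (p n)) - (\<integral>z. f z \<partial>dens q)\<bar> \<le> (\<integral>z. \<bar>p n z * f z - q z * f z\<bar> \<partial>K)"
      using integral_abs_bound[of K "\<lambda>z. p n z * f z - q z * f z"] by simp
    also have "\<dots> \<le> (\<integral>z. C * (breg (p n z) (kern v z) / (2 * d) + d * (p n z + q z)) \<partial>K)"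
    proof (rule integral_mono_AE)
      show "AE z in K. \<bar>p n z * f z - q z * f z\<bar> \<le> C * (breg (p n z) (kern v z) / (2 * d) + d * (p n z + q z))"
        using qv
      proof eventually_elim
        case (elim z)
        have "\<bar>p n z * f z - q z * f z\<bar> = \<bar>f z\<bar> * \<bar>p n z - kern v z\<bar>"
          by (simp add: elim abs_mult[symmetric] algebra_simps)
        also have "\<dots> \<le> C * (breg (p n z) (kern v z) / (2 * d) + d * (p n z + kern v z))"
          using fb C abs_diff_le_breg[OF admissibleD(2)[OF p(1)] kpos d] by (intro mult_mono) auto
        finally show ?case using elim by simp
      qed
    qed (use ir[OF p(1)[of n]] ir[OF aq] iq in auto)
    also have "\<dots> = C * (bregman (p n) v / (2 * d) + d * 2)"
      using iq tot[OF p(1) mp(1), of n] tot[OF aq mq(1)] by (simp add: bregman_def)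
    finally show ?thesis by (simp add: De)
  qed
  define g where "g n = C * (sqrt (e n) / 2 + (sqrt (e n) + inverse (real (Suc n))) * 2)" for n
  have le: "\<bar>(\<integral>z. f z \<partial>dens (p n)) - (\<integral>z. f z \<partial>dens q)\<bar> \<le> g n" for n
  proof -
    \<comment> \<open>A \<open>d\<close> of the order of \<open>sqrt (e n)\<close> balances the two
      terms of \<open>bound\<close>; the added \<open>inverse (real (Suc n))\<close> keeps
      \<open>d\<close> positive when \<open>e n = 0\<close>.\<close>
    define d where "d = sqrt (e n) + inverse (real (Suc n))"
    have d: "0 < d" "sqrt (e n) \<le> d" using e0[of n] by (auto simp: d_def intro: add_nonneg_pos)
    have "e n = sqrt (e n) * sqrt (e n)" using e0[of n] by simp
    also have "\<dots> \<le> sqrt (e n) * d" using d e0[of n] by (intro mult_left_mono) auto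
    finally have "e n / (2 * d) \<le> sqrt (e n) / 2" using d by (simp add: field_simps)
    then show ?thesis using bound[OF d(1), of n] C unfolding g_def d_def[symmetric]
      by (elim order_trans) (auto intro!: mult_left_mono)
  qed
  have "g \<longlonglongrightarrow> C * (sqrt 0 / 2 + (sqrt 0 + 0) * 2)"
    unfolding g_def using lim LIMSEQ_inverse_real_of_nat by (intro tendsto_intros) (simp_all add: e_def)
  then have g: "g \<longlonglongrightarrow> 0" by simp
  have "(\<lambda>n. (\<integral>z. f z \<partial>dens (p n)) - (\<integral>z. f z \<partial>dens q)) \<longlonglongrightarrow> 0"
    by (rule Lim_null_comparison[OF _ g]) (use le in auto)
  then show ?thesis by (simp add: LIM_zero_iff)
qed

end

section \<open>The norm of the cost and the iterates of the algorithm\<close>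

lemma mass_restr: "S \<in> sets N \<Longrightarrow> mass (restr N S) = measure N S"
  using sets.sets_into_space[of S N]
  by (simp add: mass_def measure_def emeasure_restr restr_def[THEN arg_cong[of _ _ space]] Int_absorb2)

text \<open>The essential supremum is finite by membership in \<open>Linfty\<close> and non-negative
  because the whole space is not a null set. So \<open>real_of_ereal\<close> returns its true value
  and not the default for infinite arguments.\<close>

lemma Linfty_norm_AE:
  assumes "prob_space N" and c: "c \<in> Linfty N"
  shows "AE z in N. \<bar>c z\<bar> \<le> Linfty_norm N c" and "0 \<le> Linfty_norm N c"
proof -
  interpret prob_space N by fact
  let ?e = "esssup N (\<lambda>z. ereal \<bar>c z\<bar>)"
  have ae: "AE z in N. ereal \<bar>c z\<bar> \<le> ?e" by (rule esssup_AE)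
  have "0 \<le> ?e"
  proof (rule ccontr)
    assume n: "\<not> 0 \<le> ?e"
    have "AE z in N. False" using ae
    proof eventually_elim
      case (elim z)
      have "0 \<le> ereal \<bar>c z\<bar>" by simp
      then show ?case using elim n order_trans by blast
    qed
    then show False by simp
  qed
  moreover have "?e < \<infinity>" using c by (simp add: Linfty_def)
  ultimately obtain r where r: "?e = ereal r" "0 \<le> r" by (cases ?e) auto
  then show "0 \<le> Linfty_norm N c" by (simp add: Linfty_norm_def)
  show "AE z in N. \<bar>c z\<bar> \<le> Linfty_norm N c" using ae by (simp add: r Linfty_norm_def)
qed

context bounded_kernel
begin

text \<open>\<open>J1 \<noteq> J2\<close> ensures that the sum over the set \<open>{J1, J2}\<close>
  has two terms.\<close>

lemma domdec_dd_step:
  assumes \<rho>: "\<rho> \<in> couplings \<mu> \<nu>" and eps: "\<epsilon> > 0" and J: "J1 \<noteq> J2"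
    and cc: "composite_cell X J1 = S" "composite_cell X J2 = T"
    and S: "S \<in> sets borel" "T \<in> sets borel" "S \<inter> T = {}" "S \<union> T = UNIV"
    and pos: "measure \<mu> S > 0" "measure \<mu> T > 0"
    and min: "\<forall>J\<in>{J1, J2}. entropic_minimizer \<epsilon> K (restr \<mu> (composite_cell X J))
       (marginal_Y (restr \<rho> (composite_cell X J \<times> UNIV))) (\<sigma>J J)"
    and \<sigma>: "\<sigma> = sum_measure (borel \<Otimes>\<^sub>M borel) {J1, J2} \<sigma>J"
  shows "\<exists>p. \<sigma> = dens p \<and> dd_step S T \<rho> p"
proof -
  have s: "sets (\<sigma>J J) = sets (borel \<Otimes>\<^sub>M borel)" if "J \<in> {J1, J2}" for J
    using min that by (auto simp: entropic_minimizer_def is_arg_min_def couplings_def)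
  have m: "entropic_minimizer \<epsilon> K (restr \<mu> S) (marginal_Y (restr \<rho> (S \<times> UNIV))) (\<sigma>J J1)"
    "entropic_minimizer \<epsilon> K (restr \<mu> T) (marginal_Y (restr \<rho> (T \<times> UNIV))) (\<sigma>J J2)"
    using min cc by auto
  have "emeasure \<sigma> A = emeasure (\<sigma>J J1) A + emeasure (\<sigma>J J2) A" if "A \<in> sets (borel \<Otimes>\<^sub>M borel)" for A
    unfolding \<sigma> by (subst emeasure_sum_measure) (use s that J in auto)
  moreover have "sets \<sigma> = sets (borel \<Otimes>\<^sub>M borel)" by (simp add: \<sigma> sets_sum_measure)
  ultimately obtain p where "\<sigma> = dens p" "dd_step S T \<rho> p"
    using dd_stepI[OF \<rho> eps S pos m] by blast
  then show ?thesis by blast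
qed

text \<open>The global problem is the cell problem of the cell \<open>UNIV\<close>.\<close>

lemma entropic_minimizer_dens:
  assumes "entropic_minimizer \<epsilon> K \<mu> \<nu> \<rho>" and eps: "\<epsilon> > 0"
  obtains q where "optimal q" "\<rho> = dens q" "dens q \<in> couplings \<mu> \<nu>"
proof -
  have "entropic_minimizer \<epsilon> K (restr \<mu> UNIV) \<nu> \<rho>" using assms(1) by (simp add: restr_mu_UNIV)
  then obtain q where "optimal q" "\<rho> = dens q" "marginal_X (dens q) = restr \<mu> UNIV" "marginal_Y (dens q) = \<nu>"
    by (rule entropic_minimizer_optimal[OF _ eps])
       (use M1.prob_space M2.emeasure_space_1 M1.emeasure_space_1 in \<open>auto simp: space_mu space_nu sets_nu\<close>)
  then show ?thesis by (intro that[of q]) (auto simp: couplings_def sets_dens restr_mu_UNIV)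
qed

text \<open>\<open>p n\<close> is the density of iterate \<open>n + 1\<close>. The start
  \<open>\<pi> 0\<close> is an arbitrary coupling, possibly of infinite entropy, and the estimate
  uses the profiles of two consecutive solved steps.\<close>

lemma domdec_contraction:
  assumes eps: "\<epsilon> > 0" and part: "basic_partition \<mu> {1, 2, 3} X"
    and iter: "\<pi> 0 \<in> couplings \<mu> \<nu>"
     "\<And>l. l \<ge> 1 \<Longrightarrow> \<exists>\<pi>J. (\<forall>J\<in>(if odd l then {{1, 2}, {3}} else {{1}, {2, 3}}).
          entropic_minimizer \<epsilon> K (restr \<mu> (composite_cell X J))
            (marginal_Y (restr (\<pi> (l - 1)) (composite_cell X J \<times> UNIV))) (\<pi>J J)) \<and>
        \<pi> l = sum_measure (borel \<Otimes>\<^sub>M borel) (if odd l then {{1, 2}, {3}} else {{1}, {2, 3::nat}}) \<pi>J"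
    and q: "optimal q" "dens q \<in> couplings \<mu> \<nu>"
  obtains p where "\<And>n. \<pi> (Suc n) = dens (p n)" "\<And>n. admissible (p n)" "\<And>n. dens (p n) \<in> couplings \<mu> \<nu>"
    "\<And>n. Phi q \<le> Phi (p n)"
    "\<And>n. Phi (p (Suc n)) - Phi q \<le> inverse (1 + \<kappa>\<^sup>2 * (measure \<mu> (X 2) / (measure \<mu> (X 1) + measure \<mu> (X 3))))
       * (Phi (p n) - Phi q)"
proof -
  have X: "X 1 \<in> sets borel" "X 2 \<in> sets borel" "X 3 \<in> sets borel"
    and m: "0 < measure \<mu> (X 1)" "0 < measure \<mu> (X 2)" "0 < measure \<mu> (X 3)"
    and dj: "X 1 \<inter> X 2 = {}" "X 1 \<inter> X 3 = {}" "X 2 \<inter> X 3 = {}" "X 1 \<union> X 2 \<union> X 3 = UNIV"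
    using part by (auto simp: basic_partition_def mass_restr sets_mu disjoint_family_on_def)
  have mono: "0 < measure \<mu> (X i \<union> X j)" if "i \<in> {1,2,3}" "j \<in> {1,2,3}" for i j
  proof -
    have "measure \<mu> (X i) \<le> measure \<mu> (X i \<union> X j)"
      by (rule M1.finite_measure_mono) (use X that in \<open>auto simp: sets_mu\<close>)
    moreover have "0 < measure \<mu> (X i)" using m that by auto
    ultimately show ?thesis by simp
  qed
  \<comment> \<open>\<open>S n\<close> and \<open>T n\<close> are the cells of step
    \<open>n + 1\<close>, so the parity is opposite to that in the algorithm.\<close>
  define S where "S n = (if even n then X 1 \<union> X 2 else X 2 \<union> X 3)" for n :: nat
  define T where "T n = (if even n then X 3 else X 1)" for n :: nat
  have ex: "\<exists>p. \<pi> (Suc n) = dens p \<and> dd_step (S n) (T n) (\<pi> n) p" if c: "\<pi> n \<in> couplings \<mu> \<nu>" for n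
  proof (cases "even n")
    case True
    then obtain \<pi>J where \<pi>J: "\<forall>J\<in>{{1, 2}, {3}}. entropic_minimizer \<epsilon> K (restr \<mu> (composite_cell X J))
            (marginal_Y (restr (\<pi> n) (composite_cell X J \<times> UNIV))) (\<pi>J J)"
       "\<pi> (Suc n) = sum_measure (borel \<Otimes>\<^sub>M borel) {{1, 2}, {3}} \<pi>J"
      using iter(2)[of "Suc n"] by auto
    show ?thesis
      by (rule domdec_dd_step[OF c eps _ _ _ _ _ _ _ _ _ \<pi>J])
         (use True X m dj mono[of 1 2] in \<open>auto simp: S_def T_def composite_cell_def\<close>)
  next
    case False
    then obtain \<pi>J where \<pi>J: "\<forall>J\<in>{{1}, {2, 3}}. entropic_minimizer \<epsilon> K (restr \<mu> (composite_cell X J))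
            (marginal_Y (restr (\<pi> n) (composite_cell X J \<times> UNIV))) (\<pi>J J)"
       "\<pi> (Suc n) = sum_measure (borel \<Otimes>\<^sub>M borel) {{1}, {2, 3}} \<pi>J"
      using iter(2)[of "Suc n"] by auto
    \<comment> \<open>The two-cell block is put first, since the profile is kept for the first
      cell.\<close>
    have \<pi>J': "\<forall>J\<in>{{2, 3}, {1}}. entropic_minimizer \<epsilon> K (restr \<mu> (composite_cell X J))
            (marginal_Y (restr (\<pi> n) (composite_cell X J \<times> UNIV))) (\<pi>J J)"
       "\<pi> (Suc n) = sum_measure (borel \<Otimes>\<^sub>M borel) {{2, 3}, {1}} \<pi>J"
      using \<pi>J by (auto simp: insert_commute)
    show ?thesis
      by (rule domdec_dd_step[OF c eps _ _ _ _ _ _ _ _ _ \<pi>J'])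
         (use False X m dj mono[of 2 3] in \<open>auto simp: S_def T_def composite_cell_def\<close>)
  qed
  have c: "\<pi> n \<in> couplings \<mu> \<nu>" for n
  proof (induction n)
    case (Suc n)
    from ex[OF Suc] show ?case by (auto simp: dd_step_def)
  qed (rule iter(1))
  obtain p where p: "\<And>n. \<pi> (Suc n) = dens (p n)" "\<And>n. dd_step (S n) (T n) (\<pi> n) (p n)"
    using ex[OF c] by metis
  have a: "admissible (p n)" "dens (p n) \<in> couplings \<mu> \<nu>" for n using p(2)[of n] by (auto simp: dd_step_def)
  have aq: "admissible q" using q by (simp add: optimal_def)
  have le: "Phi q \<le> Phi (p n)" for n
    using q a[of n] by (auto simp: optimal_def couplings_def)
  have dd: "dd_step (S (Suc n)) (T (Suc n)) (dens (p n)) (p (Suc n))" for n using p(2)[of "Suc n"] by (simp add: p(1))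
  define m13 where "m13 = measure \<mu> (X 1) + measure \<mu> (X 3)"
  have contr: "Phi (p (Suc n)) - Phi q \<le> inverse (1 + \<kappa>\<^sup>2 * (measure \<mu> (X 2) / m13)) * (Phi (p n) - Phi q)" for n
  proof -
    define d where "d = Phi (p n) - Phi q"
    define d' where "d' = Phi (p (Suc n)) - Phi q"
    define mP where "mP = measure \<mu> (T (Suc n))"
    have mP: "0 < mP" "mP \<le> m13" using m by (auto simp: mP_def T_def m13_def)
    have "mP * d' + \<kappa>\<^sup>2 * measure \<mu> (X 2) * d' \<le> mP * d"
    proof (cases "even n")
      case True
      have "dd_step (X 2 \<union> X 1) (X 3) (\<pi> n) (p n)" "dd_step (X 3 \<union> X 2) (X 1) (dens (p n)) (p (Suc n))"
        using p(2)[of n] dd[of n] True by (simp_all add: S_def T_def Un_commute)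
      from dd_step_contraction[OF X(3,2,1) _ _ _ _ m(2) this aq q(2)] show ?thesis
        using dj True by (auto simp: mP_def T_def d_def d'_def)
    next
      case False
      have "dd_step (X 2 \<union> X 3) (X 1) (\<pi> n) (p n)" "dd_step (X 1 \<union> X 2) (X 3) (dens (p n)) (p (Suc n))"
        using p(2)[of n] dd[of n] False by (simp_all add: S_def T_def)
      from dd_step_contraction[OF X dj m(2) this aq q(2)] show ?thesis
        using False by (auto simp: mP_def T_def d_def d'_def)
    qed
    then have "d' + \<kappa>\<^sup>2 * (measure \<mu> (X 2) / mP) * d' \<le> d" using mP by (simp add: field_simps)
    \<comment> \<open>The mass of the current single outer cell is replaced by that of both outer
      cells. This weakens the estimate because \<open>d'\<close> is non-negative by minimality of
      \<open>q\<close>.\<close>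
    moreover have "\<kappa>\<^sup>2 * (measure \<mu> (X 2) / m13) * d' \<le> \<kappa>\<^sup>2 * (measure \<mu> (X 2) / mP) * d'"
      using mP m le by (intro mult_right_mono mult_left_mono divide_left_mono) (auto simp: d'_def)
    ultimately have "(1 + \<kappa>\<^sup>2 * (measure \<mu> (X 2) / m13)) * d' \<le> d" by (simp add: distrib_right)
    moreover have "0 < 1 + \<kappa>\<^sup>2 * (measure \<mu> (X 2) / m13)"
      using mP m by (intro add_pos_nonneg mult_nonneg_nonneg divide_nonneg_nonneg) auto
    ultimately show ?thesis unfolding d_def[symmetric] d'_def[symmetric] by (simp add: field_simps)
  qed
  show ?thesis by (rule that[of p]) (use p a le contr in \<open>auto simp: m13_def\<close>)
qed

end

theorem theorem4p3:
  fixes \<mu> :: "'a::metric_space measure" and \<nu> :: "'b::metric_space measure"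
    and c :: "'a \<times> 'b \<Rightarrow> real" and \<epsilon> :: real
    and X :: "nat \<Rightarrow> 'a set"
    and \<pi> :: "nat \<Rightarrow> ('a \<times> 'b) measure" and \<pi>s :: "('a \<times> 'b) measure"
  assumes "compact (UNIV :: 'a set)" and "compact (UNIV :: 'b set)"
    and "prob_space \<mu>" and "sets \<mu> = sets borel"
    and "prob_space \<nu>" and "sets \<nu> = sets borel"
    and "c \<in> Linfty (\<mu> \<Otimes>\<^sub>M \<nu>)" and "AE z in \<mu> \<Otimes>\<^sub>M \<nu>. 0 \<le> c z"
    and "\<epsilon> > 0"
    and "basic_partition \<mu> {1, 2, 3} X"
    and "domdec_iterates \<epsilon> c \<mu> \<nu> X {{1, 2}, {3}} {{1}, {2, 3}} \<pi>"
    and "entropic_minimizer \<epsilon> (gibbs \<epsilon> c \<mu> \<nu>) \<mu> \<nu> \<pi>s"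
  shows "(\<forall>l>1. subopt (gibbs \<epsilon> c \<mu> \<nu>) \<pi>s (\<pi> l)
            \<le> ereal (inverse (1 + exp (- 2 * Linfty_norm (\<mu> \<Otimes>\<^sub>M \<nu>) c / \<epsilon>)
                  * (mass (restr \<mu> (X 2)) / mass (sum_measure \<mu> {1, 3} (\<lambda>i. restr \<mu> (X i))))))
              * subopt (gibbs \<epsilon> c \<mu> \<nu>) \<pi>s (\<pi> (l - 1)))
         \<and> weak_star_tendsto \<pi> \<pi>s"
proof -
  interpret mu: prob_space \<mu> by fact
  interpret nu: prob_space \<nu> by fact
  interpret mn: pair_prob_space \<mu> \<nu> ..
  note [measurable_cong] = assms(4,6)
  have [measurable]: "c \<in> borel_measurable (borel \<Otimes>\<^sub>M borel)"
    using assms(7) by (simp add: Linfty_def measurable_cong_sets[OF sets_pair_measure_cong[OF assms(4,6)] refl])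
  define C where "C = Linfty_norm (\<mu> \<Otimes>\<^sub>M \<nu>) c"
  have C: "AE z in \<mu> \<Otimes>\<^sub>M \<nu>. \<bar>c z\<bar> \<le> C" "0 \<le> C"
    unfolding C_def by (intro Linfty_norm_AE assms mn.P.prob_space_axioms)+
  \<comment> \<open>The cost is truncated to lie between 0 and its norm; this makes the kernel
    bounds hold everywhere and changes the Gibbs density only on a null set.\<close>
  define k where "k z = exp (- max 0 (min C (c z)) / \<epsilon>)" for z
  define \<kappa> where "\<kappa> = exp (- C / \<epsilon>)"
  interpret bounded_kernel \<mu> \<nu> k \<kappa>
  proof
    show "sets \<mu> = sets borel" "sets \<nu> = sets borel" by fact+
    show "k \<in> borel_measurable (borel \<Otimes>\<^sub>M borel)" unfolding k_def by measurable
    show "0 < \<kappa>" by (simp add: \<kappa>_def)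
    show "\<kappa> \<le> k z" "k z \<le> 1" for z using assms(9) C(2) by (auto simp: \<kappa>_def k_def divide_right_mono)
  qed
  have K: "gibbs \<epsilon> c \<mu> \<nu> = K" unfolding gibbs_def K_def
  proof (rule density_cong)
    show "AE z in \<mu> \<Otimes>\<^sub>M \<nu>. ennreal (exp (- c z / \<epsilon>)) = ennreal (k z)"
      using C(1) assms(8) by eventually_elim (simp add: k_def)
  qed measurable
  obtain q where q: "optimal q" "\<pi>s = dens q" "dens q \<in> couplings \<mu> \<nu>"
    using entropic_minimizer_dens[OF assms(12)[unfolded K] assms(9)] by metis
  have aq: "admissible q" using q by (simp add: optimal_def)
  define r where "r = inverse (1 + \<kappa>\<^sup>2 * (measure \<mu> (X 2) / (measure \<mu> (X 1) + measure \<mu> (X 3))))"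
  obtain p where p: "\<And>n. \<pi> (Suc n) = dens (p n)" "\<And>n. admissible (p n)" "\<And>n. dens (p n) \<in> couplings \<mu> \<nu>"
    "\<And>n. Phi q \<le> Phi (p n)" "\<And>n. Phi (p (Suc n)) - Phi q \<le> r * (Phi (p n) - Phi q)"
  proof (rule domdec_contraction[OF assms(9,10) _ _ q(1,3)])
    show "\<pi> 0 \<in> couplings \<mu> \<nu>" using assms(11) by (simp add: domdec_iterates_def)
    show "\<exists>\<pi>J. (\<forall>J\<in>(if odd l then {{1, 2}, {3}} else {{1}, {2, 3}}).
          entropic_minimizer \<epsilon> K (restr \<mu> (composite_cell X J))
            (marginal_Y (restr (\<pi> (l - 1)) (composite_cell X J \<times> UNIV))) (\<pi>J J)) \<and>
        \<pi> l = sum_measure (borel \<Otimes>\<^sub>M borel) (if odd l then {{1, 2}, {3}} else {{1}, {2, 3}}) \<pi>J" if "l \<ge> 1" for l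
      using assms(11)[unfolded domdec_iterates_def Let_def K, THEN conjunct2, rule_format, OF that] .
  qed (simp add: r_def)
  have X: "X 1 \<in> sets \<mu>" "X 2 \<in> sets \<mu>" "X 3 \<in> sets \<mu>"
    and m: "0 < measure \<mu> (X 1)" "0 < measure \<mu> (X 2)" "0 < measure \<mu> (X 3)"
    using assms(10) by (auto simp: basic_partition_def mass_restr assms(4))
  have m13: "mass (sum_measure \<mu> {1, 3} (\<lambda>i. restr \<mu> (X i))) = measure \<mu> (X 1) + measure \<mu> (X 3)"
  proof -
    have "emeasure (sum_measure \<mu> {1, 3} (\<lambda>i. restr \<mu> (X i))) (space \<mu>) = emeasure \<mu> (X 1) + emeasure \<mu> (X 3)"
      using X by (subst emeasure_sum_measure) (auto simp: emeasure_restr)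
    also have "\<dots> = ennreal (measure \<mu> (X 1) + measure \<mu> (X 3))"
      by (simp add: mu.emeasure_eq_measure ennreal_plus)
    finally show ?thesis
      by (simp add: mass_def measure_def[of "sum_measure _ _ _"] sets_eq_imp_space_eq[OF sets_sum_measure]
          del: ennreal_plus)
  qed
  have r_eq: "inverse (1 + exp (- 2 * Linfty_norm (\<mu> \<Otimes>\<^sub>M \<nu>) c / \<epsilon>)
      * (mass (restr \<mu> (X 2)) / mass (sum_measure \<mu> {1, 3} (\<lambda>i. restr \<mu> (X i))))) = r"
  proof -
    have "exp (- 2 * C / \<epsilon>) = \<kappa>\<^sup>2" by (simp add: \<kappa>_def power2_eq_square exp_add[symmetric])
    then show ?thesis unfolding C_def[symmetric] m13 mass_restr[OF X(2)] r_def by (simp only:)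
  qed
  \<comment> \<open>From the first iterate on all entropies are finite, so the difference of
    extended reals is an ordinary one.\<close>
  have sub: "subopt K \<pi>s (\<pi> (Suc n)) = ereal (Phi (p n) - Phi q)" for n
    using aq p(2) by (simp add: KL_admissible subopt_def p(1) q(2))
  have "subopt K \<pi>s (\<pi> l) \<le> ereal r * subopt K \<pi>s (\<pi> (l - 1))" if l: "l > 1" for l
  proof -
    obtain n where "l = Suc (Suc n)" using less_imp_Suc_add[OF l] by auto
    then show ?thesis using p(5)[of n] by (simp add: sub)
  qed
  moreover have "weak_star_tendsto \<pi> \<pi>s"
    unfolding weak_star_tendsto_def
  proof (intro allI impI)
    fix f :: "'a \<times> 'b \<Rightarrow> real" assume f: "continuous_on UNIV f"
    show "(\<lambda>l. integral\<^sup>L (\<pi> l) f) \<longlonglongrightarrow> integral\<^sup>L \<pi>s f"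
    proof (cases "f \<in> borel_measurable (borel \<Otimes>\<^sub>M borel)")
      case True
      have "compact (UNIV :: ('a \<times> 'b) set)" using compact_Times[OF assms(1,2)] by simp
      then have "bounded (range f)" using f by (intro compact_imp_bounded compact_continuous_image)
      then obtain B where B: "\<And>z. \<bar>f z\<bar> \<le> B" by (auto simp: bounded_iff)
      have "0 < \<kappa>\<^sup>2 * (measure \<mu> (X 2) / (measure \<mu> (X 1) + measure \<mu> (X 3)))"
        using m kappa_pos by (intro mult_pos_pos divide_pos_pos add_pos_pos) auto
      \<comment> \<open>The middle cell has positive mass, so the factor is strictly below 1 and the
        suboptimality decays geometrically.\<close>
      then have r: "0 \<le> r" "r < 1" unfolding r_def by (simp_all add: inverse_less_1_iff)
      have d: "Phi (p n) - Phi q \<le> r ^ n * (Phi (p 0) - Phi q)" for n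
      proof (induction n)
        case (Suc n)
        have "r * (Phi (p n) - Phi q) \<le> r * (r ^ n * (Phi (p 0) - Phi q))"
          by (intro mult_left_mono Suc r)
        then show ?case using p(5)[of n] by simp
      qed simp
      have "(\<lambda>n. r ^ n * (Phi (p 0) - Phi q)) \<longlonglongrightarrow> 0"
        using r by (intro tendsto_mult_left_zero LIMSEQ_power_zero) auto
      then have "(\<lambda>n. Phi (p n) - Phi q) \<longlonglongrightarrow> 0"
        by (rule tendsto_sandwich[OF _ _ tendsto_const, rotated 2]) (use p(4) d in auto)
      from dens_convergence[OF p(2,3) q(1,3) this True B]
      have "(\<lambda>n. integral\<^sup>L (\<pi> (Suc n)) f) \<longlonglongrightarrow> integral\<^sup>L \<pi>s f" by (simp add: p(1) q(2))
      then show ?thesis by (rule LIMSEQ_imp_Suc)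
    next
      case False
      \<comment> \<open>If \<open>f\<close> failed to be measurable for the product sigma-algebra,
        all integrals involved would take the default value 0 and the convergence would be
        trivial.\<close>
      have z: "integral\<^sup>L N f = 0" if "sets N = sets (borel \<Otimes>\<^sub>M borel)" for N
      proof (rule not_integrable_integral_eq)
        show "\<not> integrable N f"
        proof
          assume "integrable N f"
          then have "f \<in> borel_measurable N" by simp
          then show False using False by (simp add: measurable_cong_sets[OF that refl])
        qed
      qed
      have "integral\<^sup>L (\<pi> l) f = 0" for l
      proof (rule z)
        show "sets (\<pi> l) = sets (borel \<Otimes>\<^sub>M borel)"
          using assms(11) by (cases l) (auto simp: p(1) sets_dens domdec_iterates_def couplings_def)
      qed
      then show ?thesis by (simp add: z q(2) sets_dens)
    qed
  qed
  ultimately show ?thesis unfolding K r_eq by (intro conjI allI impI)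
qed

end
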